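(* Let $0\to B\to C\to D\to0$ be a short exact sequence in $\mathcal C$, let $(0\to\widetilde B_k\to\widetilde C_k\to\widetilde D_k\to0)_{k\in\mathbb N_0}$ be a sequence of short exact sequences of syzygies obtained from the Horseshoe Lemma, let $A\in\mathrm{obj}(\mathcal C)$ with projective resolution $A_\bullet$, and let $n\in\mathbb Z$. For every $k\in\mathbb N_0$ with $n+k\ge1$ one has $$\tau_{n+k,k}\circ\beta_{n+k}(\widetilde D_k)=\beta_{n+k+1}(\widetilde B_k)\circ\delta^{n+k}:\ \mathrm{Ext}_{\mathcal C}^{n+k}(A,\widetilde D_k)\to[\widetilde A_{n+k+1},\widetilde B_k]_{\mathcal C}$$ and $$t_{\widetilde A_{n+k+1},\widetilde B_k}\circ(-1)^k\tau_{n+k,k}=(-1)^{k+1}\tau_{n+k+1,k+1}\circ t_{\widetilde A_{n+k},\widetilde D_k}:\ [\widetilde A_{n+k},\widetilde D_k]_{\mathcal C}\to[\widetilde A_{n+k+2},\widetilde B_{k+1}]_{\mathcal C}.$$ The homomorphism in the direct limit $$\tau^n:=\varinjlim_{k\in\mathbb N_0,\,n+k\ge1}(-1)^k\tau_{n+k,k}:\ BC_{\mathcal C}^n(A,D)\to BC_{\mathcal C}^{n+1}(A,B)$$ defines the connecting homomorphism in the naïve construction, and it satisfies $\tau^n\circ\beta^n(D)=\beta^{n+1}(B)\circ\widehat\delta^n:\widehat{\mathrm{Ext}}_{\mathcal C}^n(A,D)\to BC_{\mathcal C}^{n+1}(A,B)$.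
   Context: $\mathcal C$ is an abelian category with enough projectives; $\mathrm{Ext}_{\mathcal C}^n(A,-):\mathcal C\to\mathbf{Ab}$ with its usual connecting homomorphisms $\delta^n$. For an object $M$ with projective resolution $M_\bullet$, the syzygies are $\widetilde M_0=M$, $\widetilde M_k=\mathrm{Ker}(M_{k-1}\to\widetilde M_{k-1})$. Horseshoe: the sequences $0\to\widetilde B_k\to\widetilde C_k\to\widetilde D_k\to0$ are the syzygy sequences of projective resolutions $B_\bullet,C_\bullet,D_\bullet$ fitting in short exact sequences $0\to B_k\to C_k\to D_k\to0$ compatible with the maps to the syzygies. $[X,Y]_{\mathcal C}=\mathrm{Hom}_{\mathcal C}(X,Y)/\mathcal P_{\mathcal C}(X,Y)$, with $\mathcal P_{\mathcal C}(X,Y)$ the subgroup of morphisms factoring through a projective. For $f:\widetilde A_{n+k}\to\widetilde Y_k$ choose a lift $A_{n+k}\to Y_k$ and let $\overline f^*:\widetilde A_{n+k+1}\to\widetilde Y_{k+1}$ be the induced morphism; $t_{\widetilde A_{n+k},\widetilde Y_k}:[\widetilde A_{n+k},\widetilde Y_k]_{\mathcal C}\to[\widetilde A_{n+k+1},\widetilde Y_{k+1}]_{\mathcal C}$ sends the class of $f$ to that of $\overline f^*$; this is a well-defined homomorphism (likewise for $t_{\widetilde A_{n+k+1},\widetilde B_k}$, with $A$-index $n+k+1$). $BC_{\mathcal C}^n(A,Y)=\varinjlim_{k\in\mathbb N_0,\,n+k\ge0}([\widetilde A_{n+k},\widetilde Y_k]_{\mathcal C},t_{\widetilde A_{n+k},\widetilde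 Y_k})$. $\tau_{n+k,k}:[\widetilde A_{n+k},\widetilde D_k]_{\mathcal C}\to[\widetilde A_{n+k+1},\widetilde B_k]_{\mathcal C}$ sends the class of $f$ to the class of $h^*\circ\overline f^*$, where $h:D_k\to\widetilde C_k$ is a lift of $\mathrm{id}_{\widetilde D_k}$ (i.e. $D_k\to\widetilde C_k\to\widetilde D_k$ is the given epimorphism) and $h^*:\widetilde D_{k+1}\to\widetilde B_k$ is the induced morphism; it is independent of the choice of $h$. For $m\ge1$, write the differential of $A_\bullet$ as $\partial_m:A_m\xrightarrow{\pi_m}\widetilde A_m\xrightarrow{\iota_m}A_{m-1}$. $\beta_m(Y):\mathrm{Ext}_{\mathcal C}^m(A,Y)\to[\widetilde A_m,Y]_{\mathcal C}$ sends the class of $f\in\mathrm{Ker}(\mathrm{Hom}_{\mathcal C}(\partial_{m+1},Y))$ to the class of the unique $f':\widetilde A_m\to Y$ with $f=f'\circ\pi_m$. The completed Ext-functor (resolution construction) is $\widehat{\mathrm{Ext}}_{\mathcal C}^n(A,Y)=\varinjlim_{k\in\mathbb N_0}(\mathrm{Ext}_{\mathcal C}^{n+k}(A,\widetilde Y_k),\delta^{n+k})$ ($\mathrm{Ext}^m=0$ for $m<0$), using the connecting homomorphisms of $0\to\widetilde Y_{k+1}\to Y_k\to\widetilde Y_k\to0$, and for $0\to B\to C\to D\to0$ its connecting homomorphism is $\widehat\delta^n=\varinjlim_k(-1)^k\delta^{n+k}$ with $\delta^{n+k}:\mathrm{Ext}_{\mathcal C}^{n+k}(A,\widetilde D_k)\to\mathrm{Ext}_{\mathcal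 C}^{n+k+1}(A,\widetilde B_k)$ (the $\delta^{n+k}$ in the first displayed identity of the claim is this one). $\beta^n(Y)=\varinjlim_{k,\,n+k\ge1}\beta_{n+k}(\widetilde Y_k):\widehat{\mathrm{Ext}}_{\mathcal C}^n(A,Y)\to BC_{\mathcal C}^n(A,Y)$. *)

theory Defs
  imports "HOL-Algebra.Coset" "HOL-Algebra.Elementary_Groups"
begin

section \<open>Abelian categories\<close>

text \<open>
  An arrow determines its domain and codomain, so hom-sets are pairwise disjoint.
  Composition is written in the usual (right-to-left) order, and \<open>Cmp\<close> and \<open>Add\<close>
  are only meaningful on composable, respectively parallel, arrows.
\<close>

record ('o, 'm) cat =
  Obj :: "'o set"
  Arr :: "'m set"
  Dom :: "'m \<Rightarrow> 'o"
  Cod :: "'m \<Rightarrow> 'o"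
  Idm :: "'o \<Rightarrow> 'm"
  Cmp :: "'m \<Rightarrow> 'm \<Rightarrow> 'm"  (infixl "\<cdot>\<index>" 70)
  Add :: "'m \<Rightarrow> 'm \<Rightarrow> 'm"
  Nul :: "'o \<Rightarrow> 'o \<Rightarrow> 'm"

definition Hom :: "('o, 'm) cat \<Rightarrow> 'o \<Rightarrow> 'o \<Rightarrow> 'm set" where
  "Hom \<C> X Y = {f \<in> Arr \<C>. Dom \<C> f = X \<and> Cod \<C> f = Y}"

definition hom_grp :: "('o, 'm) cat \<Rightarrow> 'o \<Rightarrow> 'o \<Rightarrow> 'm monoid" where
  "hom_grp \<C> X Y = \<lparr>carrier = Hom \<C> X Y, mult = Add \<C>, one = Nul \<C> X Y\<rparr>"

definition is_mono :: "('o, 'm) cat \<Rightarrow> 'm \<Rightarrow> bool" where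
  "is_mono \<C> f \<longleftrightarrow> f \<in> Arr \<C> \<and>
     (\<forall>W. \<forall>g\<in>Hom \<C> W (Dom \<C> f). \<forall>h\<in>Hom \<C> W (Dom \<C> f).
        f \<cdot>\<^bsub>\<C>\<^esub> g = f \<cdot>\<^bsub>\<C>\<^esub> h \<longrightarrow> g = h)"

definition is_epi :: "('o, 'm) cat \<Rightarrow> 'm \<Rightarrow> bool" where
  "is_epi \<C> f \<longleftrightarrow> f \<in> Arr \<C> \<and>
     (\<forall>W. \<forall>g\<in>Hom \<C> (Cod \<C> f) W. \<forall>h\<in>Hom \<C> (Cod \<C> f) W.
        g \<cdot>\<^bsub>\<C>\<^esub> f = h \<cdot>\<^bsub>\<C>\<^esub> f \<longrightarrow> g = h)"

text \<open>\<open>is_kernel \<C> f k\<close>: the arrow \<open>k\<close> is a kernel of \<open>f\<close>; dually for cokernels.\<close>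

definition is_kernel :: "('o, 'm) cat \<Rightarrow> 'm \<Rightarrow> 'm \<Rightarrow> bool" where
  "is_kernel \<C> f k \<longleftrightarrow> f \<in> Arr \<C> \<and> k \<in> Arr \<C> \<and> Cod \<C> k = Dom \<C> f \<and>
     f \<cdot>\<^bsub>\<C>\<^esub> k = Nul \<C> (Dom \<C> k) (Cod \<C> f) \<and>
     (\<forall>W. \<forall>g\<in>Hom \<C> W (Dom \<C> f). f \<cdot>\<^bsub>\<C>\<^esub> g = Nul \<C> W (Cod \<C> f) \<longrightarrow>
        (\<exists>!u. u \<in> Hom \<C> W (Dom \<C> k) \<and> k \<cdot>\<^bsub>\<C>\<^esub> u = g))"

definition is_cokernel :: "('o, 'm) cat \<Rightarrow> 'm \<Rightarrow> 'm \<Rightarrow> bool" where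
  "is_cokernel \<C> f c \<longleftrightarrow> f \<in> Arr \<C> \<and> c \<in> Arr \<C> \<and> Dom \<C> c = Cod \<C> f \<and>
     c \<cdot>\<^bsub>\<C>\<^esub> f = Nul \<C> (Dom \<C> f) (Cod \<C> c) \<and>
     (\<forall>W. \<forall>g\<in>Hom \<C> (Cod \<C> f) W. g \<cdot>\<^bsub>\<C>\<^esub> f = Nul \<C> (Dom \<C> f) W \<longrightarrow>
        (\<exists>!u. u \<in> Hom \<C> (Cod \<C> c) W \<and> u \<cdot>\<^bsub>\<C>\<^esub> c = g))"

definition is_zero_object :: "('o, 'm) cat \<Rightarrow> 'o \<Rightarrow> bool" where
  "is_zero_object \<C> Z \<longleftrightarrow> Z \<in> Obj \<C> \<and>
     (\<forall>X\<in>Obj \<C>. (\<exists>!f. f \<in> Hom \<C> X Z) \<and> (\<exists>!f. f \<in> Hom \<C> Z X))"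

definition is_product :: "('o, 'm) cat \<Rightarrow> 'o \<Rightarrow> 'o \<Rightarrow> 'o \<Rightarrow> 'm \<Rightarrow> 'm \<Rightarrow> bool" where
  "is_product \<C> X Y P p q \<longleftrightarrow> P \<in> Obj \<C> \<and> p \<in> Hom \<C> P X \<and> q \<in> Hom \<C> P Y \<and>
     (\<forall>W. \<forall>f\<in>Hom \<C> W X. \<forall>g\<in>Hom \<C> W Y.
        \<exists>!u. u \<in> Hom \<C> W P \<and> p \<cdot>\<^bsub>\<C>\<^esub> u = f \<and> q \<cdot>\<^bsub>\<C>\<^esub> u = g)"

locale cat =
  fixes \<C> :: "('o, 'm) cat" (structure)
  assumes Dom_Obj: "f \<in> Arr \<C> \<Longrightarrow> Dom \<C> f \<in> Obj \<C>"
    and Cod_Obj: "f \<in> Arr \<C> \<Longrightarrow> Cod \<C> f \<in> Obj \<C>"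
    and Idm_Hom: "X \<in> Obj \<C> \<Longrightarrow> Idm \<C> X \<in> Hom \<C> X X"
    and Cmp_Hom: "\<lbrakk>f \<in> Hom \<C> X Y; g \<in> Hom \<C> Y Z\<rbrakk> \<Longrightarrow> g \<cdot> f \<in> Hom \<C> X Z"
    and Cmp_Idm: "f \<in> Hom \<C> X Y \<Longrightarrow> f \<cdot> Idm \<C> X = f"
    and Idm_Cmp: "f \<in> Hom \<C> X Y \<Longrightarrow> Idm \<C> Y \<cdot> f = f"
    and Cmp_assoc: "\<lbrakk>f \<in> Hom \<C> W X; g \<in> Hom \<C> X Y; h \<in> Hom \<C> Y Z\<rbrakk> \<Longrightarrow> (h \<cdot> g) \<cdot> f = h \<cdot> (g \<cdot> f)"

locale preadditive_cat = cat +
  assumes Hom_comm_group: "\<lbrakk>X \<in> Obj \<C>; Y \<in> Obj \<C>\<rbrakk> \<Longrightarrow> comm_group (hom_grp \<C> X Y)"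
    and Cmp_Add: "\<lbrakk>f \<in> Hom \<C> X Y; f' \<in> Hom \<C> X Y; g \<in> Hom \<C> Y Z\<rbrakk> \<Longrightarrow>
          g \<cdot> Add \<C> f f' = Add \<C> (g \<cdot> f) (g \<cdot> f')"
    and Add_Cmp: "\<lbrakk>f \<in> Hom \<C> X Y; g \<in> Hom \<C> Y Z; g' \<in> Hom \<C> Y Z\<rbrakk> \<Longrightarrow>
          Add \<C> g g' \<cdot> f = Add \<C> (g \<cdot> f) (g' \<cdot> f)"

locale abelian_cat = preadditive_cat +
  assumes ex_zero_object: "\<exists>Z. is_zero_object \<C> Z"
    and ex_product: "\<lbrakk>X \<in> Obj \<C>; Y \<in> Obj \<C>\<rbrakk> \<Longrightarrow> \<exists>P p q. is_product \<C> X Y P p q"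
    and ex_kernel: "f \<in> Arr \<C> \<Longrightarrow> \<exists>k. is_kernel \<C> f k"
    and ex_cokernel: "f \<in> Arr \<C> \<Longrightarrow> \<exists>c. is_cokernel \<C> f c"
    and mono_normal: "is_mono \<C> f \<Longrightarrow> \<exists>g. is_kernel \<C> g f"
    and epi_normal: "is_epi \<C> f \<Longrightarrow> \<exists>g. is_cokernel \<C> g f"

definition projective :: "('o, 'm) cat \<Rightarrow> 'o \<Rightarrow> bool" where
  "projective \<C> P \<longleftrightarrow> P \<in> Obj \<C> \<and>
     (\<forall>X Y. \<forall>e\<in>Hom \<C> X Y. \<forall>f\<in>Hom \<C> P Y.
        is_epi \<C> e \<longrightarrow> (\<exists>g\<in>Hom \<C> P X. e \<cdot>\<^bsub>\<C>\<^esub> g = f))"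

definition enough_projectives :: "('o, 'm) cat \<Rightarrow> bool" where
  "enough_projectives \<C> \<longleftrightarrow>
     (\<forall>X\<in>Obj \<C>. \<exists>P e. projective \<C> P \<and> e \<in> Hom \<C> P X \<and> is_epi \<C> e)"

text \<open>Exactness of \<open>X \<rightarrow>\<^sub>f Y \<rightarrow>\<^sub>g Z\<close> at \<open>Y\<close>: the image of \<open>f\<close> is the kernel of \<open>g\<close>.\<close>

definition exact_at :: "('o, 'm) cat \<Rightarrow> 'm \<Rightarrow> 'm \<Rightarrow> bool" where
  "exact_at \<C> f g \<longleftrightarrow> f \<in> Arr \<C> \<and> g \<in> Arr \<C> \<and> Cod \<C> f = Dom \<C> g \<and>
     (\<exists>j q. is_kernel \<C> g j \<and> q \<in> Hom \<C> (Dom \<C> f) (Dom \<C> j) \<and> is_epi \<C> q \<and> j \<cdot>\<^bsub>\<C>\<^esub> q = f)"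

definition short_exact :: "('o, 'm) cat \<Rightarrow> 'o \<Rightarrow> 'o \<Rightarrow> 'o \<Rightarrow> 'm \<Rightarrow> 'm \<Rightarrow> bool" where
  "short_exact \<C> X Y Z i p \<longleftrightarrow> i \<in> Hom \<C> X Y \<and> p \<in> Hom \<C> Y Z \<and>
     is_mono \<C> i \<and> exact_at \<C> i p \<and> is_epi \<C> p"


section \<open>Projective resolutions with syzygies\<close>

text \<open>
  For a resolution of \<open>M\<close>: \<open>Df m\<close> is the differential from degree \<open>m\<close> to degree \<open>m - 1\<close>
  (only used for \<open>m \<ge> 1\<close>), \<open>Syz k\<close> the \<open>k\<close>-th syzygy, \<open>Epi k\<close> the map from degree \<open>k\<close> onto the
  \<open>k\<close>-th syzygy, and \<open>Inc k\<close> (only used for \<open>k \<ge> 1\<close>) the embedding of the \<open>k\<close>-th syzygy into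
  degree \<open>k - 1\<close>. Hence \<open>Df m = Inc m \<cdot> Epi m\<close>, and \<open>Epi 0\<close> is the augmentation \<open>Aug\<close>.
\<close>

record ('o, 'm) resolution =
  Pr :: "nat \<Rightarrow> 'o"
  Df :: "nat \<Rightarrow> 'm"
  Aug :: 'm
  Syz :: "nat \<Rightarrow> 'o"
  Epi :: "nat \<Rightarrow> 'm"
  Inc :: "nat \<Rightarrow> 'm"

definition proj_resolution :: "('o, 'm) cat \<Rightarrow> 'o \<Rightarrow> ('o, 'm) resolution \<Rightarrow> bool" where
  "proj_resolution \<C> M R \<longleftrightarrow> M \<in> Obj \<C> \<and>
     (\<forall>k. projective \<C> (Pr R k)) \<and>
     (\<forall>k. Df R (Suc k) \<in> Hom \<C> (Pr R (Suc k)) (Pr R k)) \<and>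
     Aug R \<in> Hom \<C> (Pr R 0) M \<and> is_epi \<C> (Aug R) \<and>
     exact_at \<C> (Df R (Suc 0)) (Aug R) \<and>
     (\<forall>k. exact_at \<C> (Df R (Suc (Suc k))) (Df R (Suc k)))"

definition syzygies :: "('o, 'm) cat \<Rightarrow> 'o \<Rightarrow> ('o, 'm) resolution \<Rightarrow> bool" where
  "syzygies \<C> M R \<longleftrightarrow> Syz R 0 = M \<and> Epi R 0 = Aug R \<and>
     (\<forall>k. Inc R (Suc k) \<in> Hom \<C> (Syz R (Suc k)) (Pr R k) \<and>
          is_kernel \<C> (Epi R k) (Inc R (Suc k)) \<and>
          Epi R (Suc k) \<in> Hom \<C> (Pr R (Suc k)) (Syz R (Suc k)) \<and>
          Inc R (Suc k) \<cdot>\<^bsub>\<C>\<^esub> Epi R (Suc k) = Df R (Suc k))"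

definition syz_resolution :: "('o, 'm) cat \<Rightarrow> 'o \<Rightarrow> ('o, 'm) resolution \<Rightarrow> bool" where
  "syz_resolution \<C> M R \<longleftrightarrow> proj_resolution \<C> M R \<and> syzygies \<C> M R"

text \<open>
  \<open>horseshoe\<close>: resolutions \<open>RB, RC, RD\<close> of the terms of \<open>0 \<rightarrow> B \<rightarrow> C \<rightarrow> D \<rightarrow> 0\<close> (with maps \<open>i, p\<close>),
  short exact sequences \<open>(U k, V k)\<close> of their terms in degree \<open>k\<close>, and the short exact
  sequences \<open>(SU k, SV k)\<close> of their \<open>k\<close>-th syzygies, everything commuting.
\<close>

definition horseshoe :: "('o, 'm) cat \<Rightarrow> 'o \<Rightarrow> 'o \<Rightarrow> 'o \<Rightarrow> 'm \<Rightarrow> 'm \<Rightarrow>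
    ('o, 'm) resolution \<Rightarrow> ('o, 'm) resolution \<Rightarrow> ('o, 'm) resolution \<Rightarrow>
    (nat \<Rightarrow> 'm) \<Rightarrow> (nat \<Rightarrow> 'm) \<Rightarrow> (nat \<Rightarrow> 'm) \<Rightarrow> (nat \<Rightarrow> 'm) \<Rightarrow> bool" where
  "horseshoe \<C> B C D i p RB RC RD U V SU SV \<longleftrightarrow>
     syz_resolution \<C> B RB \<and> syz_resolution \<C> C RC \<and> syz_resolution \<C> D RD \<and>
     SU 0 = i \<and> SV 0 = p \<and>
     (\<forall>k. short_exact \<C> (Pr RB k) (Pr RC k) (Pr RD k) (U k) (V k) \<and>
          short_exact \<C> (Syz RB k) (Syz RC k) (Syz RD k) (SU k) (SV k) \<and>
          Epi RC k \<cdot>\<^bsub>\<C>\<^esub> U k = SU k \<cdot>\<^bsub>\<C>\<^esub> Epi RB k \<and>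
          Epi RD k \<cdot>\<^bsub>\<C>\<^esub> V k = SV k \<cdot>\<^bsub>\<C>\<^esub> Epi RC k \<and>
          Inc RC (Suc k) \<cdot>\<^bsub>\<C>\<^esub> SU (Suc k) = U k \<cdot>\<^bsub>\<C>\<^esub> Inc RB (Suc k) \<and>
          Inc RD (Suc k) \<cdot>\<^bsub>\<C>\<^esub> SV (Suc k) = V k \<cdot>\<^bsub>\<C>\<^esub> Inc RC (Suc k))"


section \<open>Ext groups and their connecting homomorphisms\<close>

text \<open>
  All homomorphisms below that are given on representatives, possibly after auxiliary choices,
  are defined as \<^emph>\<open>the\<close> value obtained from every representative and every choice.
\<close>

definition cocycles :: "('o, 'm) cat \<Rightarrow> ('o, 'm) resolution \<Rightarrow> 'o \<Rightarrow> nat \<Rightarrow> 'm set" where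
  "cocycles \<C> R Y m =
     {f \<in> Hom \<C> (Pr R m) Y. f \<cdot>\<^bsub>\<C>\<^esub> Df R (Suc m) = Nul \<C> (Pr R (Suc m)) Y}"

definition coboundaries :: "('o, 'm) cat \<Rightarrow> ('o, 'm) resolution \<Rightarrow> 'o \<Rightarrow> nat \<Rightarrow> 'm set" where
  "coboundaries \<C> R Y m =
     (case m of 0 \<Rightarrow> {Nul \<C> (Pr R 0) Y}
      | Suc l \<Rightarrow> (\<lambda>g. g \<cdot>\<^bsub>\<C>\<^esub> Df R (Suc l)) ` Hom \<C> (Pr R l) Y)"

definition ext_class :: "('o, 'm) cat \<Rightarrow> ('o, 'm) resolution \<Rightarrow> 'o \<Rightarrow> nat \<Rightarrow> 'm \<Rightarrow> 'm set" where
  "ext_class \<C> R Y m f = coboundaries \<C> R Y m #>\<^bsub>hom_grp \<C> (Pr R m) Y\<^esub> f"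

definition Ext :: "('o, 'm) cat \<Rightarrow> ('o, 'm) resolution \<Rightarrow> 'o \<Rightarrow> int \<Rightarrow> 'm set monoid" where
  "Ext \<C> R Y m =
     (if m < 0 then singleton_group {}
      else ((hom_grp \<C> (Pr R (nat m)) Y)\<lparr>carrier := cocycles \<C> R Y (nat m)\<rparr>)
             Mod (coboundaries \<C> R Y (nat m)))"

text \<open>
  The connecting homomorphism from degree \<open>m\<close> to degree \<open>m + 1\<close> of \<open>0 \<rightarrow> X \<rightarrow> Y \<rightarrow> Z \<rightarrow> 0\<close>
  (with maps \<open>i, p\<close>), as given by the snake lemma: lift a cocycle \<open>f\<close> with values in \<open>Z\<close> to \<open>g\<close>
  with values in \<open>Y\<close>, and write \<open>g \<circ> \<partial>\<close> as \<open>i \<circ> w\<close>.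
\<close>

definition delta :: "('o, 'm) cat \<Rightarrow> ('o, 'm) resolution \<Rightarrow> 'o \<Rightarrow> 'o \<Rightarrow> 'm \<Rightarrow> 'm \<Rightarrow> int \<Rightarrow>
    'm set \<Rightarrow> 'm set" where
  "delta \<C> R X Y i p m x =
     (if m < 0 then \<one>\<^bsub>Ext \<C> R X (m + 1)\<^esub>
      else THE y. \<exists>f g w. f \<in> x \<and> g \<in> Hom \<C> (Pr R (nat m)) Y \<and> p \<cdot>\<^bsub>\<C>\<^esub> g = f \<and>
             w \<in> Hom \<C> (Pr R (Suc (nat m))) X \<and> i \<cdot>\<^bsub>\<C>\<^esub> w = g \<cdot>\<^bsub>\<C>\<^esub> Df R (Suc (nat m)) \<and>
             y = ext_class \<C> R X (Suc (nat m)) w)"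


section \<open>Morphisms modulo projectives\<close>

definition proj_maps :: "('o, 'm) cat \<Rightarrow> 'o \<Rightarrow> 'o \<Rightarrow> 'm set" where
  "proj_maps \<C> X Y = {f. \<exists>P g h. projective \<C> P \<and> g \<in> Hom \<C> X P \<and> h \<in> Hom \<C> P Y \<and> f = h \<cdot>\<^bsub>\<C>\<^esub> g}"

definition st_hom :: "('o, 'm) cat \<Rightarrow> 'o \<Rightarrow> 'o \<Rightarrow> 'm set monoid" where
  "st_hom \<C> X Y = hom_grp \<C> X Y Mod proj_maps \<C> X Y"

definition st_class :: "('o, 'm) cat \<Rightarrow> 'o \<Rightarrow> 'o \<Rightarrow> 'm \<Rightarrow> 'm set" where
  "st_class \<C> X Y f = proj_maps \<C> X Y #>\<^bsub>hom_grp \<C> X Y\<^esub> f"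

text \<open>
  \<open>syz_induced \<C> RA RY m k f f'\<close>: the arrow \<open>f'\<close> between the syzygies of index \<open>m + 1\<close> and
  \<open>k + 1\<close> is induced by some lift \<open>F\<close> of the arrow \<open>f\<close> between those of index \<open>m\<close> and \<open>k\<close>.
\<close>

definition syz_induced :: "('o, 'm) cat \<Rightarrow> ('o, 'm) resolution \<Rightarrow> ('o, 'm) resolution \<Rightarrow>
    nat \<Rightarrow> nat \<Rightarrow> 'm \<Rightarrow> 'm \<Rightarrow> bool" where
  "syz_induced \<C> RA RY m k f f' \<longleftrightarrow>
     f' \<in> Hom \<C> (Syz RA (Suc m)) (Syz RY (Suc k)) \<and>
     (\<exists>F\<in>Hom \<C> (Pr RA m) (Pr RY k).
        Epi RY k \<cdot>\<^bsub>\<C>\<^esub> F = f \<cdot>\<^bsub>\<C>\<^esub> Epi RA m \<and>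
        Inc RY (Suc k) \<cdot>\<^bsub>\<C>\<^esub> f' = F \<cdot>\<^bsub>\<C>\<^esub> Inc RA (Suc m))"

definition t_map :: "('o, 'm) cat \<Rightarrow> ('o, 'm) resolution \<Rightarrow> ('o, 'm) resolution \<Rightarrow>
    nat \<Rightarrow> nat \<Rightarrow> 'm set \<Rightarrow> 'm set" where
  "t_map \<C> RA RY m k x =
     (THE y. \<exists>f f'. f \<in> x \<and> syz_induced \<C> RA RY m k f f' \<and>
        y = st_class \<C> (Syz RA (Suc m)) (Syz RY (Suc k)) f')"

text \<open>
  In \<open>tau\<close> the arrow \<open>h\<close> from degree \<open>k\<close> of \<open>RD\<close> to the \<open>k\<close>-th syzygy of \<open>RC\<close> lifts the
  identity of the \<open>k\<close>-th syzygy of \<open>RD\<close>, and \<open>h'\<close> is the arrow it induces.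
\<close>

definition tau :: "('o, 'm) cat \<Rightarrow> ('o, 'm) resolution \<Rightarrow> ('o, 'm) resolution \<Rightarrow>
    ('o, 'm) resolution \<Rightarrow> ('o, 'm) resolution \<Rightarrow> (nat \<Rightarrow> 'm) \<Rightarrow> (nat \<Rightarrow> 'm) \<Rightarrow>
    nat \<Rightarrow> nat \<Rightarrow> 'm set \<Rightarrow> 'm set" where
  "tau \<C> RA RB RC RD SU SV m k x =
     (THE y. \<exists>f f' h h'. f \<in> x \<and> syz_induced \<C> RA RD m k f f' \<and>
        h \<in> Hom \<C> (Pr RD k) (Syz RC k) \<and> SV k \<cdot>\<^bsub>\<C>\<^esub> h = Epi RD k \<and>
        h' \<in> Hom \<C> (Syz RD (Suc k)) (Syz RB k) \<and>
        SU k \<cdot>\<^bsub>\<C>\<^esub> h' = h \<cdot>\<^bsub>\<C>\<^esub> Inc RD (Suc k) \<and>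
        y = st_class \<C> (Syz RA (Suc m)) (Syz RB k) (h' \<cdot>\<^bsub>\<C>\<^esub> f'))"

text \<open>\<open>beta\<close> is used for \<open>m \<ge> 1\<close> only.\<close>

definition beta :: "('o, 'm) cat \<Rightarrow> ('o, 'm) resolution \<Rightarrow> 'o \<Rightarrow> nat \<Rightarrow> 'm set \<Rightarrow> 'm set" where
  "beta \<C> RA Y m x =
     (THE y. \<exists>f f'. f \<in> x \<and> f' \<in> Hom \<C> (Syz RA m) Y \<and> f = f' \<cdot>\<^bsub>\<C>\<^esub> Epi RA m \<and>
        y = st_class \<C> (Syz RA m) Y f')"


section \<open>Direct limits of sequences of groups\<close>

text \<open>
  A sequence of groups \<open>Grp k\<close> with transition maps \<open>Tr k\<close> from \<open>Grp k\<close> to \<open>Grp (k + 1)\<close>,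
  where \<open>k\<close> ranges over an upward closed set \<open>Ix\<close> of natural numbers.
\<close>

record 'g dirsys =
  Ix :: "nat set"
  Grp :: "nat \<Rightarrow> 'g monoid"
  Tr :: "nat \<Rightarrow> 'g \<Rightarrow> 'g"

primrec shift :: "'g dirsys \<Rightarrow> nat \<Rightarrow> nat \<Rightarrow> 'g \<Rightarrow> 'g" where
  "shift S k 0 x = x"
| "shift S k (Suc j) x = Tr S (k + j) (shift S k j x)"

definition dl_class :: "'g dirsys \<Rightarrow> nat \<Rightarrow> 'g \<Rightarrow> (nat \<times> 'g) set" where
  "dl_class S k x = {(l, y). l \<in> Ix S \<and> y \<in> carrier (Grp S l) \<and>
     (\<exists>i j. k + i = l + j \<and> shift S k i x = shift S l j y)}"

definition dirlim :: "'g dirsys \<Rightarrow> (nat \<times> 'g) set monoid" where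
  "dirlim S =
     \<lparr>carrier = {dl_class S k x | k x. k \<in> Ix S \<and> x \<in> carrier (Grp S k)},
      mult = (\<lambda>c d. THE e. \<exists>k x y. (k, x) \<in> c \<and> (k, y) \<in> d \<and> e = dl_class S k (x \<otimes>\<^bsub>Grp S k\<^esub> y)),
      one = (THE e. \<exists>k\<in>Ix S. e = dl_class S k \<one>\<^bsub>Grp S k\<^esub>)\<rparr>"

text \<open>
  The map of direct limits, into the limit of \<open>T\<close>, induced by maps \<open>\<phi> k\<close> that are given for the
  indices \<open>k\<close> in a cofinal set \<open>K\<close>.
\<close>

definition dirlim_map :: "nat set \<Rightarrow> 'h dirsys \<Rightarrow> (nat \<Rightarrow> 'g \<Rightarrow> 'h) \<Rightarrow>
    (nat \<times> 'g) set \<Rightarrow> (nat \<times> 'h) set" where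
  "dirlim_map K T \<phi> c = (THE d. \<exists>k x. k \<in> K \<and> (k, x) \<in> c \<and> d = dl_class T k (\<phi> k x))"


section \<open>The completed Ext functor and the naive construction\<close>

definition Ext_sys :: "('o, 'm) cat \<Rightarrow> ('o, 'm) resolution \<Rightarrow> ('o, 'm) resolution \<Rightarrow> int \<Rightarrow>
    'm set dirsys" where
  "Ext_sys \<C> RA RY n =
     \<lparr>Ix = UNIV,
      Grp = (\<lambda>k. Ext \<C> RA (Syz RY k) (n + int k)),
      Tr = (\<lambda>k. delta \<C> RA (Syz RY (Suc k)) (Pr RY k) (Inc RY (Suc k)) (Epi RY k) (n + int k))\<rparr>"

definition BC_sys :: "('o, 'm) cat \<Rightarrow> ('o, 'm) resolution \<Rightarrow> ('o, 'm) resolution \<Rightarrow> int \<Rightarrow>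
    'm set dirsys" where
  "BC_sys \<C> RA RY n =
     \<lparr>Ix = {k. n + int k \<ge> 0},
      Grp = (\<lambda>k. st_hom \<C> (Syz RA (nat (n + int k))) (Syz RY k)),
      Tr = (\<lambda>k. t_map \<C> RA RY (nat (n + int k)) k)\<rparr>"

definition Ext_hat :: "('o, 'm) cat \<Rightarrow> ('o, 'm) resolution \<Rightarrow> ('o, 'm) resolution \<Rightarrow> int \<Rightarrow>
    (nat \<times> 'm set) set monoid" where
  "Ext_hat \<C> RA RY n = dirlim (Ext_sys \<C> RA RY n)"

definition BC :: "('o, 'm) cat \<Rightarrow> ('o, 'm) resolution \<Rightarrow> ('o, 'm) resolution \<Rightarrow> int \<Rightarrow>
    (nat \<times> 'm set) set monoid" where
  "BC \<C> RA RY n = dirlim (BC_sys \<C> RA RY n)"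

definition beta_hat :: "('o, 'm) cat \<Rightarrow> ('o, 'm) resolution \<Rightarrow> ('o, 'm) resolution \<Rightarrow> int \<Rightarrow>
    (nat \<times> 'm set) set \<Rightarrow> (nat \<times> 'm set) set" where
  "beta_hat \<C> RA RY n =
     dirlim_map {k. n + int k \<ge> 1} (BC_sys \<C> RA RY n)
       (\<lambda>k. beta \<C> RA (Syz RY k) (nat (n + int k)))"

definition delta_hat :: "('o, 'm) cat \<Rightarrow> ('o, 'm) resolution \<Rightarrow> ('o, 'm) resolution \<Rightarrow>
    ('o, 'm) resolution \<Rightarrow> (nat \<Rightarrow> 'm) \<Rightarrow> (nat \<Rightarrow> 'm) \<Rightarrow> int \<Rightarrow>
    (nat \<times> 'm set) set \<Rightarrow> (nat \<times> 'm set) set" where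
  "delta_hat \<C> RA RB RC SU SV n =
     dirlim_map UNIV (Ext_sys \<C> RA RB (n + 1))
       (\<lambda>k x. delta \<C> RA (Syz RB k) (Syz RC k) (SU k) (SV k) (n + int k) x
                [^]\<^bsub>Ext \<C> RA (Syz RB k) (n + int k + 1)\<^esub> ((-1 :: int) ^ k))"

definition signed_tau :: "('o, 'm) cat \<Rightarrow> ('o, 'm) resolution \<Rightarrow> ('o, 'm) resolution \<Rightarrow>
    ('o, 'm) resolution \<Rightarrow> ('o, 'm) resolution \<Rightarrow> (nat \<Rightarrow> 'm) \<Rightarrow> (nat \<Rightarrow> 'm) \<Rightarrow>
    nat \<Rightarrow> nat \<Rightarrow> 'm set \<Rightarrow> 'm set" where
  "signed_tau \<C> RA RB RC RD SU SV m k x =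
     tau \<C> RA RB RC RD SU SV m k x [^]\<^bsub>st_hom \<C> (Syz RA (Suc m)) (Syz RB k)\<^esub> ((-1 :: int) ^ k)"

definition tau_hat :: "('o, 'm) cat \<Rightarrow> ('o, 'm) resolution \<Rightarrow> ('o, 'm) resolution \<Rightarrow>
    ('o, 'm) resolution \<Rightarrow> ('o, 'm) resolution \<Rightarrow> (nat \<Rightarrow> 'm) \<Rightarrow> (nat \<Rightarrow> 'm) \<Rightarrow> int \<Rightarrow>
    (nat \<times> 'm set) set \<Rightarrow> (nat \<times> 'm set) set" where
  "tau_hat \<C> RA RB RC RD SU SV n =
     dirlim_map {k. n + int k \<ge> 1} (BC_sys \<C> RA RB (n + 1))
       (\<lambda>k. signed_tau \<C> RA RB RC RD SU SV (nat (n + int k)) k)"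

end

theory Submission
  imports Defs
begin

text \<open>
  A map on subquotients of Hom groups that is given by a relation between representatives is
  evaluated by exhibiting one related pair, once the relation is known to respect the subgroups
  that are divided out. With \<open>f\<close> representing a class over the syzygies, \<open>F\<close> a lift of \<open>f\<close> to the
  resolutions and \<open>h\<close> a lift of the identity, the arrow \<open>h \<cdot> F\<close> is a lift as required by the snake
  lemma; this gives the compatibility of \<open>\<tau>\<close> and \<open>\<delta>\<close>. The anticommuting squares for \<open>\<tau>\<close>
  and for \<open>\<delta>\<close> both come from one arrow of the form \<open>G \<cdot> \<partial> - U k \<cdot> H\<close> into degree \<open>k\<close> of the
  resolution of \<open>C\<close>: it vanishes under the projection to the syzygy, and its two terms compute the two ways
  round the square with opposite signs. The alternating signs turn these squares into maps of
  direct systems.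
\<close>

section \<open>Subquotients of abelian groups\<close>

text \<open>Every map of the statement is a definite description over all representatives and all
  auxiliary lifts, so nothing can be said about its value before well-definedness is known;
  additivity and the squares then follow from one convenient choice. Ext (cocycles modulo
  coboundaries) and stable Hom (all arrows modulo those through a projective) are therefore
  instances of one subquotient \<open>Z\<close> modulo \<open>N\<close>. The sign rule has to be
  proved twice. \<open>beta\<close> kills the class of \<open>f' \<cdot> Epi\<close> whenever
  \<open>f'\<close> factors through a projective, although such a class in Ext need not vanish, and
  \<open>beta\<close> is used only from degree 1 on. Hence the square for \<open>delta\<close>
  cannot be read off from the one for \<open>tau\<close>: it is proved with cocycles, the other with
  arrows between syzygies. The index ranges differ as well: the Ext system runs over all
  \<open>k\<close>, with trivial groups in negative degrees, \<open>BC_sys\<close> starts where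
  \<open>n + k\<close> reaches 0, and \<open>beta\<close> and the signed \<open>tau\<close> are used
  from \<open>n + k = 1\<close> on. Maps of limits are therefore built from components on a cofinal,
  upward closed set of indices.\<close>

locale subquotient = comm_group G for G (structure) +
  fixes Z N :: "'a set"
  assumes Z: "subgroup Z G" and N: "subgroup N G" and N_le_Z: "N \<subseteq> Z"
begin

abbreviation Q where "Q \<equiv> (G\<lparr>carrier := Z\<rparr>) Mod N"

lemma Z_carrier: "a \<in> Z \<Longrightarrow> a \<in> carrier G"
  using Z by (rule subgroup.mem_carrier)

lemma normal_N: "N \<lhd> G"
  using N by (simp add: normal_iff_subgroup)

lemma comm_group_Q: "comm_group Q"
proof -
  interpret sub: group "G\<lparr>carrier := Z\<rparr>"
    using Z by (rule subgroup_imp_group)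
  interpret sub: comm_group "G\<lparr>carrier := Z\<rparr>"
    by (rule sub.group_comm_groupI) (auto simp: Z_carrier m_comm)
  show ?thesis
    using subgroup_incl[OF N Z N_le_Z] by (rule sub.abelian_FactGroup)
qed

lemma group_Q: "group Q"
  using comm_group_Q by (rule comm_group.axioms)

lemma carrier_Q: "carrier Q = (\<lambda>a. N #> a) ` Z"
  by (auto simp: FactGroup_def RCOSETS_def r_coset_def)

lemma mult_Q: "\<lbrakk>a \<in> Z; b \<in> Z\<rbrakk> \<Longrightarrow> (N #> a) \<otimes>\<^bsub>Q\<^esub> (N #> b) = N #> (a \<otimes> b)"
  using normal.rcos_sum[OF normal_N, of a b] by (simp add: Z_carrier set_mult_def)

lemma one_Q: "\<one>\<^bsub>Q\<^esub> = N #> \<one>"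
  by (simp add: coset_mult_one subgroup.subset[OF N])

lemma coset_in_Q: "a \<in> Z \<Longrightarrow> N #> a \<in> carrier Q"
  by (simp add: carrier_Q)

lemma inv_Q: assumes "a \<in> Z" shows "inv\<^bsub>Q\<^esub> (N #> a) = N #> (inv a)"
proof -
  interpret Q: group Q by (rule group_Q)
  have "inv a \<in> Z" using Z assms by (rule subgroup.m_inv_closed)
  then show ?thesis
    using assms by (intro Q.inv_equality) (simp_all only: mult_Q one_Q coset_in_Q l_inv Z_carrier)
qed

lemma mem_coset_iff: "\<lbrakk>a \<in> Z; b \<in> Z\<rbrakk> \<Longrightarrow> b \<in> N #> a \<longleftrightarrow> b \<otimes> inv a \<in> N"
  using subgroup.rcos_module[OF N is_group] by (simp add: Z_carrier)

lemma coset_subset: "a \<in> Z \<Longrightarrow> b \<in> N #> a \<Longrightarrow> b \<in> Z"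
  using N_le_Z subgroup.m_closed[OF Z] by (auto simp: r_coset_def)

lemma coset_eqI: "\<lbrakk>a \<in> Z; b \<in> Z; b \<otimes> inv a \<in> N\<rbrakk> \<Longrightarrow> N #> b = N #> a"
  using repr_independence[of b N a] N by (simp add: mem_coset_iff Z_carrier)

lemma self_mem_coset: "a \<in> Z \<Longrightarrow> a \<in> N #> a"
  using N by (simp add: rcos_self Z_carrier)

end

text \<open>A relation takes the place of a function because a value depends on chosen lifts.
  \<open>rel_wd\<close> covers both ambiguities at once: the change of representative, and, with
  \<open>a = a'\<close>, the change of lift, since \<open>N\<close> contains the unit.\<close>

locale subquotient_map = dom: subquotient G Z N + cod: subquotient G' Z' N'
  for G :: "('a, 'c) monoid_scheme" and Z N and G' :: "('b, 'd) monoid_scheme" and Z' N' +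
  fixes R :: "'a \<Rightarrow> 'b \<Rightarrow> bool"
  assumes tot: "a \<in> Z \<Longrightarrow> \<exists>b. R a b"
    and rel_cod: "\<lbrakk>R a b; a \<in> Z\<rbrakk> \<Longrightarrow> b \<in> Z'"
    and rel_wd: "\<lbrakk>R a b; R a' b'; a \<in> Z; a' \<in> Z; a \<otimes>\<^bsub>G\<^esub> inv\<^bsub>G\<^esub> a' \<in> N\<rbrakk> \<Longrightarrow> b \<otimes>\<^bsub>G'\<^esub> inv\<^bsub>G'\<^esub> b' \<in> N'"
begin

text \<open>The left-hand side has, up to regrouping of quantifiers, the shape in which
  \<open>delta\<close>, \<open>t_map\<close>, \<open>beta\<close> and \<open>tau\<close> are
  defined, so one related pair evaluates each of them.\<close>

lemma the_coset:
  assumes "R a b" "a \<in> Z"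
  shows "(THE y. \<exists>a' b'. a' \<in> N #>\<^bsub>G\<^esub> a \<and> R a' b' \<and> y = N' #>\<^bsub>G'\<^esub> b') = N' #>\<^bsub>G'\<^esub> b"
proof (rule the_equality)
  show "\<exists>a' b'. a' \<in> N #>\<^bsub>G\<^esub> a \<and> R a' b' \<and> N' #>\<^bsub>G'\<^esub> b = N' #>\<^bsub>G'\<^esub> b'"
    using assms dom.self_mem_coset by blast
next
  fix y assume "\<exists>a' b'. a' \<in> N #>\<^bsub>G\<^esub> a \<and> R a' b' \<and> y = N' #>\<^bsub>G'\<^esub> b'"
  then obtain a' b' where a': "a' \<in> N #>\<^bsub>G\<^esub> a" "R a' b'" and y: "y = N' #>\<^bsub>G'\<^esub> b'"
    by blast
  have "a' \<in> Z" using a' assms by (blast intro: dom.coset_subset)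
  with a' assms have "b' \<otimes>\<^bsub>G'\<^esub> inv\<^bsub>G'\<^esub> b \<in> N'"
    by (intro rel_wd[of a' b' a b]) (simp_all add: dom.mem_coset_iff)
  with y \<open>a' \<in> Z\<close> a' assms show "y = N' #>\<^bsub>G'\<^esub> b"
    by (simp add: cod.coset_eqI rel_cod)
qed

text \<open>Additivity needs only one choice of values that is compatible with the sum, since the
  value at the sum does not depend on the choice. \<open>F\<close> is any function with prescribed
  values on cosets, because a definite description is uncontrolled outside the carrier.\<close>

lemma hom_of_rel:
  assumes F: "\<And>a b. \<lbrakk>R a b; a \<in> Z\<rbrakk> \<Longrightarrow> F (N #>\<^bsub>G\<^esub> a) = N' #>\<^bsub>G'\<^esub> b"
    and add: "\<And>a a'. \<lbrakk>a \<in> Z; a' \<in> Z\<rbrakk> \<Longrightarrow> \<exists>b b'. R a b \<and> R a' b' \<and> R (a \<otimes>\<^bsub>G\<^esub> a') (b \<otimes>\<^bsub>G'\<^esub> b')"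
  shows "F \<in> hom dom.Q cod.Q"
proof (rule homI)
  fix x assume "x \<in> carrier dom.Q"
  then obtain a where a: "a \<in> Z" "x = N #>\<^bsub>G\<^esub> a" by (auto simp: dom.carrier_Q)
  then obtain b where "R a b" using tot by blast
  with a show "F x \<in> carrier cod.Q" using F cod.coset_in_Q rel_cod by metis
next
  fix x y assume "x \<in> carrier dom.Q" "y \<in> carrier dom.Q"
  then obtain a a' where a: "a \<in> Z" "x = N #>\<^bsub>G\<^esub> a" "a' \<in> Z" "y = N #>\<^bsub>G\<^esub> a'"
    by (auto simp: dom.carrier_Q)
  then obtain b b' where b: "R a b" "R a' b'" "R (a \<otimes>\<^bsub>G\<^esub> a') (b \<otimes>\<^bsub>G'\<^esub> b')"
    using add by blast
  have "a \<otimes>\<^bsub>G\<^esub> a' \<in> Z" using a dom.Z by (simp add: subgroup.m_closed)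
  then show "F (x \<otimes>\<^bsub>dom.Q\<^esub> y) = F x \<otimes>\<^bsub>cod.Q\<^esub> F y"
    using a b F rel_cod by (simp only: dom.mult_Q cod.mult_Q)
qed

end

lemma hom_int_power:
  assumes "f \<in> hom G H" "comm_group H"
  shows "(\<lambda>x. f x [^]\<^bsub>H\<^esub> (i :: int)) \<in> hom G H"
proof -
  interpret H: comm_group H by fact
  have f: "f x \<in> carrier H" if "x \<in> carrier G" for x using that assms(1) by (auto simp: hom_def)
  then show ?thesis by (intro homI) (simp_all add: hom_mult[OF assms(1)] H.int_pow_distrib)
qed

text \<open>The inverse produced by an anticommuting square is one more factor -1 in the exponent;
  it turns the sign of stage \<open>k\<close> into the sign of stage \<open>k + 1\<close>.\<close>

lemma (in group) inv_sign_power: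
  "x \<in> carrier G \<Longrightarrow> inv x [^] ((-1 :: int) ^ k) = x [^] ((-1 :: int) ^ Suc k)"
  by (simp add: int_pow_inv int_pow_neg)

lemma positive_int_cases: "1 \<le> j \<Longrightarrow> \<exists>l. j = int (Suc l) \<and> nat j = Suc l"
  by (intro exI[of _ "nat (j - 1)"]) auto


section \<open>Direct limits\<close>

locale group_dirsys =
  fixes S :: "'g dirsys"
  assumes Suc_Ix: "k \<in> Ix S \<Longrightarrow> Suc k \<in> Ix S"
    and group_Grp: "k \<in> Ix S \<Longrightarrow> group (Grp S k)"
    and Tr_hom: "k \<in> Ix S \<Longrightarrow> Tr S k \<in> hom (Grp S k) (Grp S (Suc k))"
begin

lemma Ix_add: "k \<in> Ix S \<Longrightarrow> k + i \<in> Ix S"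
  by (induction i) (auto intro: Suc_Ix)

lemma shift_hom: "k \<in> Ix S \<Longrightarrow> shift S k i \<in> hom (Grp S k) (Grp S (k + i))"
proof (induction i)
  case 0
  then show ?case by (auto simp: hom_def)
next
  case (Suc i)
  then have "Tr S (k + i) \<circ> shift S k i \<in> hom (Grp S k) (Grp S (Suc (k + i)))"
    by (intro hom_compose[OF _ Tr_hom]) (auto intro: Ix_add)
  then show ?case by (auto simp: hom_def Pi_def)
qed

lemma shift_closed: "\<lbrakk>k \<in> Ix S; x \<in> carrier (Grp S k)\<rbrakk> \<Longrightarrow> shift S k i x \<in> carrier (Grp S (k + i))"
  using shift_hom[of k i] by (auto simp: hom_def)

lemma shift_add: "shift S k (i + j) x = shift S (k + i) j (shift S k i x)"
  by (induction j) (auto simp: add.assoc)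

lemma mem_dl_class: "(l, y) \<in> dl_class S k x \<longleftrightarrow> l \<in> Ix S \<and> y \<in> carrier (Grp S l) \<and>
    (\<exists>i j. k + i = l + j \<and> shift S k i x = shift S l j y)"
  by (simp add: dl_class_def)

lemma self_mem: "\<lbrakk>k \<in> Ix S; x \<in> carrier (Grp S k)\<rbrakk> \<Longrightarrow> (k, x) \<in> dl_class S k x"
  by (auto simp: mem_dl_class)

lemma shift_eq_mono:
  assumes "shift S k i x = shift S l j y" "k + i = l + j"
  shows "shift S k (i + m) x = shift S l (j + m) y"
  by (simp only: shift_add assms)

text \<open>Transitivity of eventual equality. One equality holds \<open>i\<close> steps after
  \<open>k\<close>, the other \<open>i'\<close> steps after \<open>k\<close>; pushing each on by the
  other's number of steps brings all three elements to the common stage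
  \<open>k + i + i'\<close>.\<close>

lemma dl_class_subset:
  assumes "k + i = l + j" "shift S k i x = shift S l j y"
  shows "dl_class S k x \<subseteq> dl_class S l y"
proof
  fix c assume "c \<in> dl_class S k x"
  then obtain r z i' j' where c: "c = (r, z)"
    and r: "r \<in> Ix S" "z \<in> carrier (Grp S r)" "k + i' = r + j'" "shift S k i' x = shift S r j' z"
    unfolding dl_class_def by blast
  have "shift S l (j + i') y = shift S k (i + i') x"
    using assms by (intro shift_eq_mono[symmetric]) simp_all
  also have "\<dots> = shift S r (j' + i) z"
    using shift_eq_mono[OF r(4,3), of i] by (simp add: add.commute)
  finally have "shift S l (j + i') y = shift S r (j' + i) z" .
  moreover have "l + (j + i') = r + (j' + i)" using assms(1) r(3) by linarith
  ultimately show "c \<in> dl_class S l y"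
    using r(1,2) unfolding c mem_dl_class by blast
qed

lemma dl_class_eqI:
  assumes "k + i = l + j" "shift S k i x = shift S l j y"
  shows "dl_class S k x = dl_class S l y"
  using dl_class_subset[OF assms] dl_class_subset[OF assms[symmetric]] by blast

lemma dl_class_shift: "dl_class S (k + i) (shift S k i x) = dl_class S k x"
  by (rule dl_class_eqI[of _ 0 _ i]) auto

text \<open>The product is described through any two representatives at a common stage. Two such
  choices become equal later on, and there their products agree as well because the shifts are
  homomorphisms.\<close>

lemma dirlim_mult:
  assumes k: "k \<in> Ix S" and x: "x \<in> carrier (Grp S k)" and y: "y \<in> carrier (Grp S k)"
  shows "dl_class S k x \<otimes>\<^bsub>dirlim S\<^esub> dl_class S k y = dl_class S k (x \<otimes>\<^bsub>Grp S k\<^esub> y)"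
proof -
  have "(THE e. \<exists>l a b. (l, a) \<in> dl_class S k x \<and> (l, b) \<in> dl_class S k y \<and>
           e = dl_class S l (a \<otimes>\<^bsub>Grp S l\<^esub> b)) = dl_class S k (x \<otimes>\<^bsub>Grp S k\<^esub> y)"
  proof (rule the_equality)
    show "\<exists>l a b. (l, a) \<in> dl_class S k x \<and> (l, b) \<in> dl_class S k y \<and>
           dl_class S k (x \<otimes>\<^bsub>Grp S k\<^esub> y) = dl_class S l (a \<otimes>\<^bsub>Grp S l\<^esub> b)"
      using assms by (blast intro: self_mem)
  next
    fix e assume "\<exists>l a b. (l, a) \<in> dl_class S k x \<and> (l, b) \<in> dl_class S k y \<and>
           e = dl_class S l (a \<otimes>\<^bsub>Grp S l\<^esub> b)"
    then obtain l a b where ab: "(l, a) \<in> dl_class S k x" "(l, b) \<in> dl_class S k y"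
      and e: "e = dl_class S l (a \<otimes>\<^bsub>Grp S l\<^esub> b)" by blast
    from ab obtain i j i' j' where l: "l \<in> Ix S" "a \<in> carrier (Grp S l)" "b \<in> carrier (Grp S l)"
      and i: "k + i = l + j" "shift S k i x = shift S l j a"
      and i': "k + i' = l + j'" "shift S k i' y = shift S l j' b"
      by (auto simp: mem_dl_class)
    \<comment> \<open>The two meeting stages may differ. From \<open>k + i = l + j\<close> and
      \<open>k + i' = l + j'\<close> follows \<open>j + i' = j' + i\<close>, so both equalities can
      be moved to one stage.\<close>
    have eq: "i + i' = i' + i" "j + i' = j' + i" using i i' by auto
    have "shift S k (i + i') x = shift S l (j + i') a" "shift S k (i + i') y = shift S l (j + i') b"
      using shift_eq_mono[OF i(2,1), of i'] shift_eq_mono[OF i'(2,1), of i] by (simp_all only: eq)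
    moreover have "k + (i + i') = l + (j + i')" using i by simp
    ultimately have "shift S k (i + i') (x \<otimes>\<^bsub>Grp S k\<^esub> y) = shift S l (j + i') (a \<otimes>\<^bsub>Grp S l\<^esub> b)"
      by (simp only: hom_mult[OF shift_hom] assms l)
    then show "e = dl_class S k (x \<otimes>\<^bsub>Grp S k\<^esub> y)"
      unfolding e using i by (metis \<open>k + (i + i') = l + (j + i')\<close> dl_class_eqI)
  qed
  then show ?thesis by (simp add: dirlim_def)
qed

lemma carrier_dirlim: "carrier (dirlim S) = {dl_class S k x | k x. k \<in> Ix S \<and> x \<in> carrier (Grp S k)}"
  by (simp add: dirlim_def)

end

text \<open>Components are required only on the cofinal set \<open>K\<close>, and the two systems
  may have different index sets. This fits \<open>beta\<close>, which has components from
  \<open>n + k = 1\<close> on, while the Ext system is indexed by all \<open>k\<close> and its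
  target starts at \<open>n + k = 0\<close>.\<close>

locale dirsys_map = dom: group_dirsys S + cod: group_dirsys T
  for S :: "'g dirsys" and T :: "'h dirsys" +
  fixes K :: "nat set" and \<phi> :: "nat \<Rightarrow> 'g \<Rightarrow> 'h"
  assumes K_Ix: "k \<in> K \<Longrightarrow> k \<in> Ix S \<and> k \<in> Ix T"
    and Suc_K: "k \<in> K \<Longrightarrow> Suc k \<in> K"
    and K_cofinal: "\<exists>i. k + i \<in> K"
    and \<phi>_hom: "k \<in> K \<Longrightarrow> \<phi> k \<in> hom (Grp S k) (Grp T k)"
    and \<phi>_Tr: "\<lbrakk>k \<in> K; x \<in> carrier (Grp S k)\<rbrakk> \<Longrightarrow> \<phi> (Suc k) (Tr S k x) = Tr T k (\<phi> k x)"
begin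

lemma \<phi>_closed: "\<lbrakk>k \<in> K; x \<in> carrier (Grp S k)\<rbrakk> \<Longrightarrow> \<phi> k x \<in> carrier (Grp T k)"
  using \<phi>_hom by (auto simp: hom_def)

lemma K_add: "k \<in> K \<Longrightarrow> k + i \<in> K"
  by (induction i) (auto intro: Suc_K)

lemma \<phi>_shift: "\<lbrakk>k \<in> K; x \<in> carrier (Grp S k)\<rbrakk> \<Longrightarrow> \<phi> (k + i) (shift S k i x) = shift T k i (\<phi> k x)"
  by (induction i) (use K_Ix in \<open>auto simp: \<phi>_Tr K_add dom.shift_closed\<close>)

lemma map_dl_class:
  assumes k: "k \<in> K" and x: "x \<in> carrier (Grp S k)"
  shows "dirlim_map K T \<phi> (dl_class S k x) = dl_class T k (\<phi> k x)"
  unfolding dirlim_map_def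
proof (rule the_equality)
  show "\<exists>l y. l \<in> K \<and> (l, y) \<in> dl_class S k x \<and> dl_class T k (\<phi> k x) = dl_class T l (\<phi> l y)"
    using k x dom.self_mem K_Ix by blast
next
  fix d assume "\<exists>l y. l \<in> K \<and> (l, y) \<in> dl_class S k x \<and> d = dl_class T l (\<phi> l y)"
  then obtain l y i j where l: "l \<in> K" "y \<in> carrier (Grp S l)"
    and i: "k + i = l + j" "shift S k i x = shift S l j y"
    and d: "d = dl_class T l (\<phi> l y)" by (auto simp: dom.mem_dl_class)
  have "shift T k i (\<phi> k x) = shift T l j (\<phi> l y)"
    using l k x i by (metis \<phi>_shift)
  then show "d = dl_class T k (\<phi> k x)"
    unfolding d using i by (metis cod.dl_class_eqI)
qed

lemma rep_in_K:
  assumes "c \<in> carrier (dirlim S)"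
  obtains k x where "k \<in> K" "x \<in> carrier (Grp S k)" "c = dl_class S k x"
proof -
  obtain l y where l: "l \<in> Ix S" "y \<in> carrier (Grp S l)" "c = dl_class S l y"
    using assms by (auto simp: dom.carrier_dirlim)
  obtain i where "l + i \<in> K" using K_cofinal by blast
  with l that show thesis using dom.shift_closed dom.dl_class_shift by metis
qed

lemma map_hom: "dirlim_map K T \<phi> \<in> hom (dirlim S) (dirlim T)"
proof (rule homI)
  fix c assume "c \<in> carrier (dirlim S)"
  then obtain k x where k: "k \<in> K" "x \<in> carrier (Grp S k)" "c = dl_class S k x"
    by (rule rep_in_K)
  then have "dirlim_map K T \<phi> c = dl_class T k (\<phi> k x)" by (simp add: map_dl_class)
  with k show "dirlim_map K T \<phi> c \<in> carrier (dirlim T)"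
    unfolding cod.carrier_dirlim using K_Ix \<phi>_closed by blast
next
  fix c d assume "c \<in> carrier (dirlim S)" "d \<in> carrier (dirlim S)"
  then obtain k x l y where k: "k \<in> K" "x \<in> carrier (Grp S k)" and c: "c = dl_class S k x"
    and l: "l \<in> K" "y \<in> carrier (Grp S l)" and d: "d = dl_class S l y"
    by (metis rep_in_K)
  \<comment> \<open>\<open>k + l\<close> is a stage in \<open>K\<close> above both indices:
    \<open>x\<close> moves \<open>l\<close> steps and \<open>y\<close> moves \<open>k\<close>
    steps.\<close>
  define x' where "x' = shift S k l x"
  define y' where "y' = shift S l k y"
  have kl: "k + l \<in> K" "k + l \<in> Ix S" "k + l \<in> Ix T" using k K_add K_Ix by blast+
  have x': "x' \<in> carrier (Grp S (k + l))" "c = dl_class S (k + l) x'"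
    using k K_Ix by (simp_all add: x'_def c dom.shift_closed dom.dl_class_shift)
  have y': "y' \<in> carrier (Grp S (k + l))" "d = dl_class S (k + l) y'"
    using l K_Ix dom.shift_closed[of l y k] dom.dl_class_shift[of l k y]
    by (simp_all add: y'_def d add.commute)
  interpret G: group "Grp S (k + l)" using kl by (intro dom.group_Grp)
  show "dirlim_map K T \<phi> (c \<otimes>\<^bsub>dirlim S\<^esub> d) =
      dirlim_map K T \<phi> c \<otimes>\<^bsub>dirlim T\<^esub> dirlim_map K T \<phi> d"
    using x' y' kl
    by (simp add: dom.dirlim_mult cod.dirlim_mult map_dl_class \<phi>_closed hom_mult[OF \<phi>_hom])
qed

end

section \<open>Additive calculus of arrows\<close>

text \<open>
  Membership in a hom-set is split into statements about \<open>Arr\<close>, \<open>Dom\<close> and \<open>Cod\<close>, so that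
  the simplifier can discharge all typing conditions without guessing intermediate objects.
\<close>

lemma Hom_iff: "f \<in> Hom \<C> X Y \<longleftrightarrow> f \<in> Arr \<C> \<and> Dom \<C> f = X \<and> Cod \<C> f = Y"
  by (simp add: Hom_def)

context cat
begin

lemma Arr_Hom: "f \<in> Arr \<C> \<Longrightarrow> f \<in> Hom \<C> (Dom \<C> f) (Cod \<C> f)"
  by (simp add: Hom_iff)

lemma Arr_Cmp [simp]:
  assumes "f \<in> Arr \<C>" "g \<in> Arr \<C>" "Cod \<C> f = Dom \<C> g"
  shows "g \<cdot> f \<in> Arr \<C>" "Dom \<C> (g \<cdot> f) = Dom \<C> f" "Cod \<C> (g \<cdot> f) = Cod \<C> g"
  using Cmp_Hom[of f "Dom \<C> f" "Dom \<C> g" g "Cod \<C> g"] assms by (simp_all add: Hom_iff)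

lemma Arr_Idm [simp]:
  assumes "X \<in> Obj \<C>"
  shows "Idm \<C> X \<in> Arr \<C>" "Dom \<C> (Idm \<C> X) = X" "Cod \<C> (Idm \<C> X) = X"
  using Idm_Hom[OF assms] by (simp_all add: Hom_iff)

lemma Cmp_Idm_Arr [simp]: "\<lbrakk>f \<in> Arr \<C>; Dom \<C> f = X\<rbrakk> \<Longrightarrow> f \<cdot> Idm \<C> X = f"
  using Cmp_Idm Arr_Hom by blast

lemma Idm_Cmp_Arr [simp]: "\<lbrakk>f \<in> Arr \<C>; Cod \<C> f = X\<rbrakk> \<Longrightarrow> Idm \<C> X \<cdot> f = f"
  using Idm_Cmp Arr_Hom by blast

lemma Cmp_assoc_Arr:
  "\<lbrakk>f \<in> Arr \<C>; g \<in> Arr \<C>; h \<in> Arr \<C>; Cod \<C> f = Dom \<C> g; Cod \<C> g = Dom \<C> h\<rbrakk> \<Longrightarrow> (h \<cdot> g) \<cdot> f = h \<cdot> (g \<cdot> f)"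
  by (rule Cmp_assoc[of _ "Dom \<C> f" "Dom \<C> g" _ "Dom \<C> h" _ "Cod \<C> h"]) (simp_all add: Hom_iff)

lemma kernelD:
  assumes "is_kernel \<C> f k"
  shows "f \<in> Arr \<C>" "k \<in> Arr \<C>" "Cod \<C> k = Dom \<C> f" "f \<cdot> k = Nul \<C> (Dom \<C> k) (Cod \<C> f)"
  using assms by (auto simp: is_kernel_def)

lemma kernel_factor:
  assumes "is_kernel \<C> f k" "g \<in> Arr \<C>" "Cod \<C> g = Dom \<C> f" "f \<cdot> g = Nul \<C> (Dom \<C> g) (Cod \<C> f)"
  shows "\<exists>u. u \<in> Arr \<C> \<and> Dom \<C> u = Dom \<C> g \<and> Cod \<C> u = Dom \<C> k \<and> k \<cdot> u = g"
proof -
  have "g \<in> Hom \<C> (Dom \<C> g) (Dom \<C> f)" using assms by (simp add: Hom_iff)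
  then obtain u where "u \<in> Hom \<C> (Dom \<C> g) (Dom \<C> k)" "k \<cdot> u = g"
    using assms unfolding is_kernel_def by blast
  then show ?thesis unfolding Hom_iff by blast
qed

lemma epi_cancel:
  assumes "is_epi \<C> e" "g \<cdot> e = h \<cdot> e" "g \<in> Arr \<C>" "h \<in> Arr \<C>"
    "Dom \<C> g = Cod \<C> e" "Dom \<C> h = Cod \<C> e" "Cod \<C> g = Cod \<C> h"
  shows "g = h"
proof -
  have "g \<in> Hom \<C> (Cod \<C> e) (Cod \<C> h)" "h \<in> Hom \<C> (Cod \<C> e) (Cod \<C> h)"
    using assms by (simp_all add: Hom_iff)
  with assms(1,2) show ?thesis unfolding is_epi_def by blast
qed

lemma mono_cancel:
  assumes "is_mono \<C> m" "m \<cdot> g = m \<cdot> h" "g \<in> Arr \<C>" "h \<in> Arr \<C>"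
    "Cod \<C> g = Dom \<C> m" "Cod \<C> h = Dom \<C> m" "Dom \<C> g = Dom \<C> h"
  shows "g = h"
proof -
  have "g \<in> Hom \<C> (Dom \<C> h) (Dom \<C> m)" "h \<in> Hom \<C> (Dom \<C> h) (Dom \<C> m)"
    using assms by (simp_all add: Hom_iff)
  with assms(1,2) show ?thesis unfolding is_mono_def by blast
qed

lemma projective_lift:
  assumes "projective \<C> P" "is_epi \<C> e" "f \<in> Arr \<C>" "Dom \<C> f = P" "Cod \<C> f = Cod \<C> e"
  shows "\<exists>g. g \<in> Arr \<C> \<and> Dom \<C> g = P \<and> Cod \<C> g = Dom \<C> e \<and> e \<cdot> g = f"
proof -
  have "e \<in> Hom \<C> (Dom \<C> e) (Cod \<C> e)" "f \<in> Hom \<C> P (Cod \<C> e)"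
    using assms by (auto simp: Hom_iff is_epi_def)
  then obtain g where "g \<in> Hom \<C> P (Dom \<C> e)" "e \<cdot> g = f"
    using assms unfolding projective_def by blast
  then show ?thesis unfolding Hom_iff by blast
qed

end

context preadditive_cat
begin

abbreviation plus (infixl "\<^bold>+" 65) where "f \<^bold>+ g \<equiv> Add \<C> f g"

text \<open>The group is recovered from the domain and codomain of the arrow, so the sign carries no
  object indices and can be rewritten like subtraction in a ring.\<close>

definition neg ("\<^bold>- _" [81] 80) where
  "\<^bold>- f = inv\<^bsub>hom_grp \<C> (Dom \<C> f) (Cod \<C> f)\<^esub> f"

lemma hom_grp_simps [simp]:
  "carrier (hom_grp \<C> X Y) = Hom \<C> X Y" "mult (hom_grp \<C> X Y) = Add \<C>" "one (hom_grp \<C> X Y) = Nul \<C> X Y"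
  by (simp_all add: hom_grp_def)

lemma comm_group_Arr: "f \<in> Arr \<C> \<Longrightarrow> comm_group (hom_grp \<C> (Dom \<C> f) (Cod \<C> f))"
  using Hom_comm_group Dom_Obj Cod_Obj by blast

lemma Arr_plus [simp]:
  assumes "f \<in> Arr \<C>" "g \<in> Arr \<C>" "Dom \<C> f = Dom \<C> g" "Cod \<C> f = Cod \<C> g"
  shows "f \<^bold>+ g \<in> Arr \<C>" "Dom \<C> (f \<^bold>+ g) = Dom \<C> f" "Cod \<C> (f \<^bold>+ g) = Cod \<C> f"
proof -
  interpret comm_group "hom_grp \<C> (Dom \<C> f) (Cod \<C> f)" by (rule comm_group_Arr) fact
  show "f \<^bold>+ g \<in> Arr \<C>" "Dom \<C> (f \<^bold>+ g) = Dom \<C> f" "Cod \<C> (f \<^bold>+ g) = Cod \<C> f"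
    using m_closed[of f g] assms by (simp_all add: Hom_iff)
qed

lemma Arr_neg [simp]:
  assumes "f \<in> Arr \<C>"
  shows "\<^bold>- f \<in> Arr \<C>" "Dom \<C> (\<^bold>- f) = Dom \<C> f" "Cod \<C> (\<^bold>- f) = Cod \<C> f"
proof -
  interpret comm_group "hom_grp \<C> (Dom \<C> f) (Cod \<C> f)" by (rule comm_group_Arr) fact
  show "\<^bold>- f \<in> Arr \<C>" "Dom \<C> (\<^bold>- f) = Dom \<C> f" "Cod \<C> (\<^bold>- f) = Cod \<C> f"
    using inv_closed[of f] assms by (simp_all add: Hom_iff neg_def)
qed

lemma Arr_Nul [simp]:
  assumes "X \<in> Obj \<C>" "Y \<in> Obj \<C>"
  shows "Nul \<C> X Y \<in> Arr \<C>" "Dom \<C> (Nul \<C> X Y) = X" "Cod \<C> (Nul \<C> X Y) = Y"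
proof -
  interpret comm_group "hom_grp \<C> X Y" by (rule Hom_comm_group) fact+
  show "Nul \<C> X Y \<in> Arr \<C>" "Dom \<C> (Nul \<C> X Y) = X" "Cod \<C> (Nul \<C> X Y) = Y"
    using one_closed by (simp_all add: Hom_iff)
qed

lemma inv_hom_grp: "f \<in> Hom \<C> X Y \<Longrightarrow> inv\<^bsub>hom_grp \<C> X Y\<^esub> f = \<^bold>- f"
  by (simp add: neg_def Hom_iff)

lemma plus_assoc [simp]:
  assumes "f \<in> Arr \<C>" "g \<in> Arr \<C>" "h \<in> Arr \<C>" "Dom \<C> g = Dom \<C> f" "Cod \<C> g = Cod \<C> f"
    "Dom \<C> h = Dom \<C> f" "Cod \<C> h = Cod \<C> f"
  shows "f \<^bold>+ g \<^bold>+ h = f \<^bold>+ (g \<^bold>+ h)"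
proof -
  interpret comm_group "hom_grp \<C> (Dom \<C> f) (Cod \<C> f)" by (rule comm_group_Arr) fact
  show ?thesis using m_assoc[of f g h] assms by (simp add: Hom_iff)
qed

lemma plus_left_commute:
  assumes "f \<in> Arr \<C>" "g \<in> Arr \<C>" "h \<in> Arr \<C>" "Dom \<C> g = Dom \<C> f" "Cod \<C> g = Cod \<C> f"
    "Dom \<C> h = Dom \<C> f" "Cod \<C> h = Cod \<C> f"
  shows "f \<^bold>+ (g \<^bold>+ h) = g \<^bold>+ (f \<^bold>+ h)"
proof -
  interpret comm_group "hom_grp \<C> (Dom \<C> f) (Cod \<C> f)" by (rule comm_group_Arr) fact
  show ?thesis using m_lcomm[of f g h] assms by (simp add: Hom_iff)
qed

lemma plus_Nul [simp]:
  assumes "f \<in> Arr \<C>" "Dom \<C> f = X" "Cod \<C> f = Y"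
  shows "f \<^bold>+ Nul \<C> X Y = f" "Nul \<C> X Y \<^bold>+ f = f"
proof -
  interpret comm_group "hom_grp \<C> (Dom \<C> f) (Cod \<C> f)" by (rule comm_group_Arr) fact
  show "f \<^bold>+ Nul \<C> X Y = f" "Nul \<C> X Y \<^bold>+ f = f"
    using l_one[of f] r_one[of f] assms by (simp_all add: Hom_iff)
qed

lemma plus_neg [simp]:
  assumes "f \<in> Arr \<C>"
  shows "f \<^bold>+ \<^bold>- f = Nul \<C> (Dom \<C> f) (Cod \<C> f)" "\<^bold>- f \<^bold>+ f = Nul \<C> (Dom \<C> f) (Cod \<C> f)"
proof -
  interpret comm_group "hom_grp \<C> (Dom \<C> f) (Cod \<C> f)" by (rule comm_group_Arr) fact
  show "f \<^bold>+ \<^bold>- f = Nul \<C> (Dom \<C> f) (Cod \<C> f)" "\<^bold>- f \<^bold>+ f = Nul \<C> (Dom \<C> f) (Cod \<C> f)"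
    using l_inv[of f] r_inv[of f] assms by (simp_all add: Hom_iff neg_def)
qed

lemma plus_neg_cancel [simp]:
  assumes "f \<in> Arr \<C>" "g \<in> Arr \<C>" "Dom \<C> g = Dom \<C> f" "Cod \<C> g = Cod \<C> f"
  shows "f \<^bold>+ (\<^bold>- f \<^bold>+ g) = g" "\<^bold>- f \<^bold>+ (f \<^bold>+ g) = g"
  using plus_assoc[of f "\<^bold>- f" g] plus_assoc[of "\<^bold>- f" f g] assms by simp_all

lemma neg_unique:
  assumes "f \<in> Arr \<C>" "g \<in> Arr \<C>" "Dom \<C> g = Dom \<C> f" "Cod \<C> g = Cod \<C> f"
    "g \<^bold>+ f = Nul \<C> (Dom \<C> f) (Cod \<C> f)"
  shows "g = \<^bold>- f"
proof -
  have "g = g \<^bold>+ (f \<^bold>+ \<^bold>- f)" using assms by simp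
  also have "\<dots> = g \<^bold>+ f \<^bold>+ \<^bold>- f"
    using assms by (intro plus_assoc[symmetric]) simp_all
  finally show ?thesis unfolding assms(5) using assms by simp
qed

lemma neg_neg [simp]: "f \<in> Arr \<C> \<Longrightarrow> \<^bold>- (\<^bold>- f) = f"
  by (rule neg_unique[symmetric]) simp_all

lemma neg_Nul [simp]: "\<lbrakk>X \<in> Obj \<C>; Y \<in> Obj \<C>\<rbrakk> \<Longrightarrow> \<^bold>- (Nul \<C> X Y) = Nul \<C> X Y"
  by (rule neg_unique[symmetric]) simp_all

lemma neg_plus [simp]:
  assumes "f \<in> Arr \<C>" "g \<in> Arr \<C>" "Dom \<C> g = Dom \<C> f" "Cod \<C> g = Cod \<C> f"
  shows "\<^bold>- (f \<^bold>+ g) = \<^bold>- f \<^bold>+ \<^bold>- g"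
  using assms by (intro neg_unique[symmetric]) (simp_all add: plus_left_commute[of "\<^bold>- g" f])

lemma Cmp_plus [simp]:
  "\<lbrakk>f \<in> Arr \<C>; f' \<in> Arr \<C>; g \<in> Arr \<C>; Dom \<C> f' = Dom \<C> f; Cod \<C> f = Dom \<C> g; Cod \<C> f' = Dom \<C> g\<rbrakk> \<Longrightarrow>
   g \<cdot> (f \<^bold>+ f') = (g \<cdot> f) \<^bold>+ (g \<cdot> f')"
  by (rule Cmp_Add[of _ "Dom \<C> f" "Dom \<C> g" _ _ "Cod \<C> g"]) (simp_all add: Hom_iff)

lemma plus_Cmp [simp]:
  "\<lbrakk>f \<in> Arr \<C>; g \<in> Arr \<C>; g' \<in> Arr \<C>; Cod \<C> g' = Cod \<C> g; Cod \<C> f = Dom \<C> g; Dom \<C> g' = Dom \<C> g\<rbrakk> \<Longrightarrow>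
   (g \<^bold>+ g') \<cdot> f = (g \<cdot> f) \<^bold>+ (g' \<cdot> f)"
  by (rule Add_Cmp[of _ "Dom \<C> f" "Dom \<C> g" _ "Cod \<C> g"]) (simp_all add: Hom_iff)

text \<open>Cancel \<open>f\<close> on both sides. Compositions with a zero arrow are idempotent for
  addition by distributivity, and therefore vanish.\<close>

lemma idempotent_Nul:
  assumes "f \<in> Arr \<C>" "f \<^bold>+ f = f" shows "f = Nul \<C> (Dom \<C> f) (Cod \<C> f)"
proof -
  have "f = \<^bold>- f \<^bold>+ (f \<^bold>+ f)" using assms(1) by simp
  then show ?thesis using assms by simp
qed

lemma Cmp_Nul [simp]:
  assumes "g \<in> Arr \<C>" "Dom \<C> g = Y" "X \<in> Obj \<C>"
  shows "g \<cdot> Nul \<C> X Y = Nul \<C> X (Cod \<C> g)"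
proof -
  have Y: "Y \<in> Obj \<C>" using assms Dom_Obj by blast
  have "g \<cdot> Nul \<C> X Y \<^bold>+ g \<cdot> Nul \<C> X Y = g \<cdot> (Nul \<C> X Y \<^bold>+ Nul \<C> X Y)"
    using assms Y by (intro Cmp_plus[symmetric]) simp_all
  then show ?thesis using assms Y idempotent_Nul[of "g \<cdot> Nul \<C> X Y"] by simp
qed

lemma Nul_Cmp [simp]:
  assumes "f \<in> Arr \<C>" "Cod \<C> f = X" "Y \<in> Obj \<C>"
  shows "Nul \<C> X Y \<cdot> f = Nul \<C> (Dom \<C> f) Y"
proof -
  have X: "X \<in> Obj \<C>" using assms Cod_Obj by blast
  have "Nul \<C> X Y \<cdot> f \<^bold>+ Nul \<C> X Y \<cdot> f = (Nul \<C> X Y \<^bold>+ Nul \<C> X Y) \<cdot> f"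
    using assms X by (intro plus_Cmp[symmetric]) simp_all
  then show ?thesis using assms X idempotent_Nul[of "Nul \<C> X Y \<cdot> f"] by simp
qed

lemma Cmp_neg [simp]:
  assumes "f \<in> Arr \<C>" "g \<in> Arr \<C>" "Cod \<C> f = Dom \<C> g"
  shows "g \<cdot> \<^bold>- f = \<^bold>- (g \<cdot> f)"
  using assms Dom_Obj by (intro neg_unique) (simp_all flip: Cmp_plus)

lemma neg_Cmp [simp]:
  assumes "f \<in> Arr \<C>" "g \<in> Arr \<C>" "Cod \<C> f = Dom \<C> g"
  shows "\<^bold>- g \<cdot> f = \<^bold>- (g \<cdot> f)"
  using assms Cod_Obj by (intro neg_unique) (simp_all flip: plus_Cmp)

text \<open>If \<open>k \<cdot> g = k \<cdot> h\<close>, both \<open>g\<close> and \<open>h\<close>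
  factor this arrow through the kernel, and such a factorization is unique.\<close>

lemma kernel_mono:
  assumes "is_kernel \<C> f k" shows "is_mono \<C> k"
  unfolding is_mono_def
proof (intro conjI allI ballI impI)
  note k = kernelD[OF assms]
  show "k \<in> Arr \<C>" by fact
  fix W g h assume g: "g \<in> Hom \<C> W (Dom \<C> k)" and h: "h \<in> Hom \<C> W (Dom \<C> k)" and eq: "k \<cdot> g = k \<cdot> h"
  have "f \<cdot> (k \<cdot> g) = Nul \<C> W (Cod \<C> f)"
    using g k by (simp add: Hom_iff Cod_Obj flip: Cmp_assoc_Arr)
  moreover have "k \<cdot> g \<in> Hom \<C> W (Dom \<C> f)" using g k by (simp add: Hom_iff)
  ultimately have "\<exists>!u. u \<in> Hom \<C> W (Dom \<C> k) \<and> k \<cdot> u = k \<cdot> g"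
    using assms unfolding is_kernel_def by blast
  with g h eq show "g = h" by metis
qed

lemmas kernel_cancel = mono_cancel[OF kernel_mono]

text \<open>A monomorphism \<open>m\<close> detects zero arrows, so \<open>e\<close> and
  \<open>m \<cdot> e\<close> annihilate the same arrows. For a differential written as
  \<open>Inc \<cdot> Epi\<close> this exchanges the kernel of the differential for that of
  \<open>Epi\<close>.\<close>

lemma kernel_of_mono_Cmp:
  assumes "is_kernel \<C> (m \<cdot> e) j" "is_mono \<C> m" "e \<in> Arr \<C>" "Cod \<C> e = Dom \<C> m"
  shows "is_kernel \<C> e j"
  unfolding is_kernel_def
proof (intro conjI allI ballI impI)
  have m: "m \<in> Arr \<C>" using assms by (simp add: is_mono_def)
  note j = kernelD[OF assms(1)]
  show "e \<in> Arr \<C>" "j \<in> Arr \<C>" by fact+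
  show "Cod \<C> j = Dom \<C> e" using j m assms by simp
  then have "m \<cdot> (e \<cdot> j) = m \<cdot> Nul \<C> (Dom \<C> j) (Cod \<C> e)"
    using j m assms by (simp add: Dom_Obj flip: Cmp_assoc_Arr)
  then show "e \<cdot> j = Nul \<C> (Dom \<C> j) (Cod \<C> e)"
    by (rule mono_cancel[OF assms(2)]) (use j m assms in \<open>simp_all add: Dom_Obj\<close>)
  fix W g assume g: "g \<in> Hom \<C> W (Dom \<C> e)" and "e \<cdot> g = Nul \<C> W (Cod \<C> e)"
  then have "(m \<cdot> e) \<cdot> g = Nul \<C> W (Cod \<C> (m \<cdot> e))"
    using j m assms Dom_Obj by (auto simp: Hom_iff Cmp_assoc_Arr)
  moreover have "g \<in> Hom \<C> W (Dom \<C> (m \<cdot> e))" using g m assms by simp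
  ultimately show "\<exists>!u. u \<in> Hom \<C> W (Dom \<C> j) \<and> j \<cdot> u = g"
    using assms(1) unfolding is_kernel_def by blast
qed

end

section \<open>Exact sequences and resolutions\<close>

context abelian_cat
begin

text \<open>In an abelian category \<open>e\<close> is the cokernel of some \<open>g\<close>. This
  \<open>g\<close> factors through the kernel \<open>k\<close> of \<open>e\<close>, so
  \<open>f\<close> kills \<open>g\<close> as soon as it kills \<open>k\<close>, and the universal
  property of the cokernel applies.\<close>

lemma epi_factor:
  assumes e: "is_epi \<C> e" and k: "is_kernel \<C> e k"
    and f: "f \<in> Arr \<C>" "Dom \<C> f = Dom \<C> e" "f \<cdot> k = Nul \<C> (Dom \<C> k) (Cod \<C> f)"
  shows "\<exists>u. u \<in> Arr \<C> \<and> Dom \<C> u = Cod \<C> e \<and> Cod \<C> u = Cod \<C> f \<and> u \<cdot> e = f"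
proof -
  obtain g where g: "is_cokernel \<C> g e" using epi_normal[OF e] by blast
  have g': "g \<in> Arr \<C>" "e \<in> Arr \<C>" "Dom \<C> e = Cod \<C> g" "e \<cdot> g = Nul \<C> (Dom \<C> g) (Cod \<C> e)"
    using g by (auto simp: is_cokernel_def)
  then obtain u where u: "u \<in> Arr \<C>" "Dom \<C> u = Dom \<C> g" "Cod \<C> u = Dom \<C> k" "k \<cdot> u = g"
    using kernel_factor[OF k] by metis
  have "f \<cdot> g = f \<cdot> (k \<cdot> u)" by (simp add: u)
  also have "\<dots> = (f \<cdot> k) \<cdot> u"
    using f u kernelD[OF k] by (intro Cmp_assoc_Arr[symmetric]) simp_all
  also have "\<dots> = Nul \<C> (Dom \<C> g) (Cod \<C> f)"
    using f u by (simp add: Cod_Obj)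
  finally have fg: "f \<cdot> g = Nul \<C> (Dom \<C> g) (Cod \<C> f)" .
  have "f \<in> Hom \<C> (Cod \<C> g) (Cod \<C> f)" using f g' by (simp add: Hom_iff)
  with fg obtain v where "v \<in> Hom \<C> (Cod \<C> e) (Cod \<C> f)" "v \<cdot> e = f"
    using g unfolding is_cokernel_def by blast
  then show ?thesis unfolding Hom_iff by blast
qed

text \<open>\<open>q\<close> is the kernel of some \<open>g\<close>; being also epi, it forces
  \<open>g\<close> to be zero, so the identity factors through \<open>q\<close>.\<close>

lemma mono_epi_right_inverse:
  assumes "is_mono \<C> q" "is_epi \<C> q"
  shows "\<exists>u. u \<in> Arr \<C> \<and> Dom \<C> u = Cod \<C> q \<and> Cod \<C> u = Dom \<C> q \<and> q \<cdot> u = Idm \<C> (Cod \<C> q)"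
proof -
  obtain g where g: "is_kernel \<C> g q" using mono_normal[OF assms(1)] by blast
  note g' = kernelD[OF g]
  have "g \<cdot> q = Nul \<C> (Cod \<C> q) (Cod \<C> g) \<cdot> q" using g' by (simp add: Cod_Obj)
  then have "g = Nul \<C> (Cod \<C> q) (Cod \<C> g)"
    by (rule epi_cancel[OF assms(2)]) (use g' in \<open>simp_all add: Cod_Obj Dom_Obj\<close>)
  then have "g \<cdot> Idm \<C> (Cod \<C> q) = Nul \<C> (Cod \<C> q) (Cod \<C> g)" using g' by (simp add: Dom_Obj)
  then show ?thesis using kernel_factor[OF g, of "Idm \<C> (Cod \<C> q)"] g' Dom_Obj by auto
qed

text \<open>Exactness gives \<open>i = j \<cdot> q\<close> with \<open>j\<close> a kernel and
  \<open>q\<close> epi. Monicity of \<open>i\<close> passes to \<open>q\<close>, which therefore has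
  a right inverse, and the universal property of \<open>j\<close> carries over to
  \<open>i\<close>.\<close>

lemma short_exact_kernel:
  assumes "short_exact \<C> X Y Z i p"
  shows "is_kernel \<C> p i"
proof -
  have i: "i \<in> Arr \<C>" "is_mono \<C> i" "Dom \<C> i = X" "Cod \<C> i = Y"
    and p: "p \<in> Arr \<C>" "Dom \<C> p = Y"
    using assms by (auto simp: short_exact_def Hom_iff)
  obtain j q where j: "is_kernel \<C> p j" and q: "q \<in> Arr \<C>" "Dom \<C> q = X" "Cod \<C> q = Dom \<C> j"
    "is_epi \<C> q" "j \<cdot> q = i"
  proof -
    have "exact_at \<C> i p" using assms by (simp add: short_exact_def)
    with that show thesis unfolding exact_at_def Hom_iff i(3) by blast
  qed
  note j' = kernelD[OF j]
  have "is_mono \<C> q"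
    unfolding is_mono_def
  proof (intro conjI allI ballI impI)
    fix W g h assume g: "g \<in> Hom \<C> W (Dom \<C> q)" "h \<in> Hom \<C> W (Dom \<C> q)" "q \<cdot> g = q \<cdot> h"
    then have "i \<cdot> g = i \<cdot> h"
      using q j' by (auto simp: Hom_iff Cmp_assoc_Arr simp flip: q(5))
    then show "g = h"
      by (rule mono_cancel[OF i(2)]) (use g q i in \<open>simp_all add: Hom_iff\<close>)
  qed fact
  then obtain u where u: "u \<in> Arr \<C>" "Dom \<C> u = Cod \<C> q" "Cod \<C> u = Dom \<C> q" "q \<cdot> u = Idm \<C> (Cod \<C> q)"
    using q mono_epi_right_inverse by metis
  show ?thesis
    unfolding is_kernel_def
  proof (intro conjI allI ballI impI)
    show "p \<cdot> i = Nul \<C> (Dom \<C> i) (Cod \<C> p)"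
      using q j' p by (simp add: Cod_Obj flip: q(5) Cmp_assoc_Arr)
    fix W g assume g: "g \<in> Hom \<C> W (Dom \<C> p)" "p \<cdot> g = Nul \<C> W (Cod \<C> p)"
    then obtain v where v: "v \<in> Arr \<C>" "Dom \<C> v = W" "Cod \<C> v = Dom \<C> j" "j \<cdot> v = g"
      using kernel_factor[OF j, of g] by (auto simp: Hom_iff)
    \<comment> \<open>Factor \<open>g\<close> through \<open>j\<close> by \<open>v\<close>, then go
      back along the right inverse \<open>u\<close> of \<open>q\<close>.\<close>
    have "i \<cdot> (u \<cdot> v) = j \<cdot> ((q \<cdot> u) \<cdot> v)"
      using u(1-3) v(1-3) q j' by (simp add: Cmp_assoc_Arr flip: q(5))
    also have "\<dots> = g" using v q by (simp add: u)
    finally have "i \<cdot> (u \<cdot> v) = g" .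
    then show "\<exists>!u. u \<in> Hom \<C> W (Dom \<C> i) \<and> i \<cdot> u = g"
      using u v q i by (intro ex1I[of _ "u \<cdot> v"]) (auto simp: Hom_iff intro: mono_cancel[OF i(2)])
  qed (use i p in simp_all)
qed

text \<open>The comparison \<open>w\<close> of the two kernels has the right inverse
  \<open>v\<close>, hence is epi, and \<open>r\<close> is \<open>w\<close> after \<open>q\<close>.
  This moves surjectivity from the kernel offered by exactness to the chosen embedding of a
  syzygy.\<close>

lemma epi_onto_kernel:
  assumes j: "is_kernel \<C> e j" and i: "is_kernel \<C> e i"
    and q: "is_epi \<C> q" "Cod \<C> q = Dom \<C> j" and r: "r \<in> Arr \<C>" "Cod \<C> r = Dom \<C> i" "Dom \<C> r = Dom \<C> q"
    and eq: "i \<cdot> r = j \<cdot> q"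
  shows "is_epi \<C> r"
proof -
  note i' = kernelD[OF i] and j' = kernelD[OF j]
  have q': "q \<in> Arr \<C>" using q by (simp add: is_epi_def)
  obtain v where v: "v \<in> Arr \<C>" "Dom \<C> v = Dom \<C> i" "Cod \<C> v = Dom \<C> j" "j \<cdot> v = i"
    using kernel_factor[OF j, of i] i' by auto
  obtain w where w: "w \<in> Arr \<C>" "Dom \<C> w = Dom \<C> j" "Cod \<C> w = Dom \<C> i" "i \<cdot> w = j"
    using kernel_factor[OF i, of j] j' by auto
  have "i \<cdot> (w \<cdot> v) = i \<cdot> Idm \<C> (Dom \<C> i)"
    using i' v w by (simp add: Dom_Obj flip: Cmp_assoc_Arr)
  then have wv: "w \<cdot> v = Idm \<C> (Dom \<C> i)"
    by (rule kernel_cancel[OF i]) (use i' v w in \<open>simp_all add: Dom_Obj\<close>)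
  have "i \<cdot> r = i \<cdot> (w \<cdot> q)"
    using i' w q q' by (simp add: eq flip: Cmp_assoc_Arr)
  then have r_eq: "r = w \<cdot> q"
    by (rule kernel_cancel[OF i]) (use i' r w q q' in simp_all)
  show ?thesis
    unfolding is_epi_def
  proof (intro conjI allI ballI impI)
    fix W g h assume g: "g \<in> Hom \<C> (Cod \<C> r) W" "h \<in> Hom \<C> (Cod \<C> r) W" "g \<cdot> r = h \<cdot> r"
    then have "(g \<cdot> w) \<cdot> q = (h \<cdot> w) \<cdot> q"
      using w q q' r by (simp add: r_eq Hom_iff Cmp_assoc_Arr)
    then have "g \<cdot> w = h \<cdot> w"
      by (rule epi_cancel[OF q(1)]) (use g w q r in \<open>simp_all add: Hom_iff\<close>)
    then have "g \<cdot> (w \<cdot> v) = h \<cdot> (w \<cdot> v)"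
      using g w v r by (simp add: Hom_iff flip: Cmp_assoc_Arr)
    then show "g = h" using g r by (simp add: wv Hom_iff)
  qed fact
qed

text \<open>What later arguments use of a resolution: the short exact pieces from which it is
  spliced. Surjectivity of every \<open>Epi R k\<close> is made explicit, since
  \<open>syzygies\<close> records for \<open>k \<ge> 1\<close> only that these arrows factor the
  differentials.\<close>

definition syz_chain :: "('a, 'b) resolution \<Rightarrow> bool" where
  "syz_chain R \<longleftrightarrow> (\<forall>k. projective \<C> (Pr R k) \<and>
     Epi R k \<in> Hom \<C> (Pr R k) (Syz R k) \<and> is_epi \<C> (Epi R k) \<and>
     Inc R (Suc k) \<in> Hom \<C> (Syz R (Suc k)) (Pr R k) \<and> is_kernel \<C> (Epi R k) (Inc R (Suc k)) \<and>
     Df R (Suc k) = Inc R (Suc k) \<cdot> Epi R (Suc k))"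

text \<open>The point is surjectivity onto the later syzygies: exactness in degree \<open>k\<close>
  provides a kernel onto which \<open>Df R (Suc k)\<close> maps epimorphically, and
  \<open>epi_onto_kernel\<close> transfers this to \<open>Inc R (Suc k)\<close>.\<close>

lemma syz_resolution_imp_chain:
  assumes "syz_resolution \<C> M R"
  shows "syz_chain R"
proof -
  have res: "\<And>k. projective \<C> (Pr R k)" "Aug R \<in> Hom \<C> (Pr R 0) M" "is_epi \<C> (Aug R)"
      "exact_at \<C> (Df R (Suc 0)) (Aug R)" "\<And>k. exact_at \<C> (Df R (Suc (Suc k))) (Df R (Suc k))"
    and syz: "Syz R 0 = M" "Epi R 0 = Aug R"
      "\<And>k. Inc R (Suc k) \<in> Hom \<C> (Syz R (Suc k)) (Pr R k)"
      "\<And>k. is_kernel \<C> (Epi R k) (Inc R (Suc k))"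
      "\<And>k. Epi R (Suc k) \<in> Hom \<C> (Pr R (Suc k)) (Syz R (Suc k))"
      "\<And>k. Inc R (Suc k) \<cdot> Epi R (Suc k) = Df R (Suc k)"
    using assms by (auto simp: syz_resolution_def proj_resolution_def syzygies_def)
  have epi_step: "is_epi \<C> (Epi R (Suc k))" if "is_kernel \<C> (Epi R k) j"
      "q \<in> Hom \<C> (Dom \<C> (Df R (Suc k))) (Dom \<C> j)" "is_epi \<C> q" "j \<cdot> q = Df R (Suc k)" for k j q
  proof (rule epi_onto_kernel[OF that(1) syz(4)])
    have "Dom \<C> (Df R (Suc k)) = Pr R (Suc k)"
      using syz(3)[of k] syz(5)[of k] by (simp add: Hom_iff flip: syz(6))
    then show "Dom \<C> (Epi R (Suc k)) = Dom \<C> q"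
      using that syz(5)[of k] by (simp add: Hom_iff)
  qed (use that syz(3)[of k] syz(5)[of k] syz(6)[of k] in \<open>simp_all add: Hom_iff\<close>)
  have "is_epi \<C> (Epi R k)" for k
  proof (induction k)
    case 0
    then show ?case using res syz by simp
  next
    case (Suc k)
    show ?case
    proof (cases k)
      case 0
      obtain j q where "is_kernel \<C> (Epi R 0) j"
          "q \<in> Hom \<C> (Dom \<C> (Df R (Suc 0))) (Dom \<C> j)" "is_epi \<C> q" "j \<cdot> q = Df R (Suc 0)"
        using res(4) unfolding exact_at_def syz(2) by blast
      then show ?thesis unfolding 0 by (rule epi_step)
    next
      case (Suc l)
      obtain j q where j: "is_kernel \<C> (Df R (Suc l)) j"
          "q \<in> Hom \<C> (Dom \<C> (Df R (Suc (Suc l)))) (Dom \<C> j)" "is_epi \<C> q" "j \<cdot> q = Df R (Suc (Suc l))"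
        using res(5)[of l] unfolding exact_at_def by blast
      \<comment> \<open>Exactness speaks of a kernel of the differential; since
        \<open>Inc R (Suc l)\<close> is monic, it is a kernel of \<open>Epi R (Suc l)\<close>
        too.\<close>
      have "is_kernel \<C> (Epi R (Suc l)) j"
      proof (rule kernel_of_mono_Cmp)
        show "is_kernel \<C> (Inc R (Suc l) \<cdot> Epi R (Suc l)) j" unfolding syz(6) by (rule j(1))
        show "is_mono \<C> (Inc R (Suc l))" using syz(4) by (rule kernel_mono)
      qed (use syz(3)[of l] syz(5)[of l] in \<open>simp_all add: Hom_iff\<close>)
      then show ?thesis unfolding Suc using epi_step j by blast
    qed
  qed
  moreover have "Epi R k \<in> Hom \<C> (Pr R k) (Syz R k)" for k
    using res syz by (cases k) simp_all
  ultimately show ?thesis using res syz by (simp add: syz_chain_def)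
qed

lemma
  assumes "syz_chain R"
  shows projective_Pr: "projective \<C> (Pr R k)"
    and Obj_Pr [simp]: "Pr R k \<in> Obj \<C>"
    and Arr_Epi [simp]: "Epi R k \<in> Arr \<C>"
    and Dom_Epi [simp]: "Dom \<C> (Epi R k) = Pr R k"
    and Cod_Epi [simp]: "Cod \<C> (Epi R k) = Syz R k"
    and epi_Epi: "is_epi \<C> (Epi R k)"
    and Arr_Inc [simp]: "Inc R (Suc k) \<in> Arr \<C>"
    and Dom_Inc [simp]: "Dom \<C> (Inc R (Suc k)) = Syz R (Suc k)"
    and Cod_Inc [simp]: "Cod \<C> (Inc R (Suc k)) = Pr R k"
    and kernel_Inc: "is_kernel \<C> (Epi R k) (Inc R (Suc k))"
    and Df_eq: "Df R (Suc k) = Inc R (Suc k) \<cdot> Epi R (Suc k)"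
  using assms by (auto simp: syz_chain_def Hom_iff projective_def)

lemma Obj_Syz [simp]: "syz_chain R \<Longrightarrow> Syz R k \<in> Obj \<C>"
  using Cod_Obj[OF Arr_Epi] by simp

lemma Epi_Inc [simp]: "syz_chain R \<Longrightarrow> Epi R k \<cdot> Inc R (Suc k) = Nul \<C> (Syz R (Suc k)) (Syz R k)"
  using kernelD[OF kernel_Inc] by simp

end

section \<open>Ext groups and stable Hom groups as subquotients\<close>

context abelian_cat
begin

text \<open>In an additive setting a product is also a sum: the injections \<open>i\<close> and
  \<open>j\<close> satisfy \<open>i \<cdot> p + j \<cdot> q = id\<close>. A lifting problem is
  solved on both summands and the solutions are added.\<close>

lemma projective_product:
  assumes P: "projective \<C> P" and P': "projective \<C> P'" and prod: "is_product \<C> P P' Q p q"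
  shows "projective \<C> Q"
proof -
  have obj: "P \<in> Obj \<C>" "P' \<in> Obj \<C>" "Q \<in> Obj \<C>"
    using assms by (auto simp: projective_def is_product_def)
  have pq: "p \<in> Arr \<C>" "q \<in> Arr \<C>" "Dom \<C> p = Q" "Dom \<C> q = Q" "Cod \<C> p = P" "Cod \<C> q = P'"
    using prod by (auto simp: is_product_def Hom_iff)
  have univ: "\<exists>!u. u \<in> Hom \<C> W Q \<and> p \<cdot> u = f \<and> q \<cdot> u = g" if "f \<in> Hom \<C> W P" "g \<in> Hom \<C> W P'" for W f g
    using prod that by (simp add: is_product_def)
  obtain i where i: "i \<in> Arr \<C>" "Dom \<C> i = P" "Cod \<C> i = Q" "p \<cdot> i = Idm \<C> P" "q \<cdot> i = Nul \<C> P P'"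
    using univ[of "Idm \<C> P" P "Nul \<C> P P'"] obj by (auto simp: Hom_iff)
  obtain j where j: "j \<in> Arr \<C>" "Dom \<C> j = P'" "Cod \<C> j = Q" "p \<cdot> j = Nul \<C> P' P" "q \<cdot> j = Idm \<C> P'"
    using univ[of "Nul \<C> P' P" P' "Idm \<C> P'"] obj by (auto simp: Hom_iff)
  have id: "i \<cdot> p \<^bold>+ j \<cdot> q = Idm \<C> Q"
  proof -
    have "p \<cdot> (i \<cdot> p \<^bold>+ j \<cdot> q) = p" "q \<cdot> (i \<cdot> p \<^bold>+ j \<cdot> q) = q"
      using pq i j obj by (simp_all flip: Cmp_assoc_Arr)
    moreover have "i \<cdot> p \<^bold>+ j \<cdot> q \<in> Hom \<C> Q Q" "Idm \<C> Q \<in> Hom \<C> Q Q" "p \<cdot> Idm \<C> Q = p" "q \<cdot> Idm \<C> Q = q"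
      using pq i j obj by (simp_all add: Hom_iff)
    moreover have "p \<in> Hom \<C> Q P" "q \<in> Hom \<C> Q P'" using pq by (simp_all add: Hom_iff)
    ultimately show ?thesis using univ by metis
  qed
  show ?thesis
    unfolding projective_def
  proof (intro conjI allI ballI impI)
    fix X Y e f assume e: "e \<in> Hom \<C> X Y" "is_epi \<C> e" and f: "f \<in> Hom \<C> Q Y"
    obtain a where a: "a \<in> Arr \<C>" "Dom \<C> a = P" "Cod \<C> a = X" "e \<cdot> a = f \<cdot> i"
      using projective_lift[OF P e(2), of "f \<cdot> i"] e f i by (auto simp: Hom_iff)
    obtain b where b: "b \<in> Arr \<C>" "Dom \<C> b = P'" "Cod \<C> b = X" "e \<cdot> b = f \<cdot> j"
      using projective_lift[OF P' e(2), of "f \<cdot> j"] e f j by (auto simp: Hom_iff)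
    have "e \<cdot> (a \<cdot> p \<^bold>+ b \<cdot> q) = (e \<cdot> a) \<cdot> p \<^bold>+ (e \<cdot> b) \<cdot> q"
      using a(1-3) b(1-3) e pq by (simp add: Hom_iff Cmp_assoc_Arr)
    also have "\<dots> = f \<cdot> (i \<cdot> p \<^bold>+ j \<cdot> q)"
      using a b f i j pq by (simp add: Hom_iff Cmp_assoc_Arr)
    finally have "e \<cdot> (a \<cdot> p \<^bold>+ b \<cdot> q) = f" using f by (simp add: id Hom_iff)
    moreover have "a \<cdot> p \<^bold>+ b \<cdot> q \<in> Hom \<C> Q X" using a b pq by (simp add: Hom_iff)
    ultimately show "\<exists>g\<in>Hom \<C> Q X. e \<cdot> g = f" by blast
  qed fact
qed

lemma proj_maps_iff:
  "f \<in> proj_maps \<C> X Y \<longleftrightarrow> (\<exists>g h. g \<in> Arr \<C> \<and> h \<in> Arr \<C> \<and> Dom \<C> g = X \<and> Cod \<C> h = Y \<and>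
     Cod \<C> g = Dom \<C> h \<and> projective \<C> (Dom \<C> h) \<and> f = h \<cdot> g)"
  unfolding proj_maps_def Hom_iff by (smt (verit) mem_Collect_eq)

lemma proj_mapsI:
  "\<lbrakk>g \<in> Arr \<C>; h \<in> Arr \<C>; Dom \<C> g = X; Cod \<C> h = Y; Cod \<C> g = Dom \<C> h; projective \<C> (Dom \<C> h)\<rbrakk> \<Longrightarrow>
   h \<cdot> g \<in> proj_maps \<C> X Y"
  by (auto simp: proj_maps_iff)

lemma proj_maps_Arr:
  "f \<in> proj_maps \<C> X Y \<Longrightarrow> f \<in> Arr \<C> \<and> Dom \<C> f = X \<and> Cod \<C> f = Y"
  by (auto simp: proj_maps_iff)

lemma proj_maps_Cmp_left:
  assumes "f \<in> proj_maps \<C> X Y" "g \<in> Arr \<C>" "Dom \<C> g = Y" "Cod \<C> g = W"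
  shows "g \<cdot> f \<in> proj_maps \<C> X W"
proof -
  obtain a b where "a \<in> Arr \<C>" "b \<in> Arr \<C>" "Dom \<C> a = X" "Cod \<C> b = Y"
     "Cod \<C> a = Dom \<C> b" "projective \<C> (Dom \<C> b)" "f = b \<cdot> a"
    using assms(1) by (auto simp: proj_maps_iff)
  then show ?thesis using assms proj_mapsI[of a "g \<cdot> b"] by (simp add: Cmp_assoc_Arr)
qed

lemma proj_maps_Cmp_right:
  assumes "f \<in> proj_maps \<C> X Y" "g \<in> Arr \<C>" "Cod \<C> g = X" "Dom \<C> g = W"
  shows "f \<cdot> g \<in> proj_maps \<C> W Y"
proof -
  obtain a b where "a \<in> Arr \<C>" "b \<in> Arr \<C>" "Dom \<C> a = X" "Cod \<C> b = Y"
     "Cod \<C> a = Dom \<C> b" "projective \<C> (Dom \<C> b)" "f = b \<cdot> a"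
    using assms(1) by (auto simp: proj_maps_iff)
  then show ?thesis using assms proj_mapsI[of "a \<cdot> g" b] by (simp add: Cmp_assoc_Arr)
qed

text \<open>Factor through the product of the two projectives: the pair \<open>(a, a')\<close>
  followed by \<open>b \<cdot> p + b' \<cdot> q\<close>.\<close>

lemma proj_maps_plus:
  assumes "f \<in> proj_maps \<C> X Y" "f' \<in> proj_maps \<C> X Y"
  shows "f \<^bold>+ f' \<in> proj_maps \<C> X Y"
proof -
  obtain a b where a: "a \<in> Arr \<C>" "b \<in> Arr \<C>" "Dom \<C> a = X" "Cod \<C> b = Y"
     "Cod \<C> a = Dom \<C> b" "projective \<C> (Dom \<C> b)" "f = b \<cdot> a"
    using assms(1) by (auto simp: proj_maps_iff)
  obtain a' b' where a': "a' \<in> Arr \<C>" "b' \<in> Arr \<C>" "Dom \<C> a' = X" "Cod \<C> b' = Y"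
     "Cod \<C> a' = Dom \<C> b'" "projective \<C> (Dom \<C> b')" "f' = b' \<cdot> a'"
    using assms(2) by (auto simp: proj_maps_iff)
  obtain Q p q where Q: "is_product \<C> (Dom \<C> b) (Dom \<C> b') Q p q"
    using ex_product a a' Dom_Obj by blast
  then have pq: "p \<in> Arr \<C>" "q \<in> Arr \<C>" "Dom \<C> p = Q" "Dom \<C> q = Q" "Cod \<C> p = Dom \<C> b" "Cod \<C> q = Dom \<C> b'"
    by (auto simp: is_product_def Hom_iff)
  have "\<exists>!u. u \<in> Hom \<C> X Q \<and> p \<cdot> u = a \<and> q \<cdot> u = a'"
    using Q a a' by (simp add: is_product_def Hom_iff)
  then obtain u where u: "u \<in> Arr \<C>" "Dom \<C> u = X" "Cod \<C> u = Q" "p \<cdot> u = a" "q \<cdot> u = a'"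
    by (auto simp: Hom_iff)
  have "(b \<cdot> p \<^bold>+ b' \<cdot> q) \<cdot> u = f \<^bold>+ f'"
    using a a' pq u by (simp add: Cmp_assoc_Arr)
  moreover have "(b \<cdot> p \<^bold>+ b' \<cdot> q) \<cdot> u \<in> proj_maps \<C> X Y"
    using a a' pq u projective_product[OF a(6) a'(6) Q] by (intro proj_mapsI) simp_all
  ultimately show ?thesis by simp
qed

text \<open>\<open>Epi R (Suc m)\<close> is epi, so killing the differential is the same as killing
  the embedding of the next syzygy. In this form \<open>epi_factor\<close> shows that a cocycle
  descends along \<open>Epi R m\<close>.\<close>

lemma cocycles_iff:
  assumes "syz_chain R" "Y \<in> Obj \<C>"
  shows "f \<in> cocycles \<C> R Y m \<longleftrightarrow> f \<in> Arr \<C> \<and> Dom \<C> f = Pr R m \<and> Cod \<C> f = Y \<and>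
     f \<cdot> Inc R (Suc m) = Nul \<C> (Syz R (Suc m)) Y"
proof -
  have "f \<cdot> Inc R (Suc m) = Nul \<C> (Syz R (Suc m)) Y"
    if f: "f \<in> Arr \<C>" "Dom \<C> f = Pr R m" "Cod \<C> f = Y" "f \<cdot> Df R (Suc m) = Nul \<C> (Pr R (Suc m)) Y"
  proof (rule epi_cancel[OF epi_Epi])
    show "(f \<cdot> Inc R (Suc m)) \<cdot> Epi R (Suc m) = Nul \<C> (Syz R (Suc m)) Y \<cdot> Epi R (Suc m)"
      using f assms by (simp add: Cmp_assoc_Arr Df_eq)
  qed (use f assms in simp_all)
  moreover have "f \<cdot> Df R (Suc m) = Nul \<C> (Pr R (Suc m)) Y"
    if "f \<in> Arr \<C>" "Dom \<C> f = Pr R m" "Cod \<C> f = Y" "f \<cdot> Inc R (Suc m) = Nul \<C> (Syz R (Suc m)) Y"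
    using that assms by (simp add: Df_eq flip: Cmp_assoc_Arr)
  ultimately show ?thesis by (auto simp: cocycles_def Hom_iff)
qed

lemma coboundaries_0: "coboundaries \<C> R Y 0 = {Nul \<C> (Pr R 0) Y}"
  by (simp add: coboundaries_def)

lemma coboundaries_Suc_iff:
  assumes "syz_chain R"
  shows "f \<in> coboundaries \<C> R Y (Suc l) \<longleftrightarrow>
    (\<exists>g. g \<in> Arr \<C> \<and> Dom \<C> g = Pr R l \<and> Cod \<C> g = Y \<and> f = (g \<cdot> Inc R (Suc l)) \<cdot> Epi R (Suc l))"
  using assms by (auto simp: coboundaries_def Hom_iff Df_eq image_iff Cmp_assoc_Arr)

lemma Df_Inc:
  assumes "syz_chain R"
  shows "Df R (Suc l) \<cdot> Inc R (Suc (Suc l)) = Nul \<C> (Syz R (Suc (Suc l))) (Pr R l)"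
  using assms by (simp add: Df_eq Cmp_assoc_Arr)

lemma subquotient_Ext:
  assumes R: "syz_chain R" and Y: "Y \<in> Obj \<C>"
  shows "subquotient (hom_grp \<C> (Pr R m) Y) (cocycles \<C> R Y m) (coboundaries \<C> R Y m)"
proof -
  interpret G: comm_group "hom_grp \<C> (Pr R m) Y"
    using assms by (intro Hom_comm_group) simp_all
  have coc: "subgroup (cocycles \<C> R Y m) (hom_grp \<C> (Pr R m) Y)"
  proof (rule G.subgroupI)
    have "Nul \<C> (Pr R m) Y \<in> cocycles \<C> R Y m" using assms by (simp add: cocycles_iff)
    then show "cocycles \<C> R Y m \<noteq> {}" by blast
  qed (use assms in \<open>auto simp: cocycles_iff Hom_iff inv_hom_grp\<close>)
  have cob: "subgroup (coboundaries \<C> R Y m) (hom_grp \<C> (Pr R m) Y) \<and>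
      coboundaries \<C> R Y m \<subseteq> cocycles \<C> R Y m"
  proof (cases m)
    case 0
    then show ?thesis using assms G.triv_subgroup by (auto simp: coboundaries_0 cocycles_iff)
  next
    case (Suc l)
    have "subgroup (coboundaries \<C> R Y m) (hom_grp \<C> (Pr R m) Y)"
    proof (rule G.subgroupI)
      show "coboundaries \<C> R Y m \<subseteq> carrier (hom_grp \<C> (Pr R m) Y)"
        using assms by (auto simp: Suc coboundaries_Suc_iff Hom_iff)
      have "(Nul \<C> (Pr R l) Y \<cdot> Inc R (Suc l)) \<cdot> Epi R (Suc l) \<in> coboundaries \<C> R Y m"
        unfolding Suc coboundaries_Suc_iff[OF R] using assms by (intro exI[of _ "Nul \<C> (Pr R l) Y"]) simp
      then show "coboundaries \<C> R Y m \<noteq> {}" by blast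
    next
      fix a assume "a \<in> coboundaries \<C> R Y m"
      then obtain g where g: "g \<in> Arr \<C>" "Dom \<C> g = Pr R l" "Cod \<C> g = Y" "a = (g \<cdot> Inc R (Suc l)) \<cdot> Epi R (Suc l)"
        using assms by (auto simp: Suc coboundaries_Suc_iff)
      have "inv\<^bsub>hom_grp \<C> (Pr R m) Y\<^esub> a = \<^bold>- a"
        using g assms by (intro inv_hom_grp) (simp add: Hom_iff Suc)
      with g assms show "inv\<^bsub>hom_grp \<C> (Pr R m) Y\<^esub> a \<in> coboundaries \<C> R Y m"
        by (simp add: Suc coboundaries_Suc_iff) (intro exI[of _ "\<^bold>- g"], simp)
      fix b assume "b \<in> coboundaries \<C> R Y m"
      then obtain h where h: "h \<in> Arr \<C>" "Dom \<C> h = Pr R l" "Cod \<C> h = Y" "b = (h \<cdot> Inc R (Suc l)) \<cdot> Epi R (Suc l)"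
        using assms by (auto simp: Suc coboundaries_Suc_iff)
      with g assms show "a \<otimes>\<^bsub>hom_grp \<C> (Pr R m) Y\<^esub> b \<in> coboundaries \<C> R Y m"
        by (simp add: Suc coboundaries_Suc_iff) (intro exI[of _ "g \<^bold>+ h"], simp)
    qed
    then show ?thesis
      using assms by (auto simp: Suc coboundaries_Suc_iff cocycles_iff Cmp_assoc_Arr)
  qed
  then show ?thesis
    using coc G.comm_group_axioms by (intro subquotient.intro subquotient_axioms.intro) simp_all
qed

lemma Ext_nonneg:
  "Ext \<C> R Y (int m) = ((hom_grp \<C> (Pr R m) Y)\<lparr>carrier := cocycles \<C> R Y m\<rparr>) Mod (coboundaries \<C> R Y m)"
  by (simp add: Ext_def)

lemma carrier_Ext:
  assumes "syz_chain R" "Y \<in> Obj \<C>"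
  shows "carrier (Ext \<C> R Y (int m)) = ext_class \<C> R Y m ` cocycles \<C> R Y m"
  using subquotient.carrier_Q[OF subquotient_Ext[OF assms]] by (simp add: Ext_nonneg ext_class_def)

lemma comm_group_Ext:
  assumes "syz_chain R" "Y \<in> Obj \<C>"
  shows "comm_group (Ext \<C> R Y m)"
proof (cases "m < 0")
  case True
  then show ?thesis by (simp add: Ext_def)
next
  case False
  then show ?thesis
    using subquotient.comm_group_Q[OF subquotient_Ext[OF assms], of "nat m"] by (simp add: Ext_def)
qed

lemma inv_ext_class:
  assumes "syz_chain R" "Y \<in> Obj \<C>" "f \<in> cocycles \<C> R Y m"
  shows "inv\<^bsub>Ext \<C> R Y (int m)\<^esub> (ext_class \<C> R Y m f) = ext_class \<C> R Y m (\<^bold>- f)"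
  using subquotient.inv_Q[OF subquotient_Ext[OF assms(1,2)], of f m] assms
  by (simp add: Ext_nonneg ext_class_def inv_hom_grp cocycles_iff Hom_iff)

end

locale projective_cat = abelian_cat +
  assumes enough: "enough_projectives \<C>"
begin

lemma subquotient_st_hom:
  assumes X: "X \<in> Obj \<C>" and Y: "Y \<in> Obj \<C>"
  shows "subquotient (hom_grp \<C> X Y) (Hom \<C> X Y) (proj_maps \<C> X Y)"
proof -
  interpret G: comm_group "hom_grp \<C> X Y"
    using assms by (rule Hom_comm_group)
  have "subgroup (Hom \<C> X Y) (hom_grp \<C> X Y)"
    using G.subgroup_self by simp
  moreover have "subgroup (proj_maps \<C> X Y) (hom_grp \<C> X Y)"
  proof (rule G.subgroupI)
    \<comment> \<open>Enough projectives enter here: the zero arrow factors through a projective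
      mapping to \<open>Y\<close>, so the subset is inhabited.\<close>
    obtain P e where "projective \<C> P" "e \<in> Hom \<C> P Y"
      using enough Y unfolding enough_projectives_def by blast
    then have "e \<cdot> Nul \<C> X P \<in> proj_maps \<C> X Y"
      using X by (intro proj_mapsI) (auto simp: Hom_iff projective_def)
    then show "proj_maps \<C> X Y \<noteq> {}" by blast
  next
    fix f assume f: "f \<in> proj_maps \<C> X Y"
    then have "inv\<^bsub>hom_grp \<C> X Y\<^esub> f = \<^bold>- (Idm \<C> Y) \<cdot> f"
      using Y proj_maps_Arr by (auto simp: inv_hom_grp Hom_iff)
    moreover have "\<^bold>- (Idm \<C> Y) \<cdot> f \<in> proj_maps \<C> X Y"
      using f Y by (intro proj_maps_Cmp_left) simp_all
    ultimately show "inv\<^bsub>hom_grp \<C> X Y\<^esub> f \<in> proj_maps \<C> X Y" by simp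
  qed (auto simp: proj_maps_plus Hom_iff dest: proj_maps_Arr)
  moreover have "proj_maps \<C> X Y \<subseteq> Hom \<C> X Y"
    by (auto simp: Hom_iff dest: proj_maps_Arr)
  ultimately show ?thesis
    using G.comm_group_axioms by (intro subquotient.intro subquotient_axioms.intro) simp_all
qed

text \<open>Replacing the carrier by itself changes nothing; it brings the stable Hom group into the
  form \<open>Z\<close> modulo \<open>N\<close> shared with Ext.\<close>

lemma st_hom_eq: "st_hom \<C> X Y = ((hom_grp \<C> X Y)\<lparr>carrier := Hom \<C> X Y\<rparr>) Mod (proj_maps \<C> X Y)"
  by (simp add: st_hom_def hom_grp_def)

lemma carrier_st_hom:
  assumes "X \<in> Obj \<C>" "Y \<in> Obj \<C>"
  shows "carrier (st_hom \<C> X Y) = st_class \<C> X Y ` Hom \<C> X Y"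
  using subquotient.carrier_Q[OF subquotient_st_hom[OF assms]] by (simp add: st_hom_eq st_class_def)

lemma comm_group_st_hom: "\<lbrakk>X \<in> Obj \<C>; Y \<in> Obj \<C>\<rbrakk> \<Longrightarrow> comm_group (st_hom \<C> X Y)"
  using subquotient.comm_group_Q[OF subquotient_st_hom] by (simp add: st_hom_eq)

lemma inv_st_class:
  assumes "X \<in> Obj \<C>" "Y \<in> Obj \<C>" "f \<in> Hom \<C> X Y"
  shows "inv\<^bsub>st_hom \<C> X Y\<^esub> (st_class \<C> X Y f) = st_class \<C> X Y (\<^bold>- f)"
  using subquotient.inv_Q[OF subquotient_st_hom[OF assms(1,2)], of f] assms
  by (simp add: st_hom_eq st_class_def inv_hom_grp)

end

section \<open>The maps on representatives\<close>

context abelian_cat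
begin

section \<open>The snake lemma relation behind the connecting homomorphism\<close>

definition delta_rel where
  "delta_rel R X Y i p m f w \<longleftrightarrow> (\<exists>g. g \<in> Hom \<C> (Pr R m) Y \<and> p \<cdot> g = f \<and>
     w \<in> Hom \<C> (Pr R (Suc m)) X \<and> i \<cdot> w = g \<cdot> Df R (Suc m))"

lemma Arr_Df [simp]:
  assumes "syz_chain R"
  shows "Df R (Suc m) \<in> Arr \<C>" "Dom \<C> (Df R (Suc m)) = Pr R (Suc m)" "Cod \<C> (Df R (Suc m)) = Pr R m"
  using assms by (simp_all add: Df_eq)

lemma Df_Df:
  assumes "syz_chain R"
  shows "Df R (Suc l) \<cdot> Df R (Suc (Suc l)) = Nul \<C> (Pr R (Suc (Suc l))) (Pr R l)"
proof -
  have "Df R (Suc l) \<cdot> Df R (Suc (Suc l)) = (Df R (Suc l) \<cdot> Inc R (Suc (Suc l))) \<cdot> Epi R (Suc (Suc l))"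
    unfolding Df_eq[OF assms, of "Suc l"] using assms by (intro Cmp_assoc_Arr[symmetric]) simp_all
  then show ?thesis using assms by (simp add: Df_Inc)
qed

lemma cocycle_Df:
  assumes "syz_chain R" "f \<in> cocycles \<C> R Y m"
  shows "f \<cdot> Df R (Suc m) = Nul \<C> (Pr R (Suc m)) Y"
  using assms by (simp add: cocycles_def)

lemma delta_rel_ex:
  assumes R: "syz_chain R" and i: "i \<in> Hom \<C> X Y" and p: "p \<in> Hom \<C> Y Z"
    and ker: "is_kernel \<C> p i" and epi: "is_epi \<C> p" and f: "f \<in> cocycles \<C> R Z m"
  shows "\<exists>w. delta_rel R X Y i p m f w"
proof -
  have Z: "Z \<in> Obj \<C>" using p Cod_Obj by (auto simp: Hom_iff)
  have f': "f \<in> Arr \<C>" "Dom \<C> f = Pr R m" "Cod \<C> f = Z"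
    using f R Z by (simp_all add: cocycles_iff)
  obtain g where g: "g \<in> Arr \<C>" "Dom \<C> g = Pr R m" "Cod \<C> g = Y" "p \<cdot> g = f"
    using projective_lift[OF projective_Pr[OF R] epi f'(1,2)] f' p by (auto simp: Hom_iff)
  have "p \<cdot> (g \<cdot> Df R (Suc m)) = (p \<cdot> g) \<cdot> Df R (Suc m)"
    using R g(1-3) p by (simp add: Hom_iff Cmp_assoc_Arr)
  also have "\<dots> = Nul \<C> (Pr R (Suc m)) Z"
    using R f by (simp add: g(4) cocycle_Df)
  finally have "p \<cdot> (g \<cdot> Df R (Suc m)) = Nul \<C> (Pr R (Suc m)) Z" .
  then obtain w where "w \<in> Arr \<C>" "Dom \<C> w = Pr R (Suc m)" "Cod \<C> w = X" "i \<cdot> w = g \<cdot> Df R (Suc m)"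
    using kernel_factor[OF ker, of "g \<cdot> Df R (Suc m)"] R g(1-3) p i by (auto simp: Hom_iff)
  with g show ?thesis unfolding delta_rel_def Hom_iff by blast
qed

lemma delta_rel_plus:
  assumes R: "syz_chain R" and i: "i \<in> Hom \<C> X Y" and p: "p \<in> Hom \<C> Y Z"
    and "delta_rel R X Y i p m f w" "delta_rel R X Y i p m f' w'"
  shows "delta_rel R X Y i p m (f \<^bold>+ f') (w \<^bold>+ w')"
proof -
  obtain g g' where "g \<in> Hom \<C> (Pr R m) Y" "p \<cdot> g = f" "w \<in> Hom \<C> (Pr R (Suc m)) X" "i \<cdot> w = g \<cdot> Df R (Suc m)"
    "g' \<in> Hom \<C> (Pr R m) Y" "p \<cdot> g' = f'" "w' \<in> Hom \<C> (Pr R (Suc m)) X" "i \<cdot> w' = g' \<cdot> Df R (Suc m)"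
    using assms(4,5) by (auto simp: delta_rel_def)
  then show ?thesis
    unfolding delta_rel_def using R i p by (intro exI[of _ "g \<^bold>+ g'"]) (simp add: Hom_iff)
qed

lemma delta_rel_neg:
  assumes R: "syz_chain R" and i: "i \<in> Hom \<C> X Y" and p: "p \<in> Hom \<C> Y Z"
    and "delta_rel R X Y i p m f w"
  shows "delta_rel R X Y i p m (\<^bold>- f) (\<^bold>- w)"
proof -
  obtain g where "g \<in> Hom \<C> (Pr R m) Y" "p \<cdot> g = f" "w \<in> Hom \<C> (Pr R (Suc m)) X" "i \<cdot> w = g \<cdot> Df R (Suc m)"
    using assms(4) by (auto simp: delta_rel_def)
  then show ?thesis
    unfolding delta_rel_def using R i p by (intro exI[of _ "\<^bold>- g"]) (simp add: Hom_iff)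
qed

lemma delta_rel_cocycle:
  assumes R: "syz_chain R" and i: "i \<in> Hom \<C> X Y" and ker: "is_kernel \<C> p i"
    and "delta_rel R X Y i p m f w"
  shows "w \<in> cocycles \<C> R X (Suc m)"
proof -
  obtain g where g: "g \<in> Hom \<C> (Pr R m) Y" and w: "w \<in> Hom \<C> (Pr R (Suc m)) X" "i \<cdot> w = g \<cdot> Df R (Suc m)"
    using assms(4) by (auto simp: delta_rel_def)
  have obj: "X \<in> Obj \<C>" "Y \<in> Obj \<C>" using i Dom_Obj Cod_Obj by (auto simp: Hom_iff)
  have "i \<cdot> (w \<cdot> Inc R (Suc (Suc m))) = (i \<cdot> w) \<cdot> Inc R (Suc (Suc m))"
    using R i w(1) by (simp add: Hom_iff Cmp_assoc_Arr)
  also have "\<dots> = i \<cdot> Nul \<C> (Syz R (Suc (Suc m))) X"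
    using R g i obj by (simp add: w(2) Hom_iff Cmp_assoc_Arr Df_Inc)
  finally have "w \<cdot> Inc R (Suc (Suc m)) = Nul \<C> (Syz R (Suc (Suc m))) X"
    by (rule kernel_cancel[OF ker]) (use R w(1) i obj in \<open>simp_all add: Hom_iff\<close>)
  then show ?thesis using R w(1) obj by (simp add: cocycles_iff Hom_iff)
qed

text \<open>A coboundary \<open>g \<cdot> \<partial>\<close> lifts to
  \<open>c \<cdot> \<partial>\<close> where \<open>c\<close> lifts \<open>g\<close>, and the next
  differential kills it. In degree 0 the only coboundary is zero and lifts to zero.\<close>

lemma coboundary_lift:
  assumes R: "syz_chain R" and p: "p \<in> Hom \<C> Y Z" and epi: "is_epi \<C> p"
    and f: "f \<in> coboundaries \<C> R Z m"
  obtains c where "c \<in> Arr \<C>" "Dom \<C> c = Pr R m" "Cod \<C> c = Y" "p \<cdot> c = f"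
    "c \<cdot> Df R (Suc m) = Nul \<C> (Pr R (Suc m)) Y"
proof (cases m)
  case 0
  have "Y \<in> Obj \<C>" using p Dom_Obj by (auto simp: Hom_iff)
  then show thesis
    using that[of "Nul \<C> (Pr R m) Y"] R p f by (simp add: 0 coboundaries_0 Hom_iff)
next
  case (Suc l)
  have Y: "Y \<in> Obj \<C>" using p Dom_Obj by (auto simp: Hom_iff)
  obtain g where g: "g \<in> Arr \<C>" "Dom \<C> g = Pr R l" "Cod \<C> g = Z" "f = (g \<cdot> Inc R (Suc l)) \<cdot> Epi R (Suc l)"
    using f R by (auto simp: Suc coboundaries_Suc_iff)
  obtain c where c: "c \<in> Arr \<C>" "Dom \<C> c = Pr R l" "Cod \<C> c = Y" "p \<cdot> c = g"
    using projective_lift[OF projective_Pr[OF R] epi g(1,2)] g p by (auto simp: Hom_iff)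
  have "p \<cdot> (c \<cdot> Df R (Suc l)) = (p \<cdot> c) \<cdot> Df R (Suc l)"
    using R c(1-3) p by (simp add: Hom_iff Cmp_assoc_Arr)
  also have "\<dots> = f" using R g by (simp add: c(4) Df_eq Cmp_assoc_Arr)
  finally show thesis
    using R c(1-3) Y that[of "c \<cdot> Df R (Suc l)"]
    by (simp add: Suc Cmp_assoc_Arr Df_Df)
qed

text \<open>The lift \<open>g\<close> of \<open>f\<close> and a lift \<open>c\<close> killed by the
  differential differ by an arrow \<open>r\<close> into \<open>X\<close>; hence
  \<open>w = r \<cdot> \<partial>\<close>. With additivity of \<open>delta_rel\<close> this gives
  independence of representative and lift.\<close>

lemma delta_rel_coboundary:
  assumes R: "syz_chain R" and i: "i \<in> Hom \<C> X Y" and p: "p \<in> Hom \<C> Y Z"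
    and ker: "is_kernel \<C> p i" and epi: "is_epi \<C> p"
    and "delta_rel R X Y i p m f w" and f: "f \<in> coboundaries \<C> R Z m"
  shows "w \<in> coboundaries \<C> R X (Suc m)"
proof -
  obtain g where g: "g \<in> Hom \<C> (Pr R m) Y" "p \<cdot> g = f"
    and w: "w \<in> Hom \<C> (Pr R (Suc m)) X" "i \<cdot> w = g \<cdot> Df R (Suc m)"
    using assms(6) by (auto simp: delta_rel_def)
  have obj: "X \<in> Obj \<C>" "Y \<in> Obj \<C>" using i Dom_Obj Cod_Obj by (auto simp: Hom_iff)
  obtain c where c: "c \<in> Arr \<C>" "Dom \<C> c = Pr R m" "Cod \<C> c = Y" "p \<cdot> c = f"
    "c \<cdot> Df R (Suc m) = Nul \<C> (Pr R (Suc m)) Y"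
    using coboundary_lift[OF R p epi f] by blast
  have "p \<cdot> (g \<^bold>+ \<^bold>- c) = (p \<cdot> g) \<^bold>+ \<^bold>- (p \<cdot> c)"
    using g(1) c(1-3) p by (simp add: Hom_iff)
  also have "\<dots> = Nul \<C> (Pr R m) Z"
    unfolding g(2) c(4) using g p by (auto simp: Hom_iff)
  finally obtain r where r: "r \<in> Arr \<C>" "Dom \<C> r = Pr R m" "Cod \<C> r = X" "i \<cdot> r = g \<^bold>+ \<^bold>- c"
    using kernel_factor[OF ker, of "g \<^bold>+ \<^bold>- c"] g(1) c(1-3) p i by (auto simp: Hom_iff)
  have "i \<cdot> (r \<cdot> Df R (Suc m)) = (i \<cdot> r) \<cdot> Df R (Suc m)"
    using R r(1-3) i by (simp add: Hom_iff Cmp_assoc_Arr)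
  also have "\<dots> = i \<cdot> w"
    unfolding r(4) w(2) using R g(1) c(1-3) obj by (simp add: Hom_iff c(5))
  finally have "r \<cdot> Df R (Suc m) = w"
    by (rule kernel_cancel[OF ker]) (use R r(1-3) w(1) i in \<open>simp_all add: Hom_iff\<close>)
  then show ?thesis using R r(1-3) by (auto simp: coboundaries_def Hom_iff)
qed

lemma subquotient_map_delta:
  assumes R: "syz_chain R" and i: "i \<in> Hom \<C> X Y" and p: "p \<in> Hom \<C> Y Z"
    and ker: "is_kernel \<C> p i" and epi: "is_epi \<C> p"
  shows "subquotient_map (hom_grp \<C> (Pr R m) Z) (cocycles \<C> R Z m) (coboundaries \<C> R Z m)
    (hom_grp \<C> (Pr R (Suc m)) X) (cocycles \<C> R X (Suc m)) (coboundaries \<C> R X (Suc m))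
    (delta_rel R X Y i p m)"
proof -
  have obj: "X \<in> Obj \<C>" "Z \<in> Obj \<C>" using i p Dom_Obj Cod_Obj by (auto simp: Hom_iff)
  show ?thesis
  proof (intro subquotient_map.intro subquotient_map_axioms.intro subquotient_Ext R obj)
    fix a b a' b'
    assume ab: "delta_rel R X Y i p m a b" "delta_rel R X Y i p m a' b'"
      and a: "a \<in> cocycles \<C> R Z m" "a' \<in> cocycles \<C> R Z m"
      and diff: "a \<otimes>\<^bsub>hom_grp \<C> (Pr R m) Z\<^esub> inv\<^bsub>hom_grp \<C> (Pr R m) Z\<^esub> a' \<in> coboundaries \<C> R Z m"
    have b': "b' \<in> Hom \<C> (Pr R (Suc m)) X" using ab by (auto simp: delta_rel_def)
    have a': "a' \<in> Hom \<C> (Pr R m) Z" using a by (simp add: cocycles_def)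
    have "delta_rel R X Y i p m (a \<^bold>+ \<^bold>- a') (b \<^bold>+ \<^bold>- b')"
      by (intro delta_rel_plus[OF R i p] delta_rel_neg[OF R i p] ab)
    then have "b \<^bold>+ \<^bold>- b' \<in> coboundaries \<C> R X (Suc m)"
      by (rule delta_rel_coboundary[OF R i p ker epi]) (use diff a' in \<open>simp add: inv_hom_grp\<close>)
    then show "b \<otimes>\<^bsub>hom_grp \<C> (Pr R (Suc m)) X\<^esub> inv\<^bsub>hom_grp \<C> (Pr R (Suc m)) X\<^esub> b' \<in> coboundaries \<C> R X (Suc m)"
      using b' by (simp add: inv_hom_grp)
  qed (use delta_rel_ex[OF R i p ker epi] delta_rel_cocycle[OF R i ker] in blast)+
qed

lemma delta_ext_class:
  assumes R: "syz_chain R" and i: "i \<in> Hom \<C> X Y" and p: "p \<in> Hom \<C> Y Z"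
    and ker: "is_kernel \<C> p i" and epi: "is_epi \<C> p"
    and f: "f \<in> cocycles \<C> R Z m" and w: "delta_rel R X Y i p m f w"
  shows "delta \<C> R X Y i p (int m) (ext_class \<C> R Z m f) = ext_class \<C> R X (Suc m) w"
proof -
  have "delta \<C> R X Y i p (int m) x =
      (THE y. \<exists>f w. f \<in> x \<and> delta_rel R X Y i p m f w \<and> y = ext_class \<C> R X (Suc m) w)" for x
    unfolding delta_def delta_rel_def nat_int
    by (subst if_not_P, simp) (intro arg_cong[where f = The] ext, blast)
  then show ?thesis
    using subquotient_map.the_coset[OF subquotient_map_delta[OF R i p ker epi] w f]
    by (simp only: ext_class_def)
qed

lemma delta_hom:
  assumes R: "syz_chain R" and i: "i \<in> Hom \<C> X Y" and p: "p \<in> Hom \<C> Y Z"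
    and ker: "is_kernel \<C> p i" and epi: "is_epi \<C> p"
  shows "delta \<C> R X Y i p j \<in> hom (Ext \<C> R Z j) (Ext \<C> R X (j + 1))"
proof (cases "j < 0")
  \<comment> \<open>In negative degrees the source is trivial and \<open>delta\<close> is the
    constant unit. For \<open>j = -1\<close> the target is the possibly non-trivial group in degree
    0.\<close>
  case True
  have "X \<in> Obj \<C>" using i Dom_Obj by (auto simp: Hom_iff)
  then interpret comm_group "Ext \<C> R X (j + 1)" using R by (intro comm_group_Ext)
  show ?thesis using True by (auto simp: hom_def delta_def)
next
  case False
  define m where "m = nat j"
  have j: "j = int m" "j + 1 = int (Suc m)" using False by (simp_all add: m_def)
  interpret subquotient_map "hom_grp \<C> (Pr R m) Z" "cocycles \<C> R Z m" "coboundaries \<C> R Z m"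
    "hom_grp \<C> (Pr R (Suc m)) X" "cocycles \<C> R X (Suc m)" "coboundaries \<C> R X (Suc m)"
    "delta_rel R X Y i p m"
    by (rule subquotient_map_delta[OF assms])
  show ?thesis
    unfolding j(2) unfolding j(1) Ext_nonneg
  proof (rule hom_of_rel)
    fix a b assume "delta_rel R X Y i p m a b" "a \<in> cocycles \<C> R Z m"
    then show "delta \<C> R X Y i p (int m) (coboundaries \<C> R Z m #>\<^bsub>hom_grp \<C> (Pr R m) Z\<^esub> a) =
        coboundaries \<C> R X (Suc m) #>\<^bsub>hom_grp \<C> (Pr R (Suc m)) X\<^esub> b"
      using delta_ext_class[OF assms] by (simp add: ext_class_def)
  next
    fix a a' assume "a \<in> cocycles \<C> R Z m" "a' \<in> cocycles \<C> R Z m"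
    then obtain b b' where "delta_rel R X Y i p m a b" "delta_rel R X Y i p m a' b'"
      using tot by blast
    then show "\<exists>b b'. delta_rel R X Y i p m a b \<and> delta_rel R X Y i p m a' b' \<and>
        delta_rel R X Y i p m (a \<otimes>\<^bsub>hom_grp \<C> (Pr R m) Z\<^esub> a') (b \<otimes>\<^bsub>hom_grp \<C> (Pr R (Suc m)) X\<^esub> b')"
      unfolding hom_grp_simps using delta_rel_plus[OF R i p] by blast
  qed
qed

section \<open>Arrows induced between consecutive syzygies\<close>

lemma syz_induced_ex:
  assumes A: "syz_chain RA" and Y: "syz_chain RY" and f: "f \<in> Hom \<C> (Syz RA m) (Syz RY k)"
  shows "\<exists>f'. syz_induced \<C> RA RY m k f f'"
proof -
  obtain F where F: "F \<in> Arr \<C>" "Dom \<C> F = Pr RA m" "Cod \<C> F = Pr RY k" "Epi RY k \<cdot> F = f \<cdot> Epi RA m"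
    using projective_lift[OF projective_Pr[OF A] epi_Epi[OF Y], of "f \<cdot> Epi RA m"] f A Y by (auto simp: Hom_iff)
  have "Epi RY k \<cdot> (F \<cdot> Inc RA (Suc m)) = (Epi RY k \<cdot> F) \<cdot> Inc RA (Suc m)"
    using A Y F(1-3) by (simp add: Cmp_assoc_Arr)
  also have "\<dots> = Nul \<C> (Syz RA (Suc m)) (Syz RY k)"
    unfolding F(4) using A Y f by (simp add: Hom_iff Cmp_assoc_Arr)
  finally obtain f' where "f' \<in> Arr \<C>" "Dom \<C> f' = Syz RA (Suc m)" "Cod \<C> f' = Syz RY (Suc k)"
    "Inc RY (Suc k) \<cdot> f' = F \<cdot> Inc RA (Suc m)"
    using kernel_factor[OF kernel_Inc[OF Y], of "F \<cdot> Inc RA (Suc m)" k] A Y F(1-3) by (simp, blast)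
  with F show ?thesis
    unfolding syz_induced_def by (intro exI[of _ f'] conjI bexI[of _ F]) (simp_all add: Hom_iff)
qed

lemma syz_induced_plus:
  assumes A: "syz_chain RA" and Y: "syz_chain RY"
    and "f \<in> Hom \<C> (Syz RA m) (Syz RY k)" "g \<in> Hom \<C> (Syz RA m) (Syz RY k)"
    and "syz_induced \<C> RA RY m k f f'" "syz_induced \<C> RA RY m k g g'"
  shows "syz_induced \<C> RA RY m k (f \<^bold>+ g) (f' \<^bold>+ g')"
proof -
  obtain F G where "F \<in> Hom \<C> (Pr RA m) (Pr RY k)" "Epi RY k \<cdot> F = f \<cdot> Epi RA m"
      "Inc RY (Suc k) \<cdot> f' = F \<cdot> Inc RA (Suc m)"
    and "G \<in> Hom \<C> (Pr RA m) (Pr RY k)" "Epi RY k \<cdot> G = g \<cdot> Epi RA m"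
      "Inc RY (Suc k) \<cdot> g' = G \<cdot> Inc RA (Suc m)"
    and "f' \<in> Hom \<C> (Syz RA (Suc m)) (Syz RY (Suc k))" "g' \<in> Hom \<C> (Syz RA (Suc m)) (Syz RY (Suc k))"
    using assms(5,6) unfolding syz_induced_def by blast
  then show ?thesis
    unfolding syz_induced_def using A Y assms(3,4)
    by (intro conjI bexI[of _ "F \<^bold>+ G"]) (simp_all add: Hom_iff)
qed

lemma syz_induced_neg:
  assumes A: "syz_chain RA" and Y: "syz_chain RY" and "f \<in> Hom \<C> (Syz RA m) (Syz RY k)"
    and "syz_induced \<C> RA RY m k f f'"
  shows "syz_induced \<C> RA RY m k (\<^bold>- f) (\<^bold>- f')"
proof -
  obtain F where "F \<in> Hom \<C> (Pr RA m) (Pr RY k)" "Epi RY k \<cdot> F = f \<cdot> Epi RA m"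
      "Inc RY (Suc k) \<cdot> f' = F \<cdot> Inc RA (Suc m)"
    and "f' \<in> Hom \<C> (Syz RA (Suc m)) (Syz RY (Suc k))"
    using assms(4) unfolding syz_induced_def by blast
  then show ?thesis
    unfolding syz_induced_def using A Y assms(3)
    by (intro conjI bexI[of _ "\<^bold>- F"]) (simp_all add: Hom_iff)
qed

text \<open>Lifts compose: \<open>G \<cdot> F\<close> lifts \<open>g \<cdot> f\<close>. In the
  square for \<open>tau\<close> this allows \<open>h' \<cdot> f'\<close> to be pushed on by inducing
  from \<open>h'\<close> and \<open>f'\<close> separately.\<close>

lemma syz_induced_Cmp:
  assumes A: "syz_chain RA" and X: "syz_chain RX" and Y: "syz_chain RY"
    and f: "f \<in> Hom \<C> (Syz RA m) (Syz RX k)" and g: "g \<in> Hom \<C> (Syz RX k) (Syz RY l)"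
    and "syz_induced \<C> RA RX m k f f'" "syz_induced \<C> RX RY k l g g'"
  shows "syz_induced \<C> RA RY m l (g \<cdot> f) (g' \<cdot> f')"
proof -
  obtain F where F: "F \<in> Hom \<C> (Pr RA m) (Pr RX k)" "Epi RX k \<cdot> F = f \<cdot> Epi RA m"
      "Inc RX (Suc k) \<cdot> f' = F \<cdot> Inc RA (Suc m)" "f' \<in> Hom \<C> (Syz RA (Suc m)) (Syz RX (Suc k))"
    using assms(6) unfolding syz_induced_def by blast
  obtain G where G: "G \<in> Hom \<C> (Pr RX k) (Pr RY l)" "Epi RY l \<cdot> G = g \<cdot> Epi RX k"
      "Inc RY (Suc l) \<cdot> g' = G \<cdot> Inc RX (Suc k)" "g' \<in> Hom \<C> (Syz RX (Suc k)) (Syz RY (Suc l))"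
    using assms(7) unfolding syz_induced_def by blast
  have "Epi RY l \<cdot> (G \<cdot> F) = (Epi RY l \<cdot> G) \<cdot> F"
    using Y F(1) G(1) by (simp add: Hom_iff Cmp_assoc_Arr)
  also have "\<dots> = (g \<cdot> f) \<cdot> Epi RA m"
    unfolding G(2) using A X F(1,2) f g by (simp add: Hom_iff Cmp_assoc_Arr)
  finally have 1: "Epi RY l \<cdot> (G \<cdot> F) = (g \<cdot> f) \<cdot> Epi RA m" .
  have "Inc RY (Suc l) \<cdot> (g' \<cdot> f') = (Inc RY (Suc l) \<cdot> g') \<cdot> f'"
    using Y F(4) G(4) by (simp add: Hom_iff Cmp_assoc_Arr)
  also have "\<dots> = (G \<cdot> F) \<cdot> Inc RA (Suc m)"
    unfolding G(3) using A X F(1,3,4) G(1) by (simp add: Hom_iff Cmp_assoc_Arr)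
  finally show ?thesis
    unfolding syz_induced_def using 1 F(1,4) G(1,4)
    by (intro conjI bexI[of _ "G \<cdot> F"]) (simp_all add: Hom_iff)
qed

text \<open>If \<open>f = b \<cdot> a\<close> over a projective, a lift of \<open>b\<close> along
  \<open>Epi RY k\<close> yields a second lift of \<open>f \<cdot> Epi\<close>, one that vanishes on
  the next syzygy. Its difference from \<open>F\<close> comes from an arrow \<open>r\<close> into
  the next syzygy of \<open>RY\<close>, so \<open>f' = r \<cdot> Inc\<close> factors through
  \<open>Pr RA m\<close>.\<close>

lemma syz_induced_proj:
  assumes A: "syz_chain RA" and Y: "syz_chain RY" and f: "f \<in> proj_maps \<C> (Syz RA m) (Syz RY k)"
    and ind: "syz_induced \<C> RA RY m k f f'"
  shows "f' \<in> proj_maps \<C> (Syz RA (Suc m)) (Syz RY (Suc k))"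
proof -
  obtain F where F0: "F \<in> Hom \<C> (Pr RA m) (Pr RY k)" and F4: "Epi RY k \<cdot> F = f \<cdot> Epi RA m"
      and F5: "Inc RY (Suc k) \<cdot> f' = F \<cdot> Inc RA (Suc m)"
      and f'0: "f' \<in> Hom \<C> (Syz RA (Suc m)) (Syz RY (Suc k))"
    using ind unfolding syz_induced_def by blast
  note F = F0[unfolded Hom_iff] and f' = f'0[unfolded Hom_iff]
  obtain a b where ab: "a \<in> Arr \<C>" "b \<in> Arr \<C>" "Dom \<C> a = Syz RA m" "Cod \<C> b = Syz RY k"
     "Cod \<C> a = Dom \<C> b" "projective \<C> (Dom \<C> b)" "f = b \<cdot> a"
    using f by (auto simp: proj_maps_iff)
  obtain l where l: "l \<in> Arr \<C>" "Dom \<C> l = Dom \<C> b" "Cod \<C> l = Pr RY k" "Epi RY k \<cdot> l = b"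
    using projective_lift[OF ab(6) epi_Epi[OF Y] ab(2)] ab Y by (simp, blast)
  let ?c = "l \<cdot> (a \<cdot> Epi RA m)"
  have c: "?c \<in> Arr \<C>" "Dom \<C> ?c = Pr RA m" "Cod \<C> ?c = Pr RY k"
    using A ab(1-5) l(1-3) by simp_all
  have "Epi RY k \<cdot> ?c = (Epi RY k \<cdot> l) \<cdot> (a \<cdot> Epi RA m)"
    using A Y ab(1-5) l(1-3) by (simp add: Cmp_assoc_Arr)
  also have "\<dots> = f \<cdot> Epi RA m"
    unfolding l(4) ab(7) using A ab(1-5) by (simp add: Cmp_assoc_Arr)
  finally have Ec: "Epi RY k \<cdot> ?c = f \<cdot> Epi RA m" .
  have "Epi RY k \<cdot> (F \<^bold>+ \<^bold>- ?c) = Epi RY k \<cdot> F \<^bold>+ \<^bold>- (Epi RY k \<cdot> ?c)"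
    using Y F c by simp
  also have "\<dots> = Nul \<C> (Pr RA m) (Syz RY k)"
    unfolding Ec F4 using A ab by simp
  finally obtain r where r: "r \<in> Arr \<C>" "Dom \<C> r = Pr RA m" "Cod \<C> r = Syz RY (Suc k)"
    "Inc RY (Suc k) \<cdot> r = F \<^bold>+ \<^bold>- ?c"
    using kernel_factor[OF kernel_Inc[OF Y], of "F \<^bold>+ \<^bold>- ?c" k] Y F c by (simp, blast)
  have "Inc RY (Suc k) \<cdot> (r \<cdot> Inc RA (Suc m)) = (Inc RY (Suc k) \<cdot> r) \<cdot> Inc RA (Suc m)"
    using A Y r(1-3) by (simp add: Cmp_assoc_Arr)
  also have "\<dots> = Inc RY (Suc k) \<cdot> f'"
    unfolding r(4) F5 using A Y F l(1-3) ab(1-5) by (simp add: Cmp_assoc_Arr Dom_Obj)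
  finally have "r \<cdot> Inc RA (Suc m) = f'"
    by (rule kernel_cancel[OF kernel_Inc[OF Y]]) (use A Y r(1-3) f' in simp_all)
  then show ?thesis
    using A r(1-3) projective_Pr[OF A] proj_mapsI[of "Inc RA (Suc m)" r] by simp
qed

section \<open>Cocycles as arrows on syzygies\<close>

definition beta_rel where
  "beta_rel RA Y m f f' \<longleftrightarrow> f' \<in> Hom \<C> (Syz RA m) Y \<and> f = f' \<cdot> Epi RA m"

lemma beta_rel_ex:
  assumes A: "syz_chain RA" and Y: "Y \<in> Obj \<C>" and f: "f \<in> cocycles \<C> RA Y m"
  shows "\<exists>f'. beta_rel RA Y m f f'"
proof -
  have "f \<in> Arr \<C>" "Dom \<C> f = Pr RA m" "Cod \<C> f = Y" "f \<cdot> Inc RA (Suc m) = Nul \<C> (Syz RA (Suc m)) Y"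
    using f A Y by (simp_all add: cocycles_iff)
  then obtain f' where "f' \<in> Arr \<C>" "Dom \<C> f' = Syz RA m" "Cod \<C> f' = Y" "f' \<cdot> Epi RA m = f"
    using epi_factor[OF epi_Epi[OF A] kernel_Inc[OF A], of f m] A by (simp, blast)
  then show ?thesis unfolding beta_rel_def Hom_iff by blast
qed

lemma beta_rel_cocycle:
  assumes "syz_chain RA" "Y \<in> Obj \<C>" "f' \<in> Hom \<C> (Syz RA m) Y"
  shows "f' \<cdot> Epi RA m \<in> cocycles \<C> RA Y m"
  using assms by (simp add: cocycles_iff Hom_iff Cmp_assoc_Arr)

text \<open>A coboundary \<open>g \<cdot> \<partial>\<close> descends to
  \<open>g \<cdot> Inc\<close>, which passes through the projective \<open>Pr RA l\<close>. Positive
  degree enters here: it supplies the term in degree \<open>l\<close>.\<close>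

lemma beta_rel_proj:
  assumes A: "syz_chain RA" and f: "f \<in> coboundaries \<C> RA Y (Suc l)" and rel: "beta_rel RA Y (Suc l) f f'"
  shows "f' \<in> proj_maps \<C> (Syz RA (Suc l)) Y"
proof -
  obtain g where g: "g \<in> Arr \<C>" "Dom \<C> g = Pr RA l" "Cod \<C> g = Y" "f = (g \<cdot> Inc RA (Suc l)) \<cdot> Epi RA (Suc l)"
    using f A by (auto simp: coboundaries_Suc_iff)
  have "f' \<cdot> Epi RA (Suc l) = (g \<cdot> Inc RA (Suc l)) \<cdot> Epi RA (Suc l)"
    using rel g by (simp add: beta_rel_def)
  then have "f' = g \<cdot> Inc RA (Suc l)"
    by (rule epi_cancel[OF epi_Epi[OF A]]) (use A g(1-3) rel in \<open>simp_all add: beta_rel_def Hom_iff\<close>)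
  then show ?thesis
    using A g(1-3) projective_Pr[OF A] proj_mapsI[of "Inc RA (Suc l)" g] by simp
qed

end

section \<open>The homomorphisms \<open>t_map\<close> and \<open>beta\<close> and their
  compatibility\<close>

context projective_cat
begin

lemma subquotient_map_t:
  assumes A: "syz_chain RA" and Y: "syz_chain RY"
  shows "subquotient_map (hom_grp \<C> (Syz RA m) (Syz RY k)) (Hom \<C> (Syz RA m) (Syz RY k))
    (proj_maps \<C> (Syz RA m) (Syz RY k)) (hom_grp \<C> (Syz RA (Suc m)) (Syz RY (Suc k)))
    (Hom \<C> (Syz RA (Suc m)) (Syz RY (Suc k))) (proj_maps \<C> (Syz RA (Suc m)) (Syz RY (Suc k)))
    (syz_induced \<C> RA RY m k)"
proof (intro subquotient_map.intro subquotient_map_axioms.intro subquotient_st_hom)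
  fix a b a' b'
  assume ab: "syz_induced \<C> RA RY m k a b" "syz_induced \<C> RA RY m k a' b'"
    and a: "a \<in> Hom \<C> (Syz RA m) (Syz RY k)" "a' \<in> Hom \<C> (Syz RA m) (Syz RY k)"
    and diff: "a \<otimes>\<^bsub>hom_grp \<C> (Syz RA m) (Syz RY k)\<^esub> inv\<^bsub>hom_grp \<C> (Syz RA m) (Syz RY k)\<^esub> a'
      \<in> proj_maps \<C> (Syz RA m) (Syz RY k)"
  have b': "b' \<in> Hom \<C> (Syz RA (Suc m)) (Syz RY (Suc k))" using ab by (simp add: syz_induced_def)
  have "\<^bold>- a' \<in> Hom \<C> (Syz RA m) (Syz RY k)" using a by (simp add: Hom_iff)
  then have "syz_induced \<C> RA RY m k (a \<^bold>+ \<^bold>- a') (b \<^bold>+ \<^bold>- b')"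
    by (intro syz_induced_plus[OF A Y] syz_induced_neg[OF A Y] ab a)
  then have "b \<^bold>+ \<^bold>- b' \<in> proj_maps \<C> (Syz RA (Suc m)) (Syz RY (Suc k))"
    by (rule syz_induced_proj[OF A Y, rotated]) (use diff a in \<open>simp add: inv_hom_grp\<close>)
  then show "b \<otimes>\<^bsub>hom_grp \<C> (Syz RA (Suc m)) (Syz RY (Suc k))\<^esub>
      inv\<^bsub>hom_grp \<C> (Syz RA (Suc m)) (Syz RY (Suc k))\<^esub> b' \<in> proj_maps \<C> (Syz RA (Suc m)) (Syz RY (Suc k))"
    using b' by (simp add: inv_hom_grp)
qed (use A Y syz_induced_ex[OF A Y] in \<open>auto simp: syz_induced_def\<close>)

lemma t_map_st_class:
  assumes A: "syz_chain RA" and Y: "syz_chain RY" and f: "f \<in> Hom \<C> (Syz RA m) (Syz RY k)"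
    and f': "syz_induced \<C> RA RY m k f f'"
  shows "t_map \<C> RA RY m k (st_class \<C> (Syz RA m) (Syz RY k) f) = st_class \<C> (Syz RA (Suc m)) (Syz RY (Suc k)) f'"
  using subquotient_map.the_coset[OF subquotient_map_t[OF A Y] f' f]
  by (simp only: t_map_def st_class_def)

lemma t_map_hom:
  assumes A: "syz_chain RA" and Y: "syz_chain RY"
  shows "t_map \<C> RA RY m k \<in> hom (st_hom \<C> (Syz RA m) (Syz RY k)) (st_hom \<C> (Syz RA (Suc m)) (Syz RY (Suc k)))"
proof -
  interpret subquotient_map "hom_grp \<C> (Syz RA m) (Syz RY k)" "Hom \<C> (Syz RA m) (Syz RY k)"
    "proj_maps \<C> (Syz RA m) (Syz RY k)" "hom_grp \<C> (Syz RA (Suc m)) (Syz RY (Suc k))"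
    "Hom \<C> (Syz RA (Suc m)) (Syz RY (Suc k))" "proj_maps \<C> (Syz RA (Suc m)) (Syz RY (Suc k))"
    "syz_induced \<C> RA RY m k"
    by (rule subquotient_map_t[OF assms])
  show ?thesis
    unfolding st_hom_eq
  proof (rule hom_of_rel)
    fix a b assume "syz_induced \<C> RA RY m k a b" "a \<in> Hom \<C> (Syz RA m) (Syz RY k)"
    then show "t_map \<C> RA RY m k (proj_maps \<C> (Syz RA m) (Syz RY k) #>\<^bsub>hom_grp \<C> (Syz RA m) (Syz RY k)\<^esub> a) =
       proj_maps \<C> (Syz RA (Suc m)) (Syz RY (Suc k)) #>\<^bsub>hom_grp \<C> (Syz RA (Suc m)) (Syz RY (Suc k))\<^esub> b"
      using t_map_st_class[OF A Y] by (simp add: st_class_def)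
  next
    fix a a' assume a: "a \<in> Hom \<C> (Syz RA m) (Syz RY k)" "a' \<in> Hom \<C> (Syz RA m) (Syz RY k)"
    then obtain b b' where "syz_induced \<C> RA RY m k a b" "syz_induced \<C> RA RY m k a' b'"
      using tot by blast
    then show "\<exists>b b'. syz_induced \<C> RA RY m k a b \<and> syz_induced \<C> RA RY m k a' b' \<and>
        syz_induced \<C> RA RY m k (a \<otimes>\<^bsub>hom_grp \<C> (Syz RA m) (Syz RY k)\<^esub> a')
          (b \<otimes>\<^bsub>hom_grp \<C> (Syz RA (Suc m)) (Syz RY (Suc k))\<^esub> b')"
      unfolding hom_grp_simps using syz_induced_plus[OF A Y a] by blast
  qed
qed

lemma subquotient_map_beta:
  assumes A: "syz_chain RA" and Y: "Y \<in> Obj \<C>"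
  shows "subquotient_map (hom_grp \<C> (Pr RA (Suc l)) Y) (cocycles \<C> RA Y (Suc l)) (coboundaries \<C> RA Y (Suc l))
    (hom_grp \<C> (Syz RA (Suc l)) Y) (Hom \<C> (Syz RA (Suc l)) Y) (proj_maps \<C> (Syz RA (Suc l)) Y)
    (beta_rel RA Y (Suc l))"
proof (intro subquotient_map.intro subquotient_map_axioms.intro subquotient_st_hom subquotient_Ext)
  fix a b a' b'
  assume ab: "beta_rel RA Y (Suc l) a b" "beta_rel RA Y (Suc l) a' b'"
    and diff: "a \<otimes>\<^bsub>hom_grp \<C> (Pr RA (Suc l)) Y\<^esub> inv\<^bsub>hom_grp \<C> (Pr RA (Suc l)) Y\<^esub> a' \<in> coboundaries \<C> RA Y (Suc l)"
  then have b': "b' \<in> Hom \<C> (Syz RA (Suc l)) Y" "a' \<in> Hom \<C> (Pr RA (Suc l)) Y"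
    using A by (auto simp: beta_rel_def Hom_iff)
  have "beta_rel RA Y (Suc l) (a \<^bold>+ \<^bold>- a') (b \<^bold>+ \<^bold>- b')"
    using ab A by (auto simp: beta_rel_def Hom_iff)
  then have "b \<^bold>+ \<^bold>- b' \<in> proj_maps \<C> (Syz RA (Suc l)) Y"
    by (rule beta_rel_proj[OF A, rotated]) (use diff b' in \<open>simp add: inv_hom_grp\<close>)
  then show "b \<otimes>\<^bsub>hom_grp \<C> (Syz RA (Suc l)) Y\<^esub> inv\<^bsub>hom_grp \<C> (Syz RA (Suc l)) Y\<^esub> b' \<in> proj_maps \<C> (Syz RA (Suc l)) Y"
    using b' by (simp add: inv_hom_grp)
qed (use A Y beta_rel_ex[OF A Y] in \<open>auto simp: beta_rel_def\<close>)

lemma beta_ext_class: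
  assumes A: "syz_chain RA" and f: "f \<in> Hom \<C> (Syz RA (Suc l)) Y"
  shows "beta \<C> RA Y (Suc l) (ext_class \<C> RA Y (Suc l) (f \<cdot> Epi RA (Suc l))) = st_class \<C> (Syz RA (Suc l)) Y f"
proof -
  have Y: "Y \<in> Obj \<C>" using f Cod_Obj by (auto simp: Hom_iff)
  have rel: "beta_rel RA Y (Suc l) (f \<cdot> Epi RA (Suc l)) f" using f by (simp add: beta_rel_def)
  have "beta \<C> RA Y (Suc l) x =
      (THE y. \<exists>f f'. f \<in> x \<and> beta_rel RA Y (Suc l) f f' \<and> y = st_class \<C> (Syz RA (Suc l)) Y f')" for x
    unfolding beta_def beta_rel_def conj_assoc ..
  then show ?thesis
    using subquotient_map.the_coset[OF subquotient_map_beta[OF A Y] rel beta_rel_cocycle[OF A Y f]]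
    by (simp only: ext_class_def st_class_def)
qed

lemma beta_hom:
  assumes A: "syz_chain RA" and Y: "Y \<in> Obj \<C>"
  shows "beta \<C> RA Y (Suc l) \<in> hom (Ext \<C> RA Y (int (Suc l))) (st_hom \<C> (Syz RA (Suc l)) Y)"
proof -
  interpret subquotient_map "hom_grp \<C> (Pr RA (Suc l)) Y" "cocycles \<C> RA Y (Suc l)" "coboundaries \<C> RA Y (Suc l)"
    "hom_grp \<C> (Syz RA (Suc l)) Y" "Hom \<C> (Syz RA (Suc l)) Y" "proj_maps \<C> (Syz RA (Suc l)) Y"
    "beta_rel RA Y (Suc l)"
    by (rule subquotient_map_beta[OF assms])
  show ?thesis
    unfolding Ext_nonneg st_hom_eq
  proof (rule hom_of_rel)
    fix a b assume "beta_rel RA Y (Suc l) a b"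
    then show "beta \<C> RA Y (Suc l) (coboundaries \<C> RA Y (Suc l) #>\<^bsub>hom_grp \<C> (Pr RA (Suc l)) Y\<^esub> a) =
       proj_maps \<C> (Syz RA (Suc l)) Y #>\<^bsub>hom_grp \<C> (Syz RA (Suc l)) Y\<^esub> b"
      using beta_ext_class[OF A] by (auto simp: st_class_def ext_class_def beta_rel_def)
  next
    fix a a' assume "a \<in> cocycles \<C> RA Y (Suc l)" "a' \<in> cocycles \<C> RA Y (Suc l)"
    then obtain b b' where b: "beta_rel RA Y (Suc l) a b" "beta_rel RA Y (Suc l) a' b'"
      using tot by blast
    then have "beta_rel RA Y (Suc l) (a \<^bold>+ a') (b \<^bold>+ b')"
      using A by (auto simp: beta_rel_def Hom_iff)
    with b show "\<exists>b b'. beta_rel RA Y (Suc l) a b \<and> beta_rel RA Y (Suc l) a' b' \<and>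
        beta_rel RA Y (Suc l) (a \<otimes>\<^bsub>hom_grp \<C> (Pr RA (Suc l)) Y\<^esub> a') (b \<otimes>\<^bsub>hom_grp \<C> (Syz RA (Suc l)) Y\<^esub> b')"
      unfolding hom_grp_simps by blast
  qed
qed

text \<open>A normal form from which, in positive degree, \<open>beta\<close> merely strips
  \<open>Epi RA m\<close>.\<close>

lemma Ext_rep:
  assumes A: "syz_chain RA" and Y: "Y \<in> Obj \<C>" and x: "x \<in> carrier (Ext \<C> RA Y (int m))"
  obtains f where "f \<in> Hom \<C> (Syz RA m) Y" "x = ext_class \<C> RA Y m (f \<cdot> Epi RA m)"
proof -
  obtain g where "g \<in> cocycles \<C> RA Y m" "x = ext_class \<C> RA Y m g"
    using x A Y by (auto simp: carrier_Ext)
  with that show thesis using beta_rel_ex[OF A Y] unfolding beta_rel_def by blast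
qed

lemma st_hom_rep:
  assumes "X \<in> Obj \<C>" "Y \<in> Obj \<C>" "x \<in> carrier (st_hom \<C> X Y)"
  obtains f where "f \<in> Hom \<C> X Y" "x = st_class \<C> X Y f"
  using assms by (auto simp: carrier_st_hom)

text \<open>A lift \<open>F\<close> of \<open>f\<close> to the resolutions is also a lift in the
  sense of the snake lemma for the sequence linking consecutive syzygies of \<open>RY\<close>. The
  resulting cocycle is \<open>f' \<cdot> Epi\<close>, so both sides are the class of
  \<open>f'\<close>. This makes \<open>beta\<close> a map of direct systems.\<close>

lemma t_map_beta:
  assumes A: "syz_chain RA" and Y: "syz_chain RY" and x: "x \<in> carrier (Ext \<C> RA (Syz RY k) (int (Suc l)))"
  shows "t_map \<C> RA RY (Suc l) k (beta \<C> RA (Syz RY k) (Suc l) x) =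
    beta \<C> RA (Syz RY (Suc k)) (Suc (Suc l))
      (delta \<C> RA (Syz RY (Suc k)) (Pr RY k) (Inc RY (Suc k)) (Epi RY k) (int (Suc l)) x)"
proof -
  let ?m = "Suc l"
  obtain f where f: "f \<in> Hom \<C> (Syz RA ?m) (Syz RY k)" and x_eq: "x = ext_class \<C> RA (Syz RY k) ?m (f \<cdot> Epi RA ?m)"
    using Ext_rep[OF A _ x] Y by auto
  obtain f' where f': "syz_induced \<C> RA RY ?m k f f'"
    using syz_induced_ex[OF A Y f] by blast
  obtain F where F: "F \<in> Hom \<C> (Pr RA ?m) (Pr RY k)" and EF: "Epi RY k \<cdot> F = f \<cdot> Epi RA ?m"
    and IF: "Inc RY (Suc k) \<cdot> f' = F \<cdot> Inc RA (Suc ?m)"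
    and f'_Hom: "f' \<in> Hom \<C> (Syz RA (Suc ?m)) (Syz RY (Suc k))"
    using f' unfolding syz_induced_def by blast
  have "Inc RY (Suc k) \<cdot> (f' \<cdot> Epi RA (Suc ?m)) = (Inc RY (Suc k) \<cdot> f') \<cdot> Epi RA (Suc ?m)"
    using A Y f'_Hom by (simp add: Hom_iff Cmp_assoc_Arr)
  also have "\<dots> = F \<cdot> Df RA (Suc ?m)"
    unfolding IF Df_eq[OF A] using A F by (simp add: Hom_iff Cmp_assoc_Arr)
  finally have "delta_rel RA (Syz RY (Suc k)) (Pr RY k) (Inc RY (Suc k)) (Epi RY k) ?m
      (f \<cdot> Epi RA ?m) (f' \<cdot> Epi RA (Suc ?m))"
    unfolding delta_rel_def using A F EF f'_Hom by (intro exI[of _ F]) (simp add: Hom_iff)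
  then have "delta \<C> RA (Syz RY (Suc k)) (Pr RY k) (Inc RY (Suc k)) (Epi RY k) (int ?m) x =
      ext_class \<C> RA (Syz RY (Suc k)) (Suc ?m) (f' \<cdot> Epi RA (Suc ?m))"
    unfolding x_eq using A Y f
    by (intro delta_ext_class kernel_Inc epi_Epi beta_rel_cocycle) (simp_all add: Hom_iff)
  then show ?thesis
    by (simp add: x_eq beta_ext_class[OF A] f f'_Hom t_map_st_class[OF A Y f f'])
qed

end

section \<open>The connecting homomorphism\<close>

context cat
begin

text \<open>In right-nested normal form a square is hidden when a further factor \<open>x\<close>
  follows on the right. This variant and the next make the squares of the horseshoe usable as
  rewrite rules there.\<close>

lemma Cmp_eq_assoc:
  assumes "a \<cdot> b = c \<cdot> d" "a \<in> Arr \<C>" "b \<in> Arr \<C>" "c \<in> Arr \<C>" "d \<in> Arr \<C>" "x \<in> Arr \<C>"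
    "Cod \<C> b = Dom \<C> a" "Cod \<C> d = Dom \<C> c" "Cod \<C> x = Dom \<C> b" "Dom \<C> d = Dom \<C> b"
  shows "a \<cdot> (b \<cdot> x) = c \<cdot> (d \<cdot> x)"
proof -
  have "a \<cdot> (b \<cdot> x) = (a \<cdot> b) \<cdot> x" using assms(2-) by (simp add: Cmp_assoc_Arr)
  also have "\<dots> = c \<cdot> (d \<cdot> x)" unfolding assms(1) using assms(2-) by (simp add: Cmp_assoc_Arr)
  finally show ?thesis .
qed

lemma Cmp_eq_assoc1:
  assumes "a \<cdot> b = c" "a \<in> Arr \<C>" "b \<in> Arr \<C>" "x \<in> Arr \<C>" "Cod \<C> b = Dom \<C> a" "Cod \<C> x = Dom \<C> b"
  shows "a \<cdot> (b \<cdot> x) = c \<cdot> x"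
  using assms(2-) by (simp add: Cmp_assoc_Arr flip: assms(1))

end

text \<open>The horseshoe in working form: each short exact row enters through a kernel and an
  epimorphism, and the objects of the given sequence survive as the syzygies of index 0.\<close>

locale syz_horseshoe = projective_cat \<C> for \<C> :: "('o, 'm) cat" (structure) +
  fixes RA RB RC RD :: "('o, 'm) resolution" and U V SU SV :: "nat \<Rightarrow> 'm"
  assumes A: "syz_chain RA" and B: "syz_chain RB" and C: "syz_chain RC" and D: "syz_chain RD"
    and U_Hom: "U k \<in> Hom \<C> (Pr RB k) (Pr RC k)" and V_Hom: "V k \<in> Hom \<C> (Pr RC k) (Pr RD k)"
    and kernel_U: "is_kernel \<C> (V k) (U k)" and epi_V: "is_epi \<C> (V k)"
    and SU_Hom: "SU k \<in> Hom \<C> (Syz RB k) (Syz RC k)" and SV_Hom: "SV k \<in> Hom \<C> (Syz RC k) (Syz RD k)"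
    and kernel_SU: "is_kernel \<C> (SV k) (SU k)" and epi_SV: "is_epi \<C> (SV k)"
    and Epi_U: "Epi RC k \<cdot> U k = SU k \<cdot> Epi RB k"
    and Epi_V: "Epi RD k \<cdot> V k = SV k \<cdot> Epi RC k"
    and Inc_SU: "Inc RC (Suc k) \<cdot> SU (Suc k) = U k \<cdot> Inc RB (Suc k)"
    and Inc_SV: "Inc RD (Suc k) \<cdot> SV (Suc k) = V k \<cdot> Inc RC (Suc k)"
begin

lemmas chains [simp] = A B C D

lemma Arr_UV [simp]:
  "U k \<in> Arr \<C>" "Dom \<C> (U k) = Pr RB k" "Cod \<C> (U k) = Pr RC k"
  "V k \<in> Arr \<C>" "Dom \<C> (V k) = Pr RC k" "Cod \<C> (V k) = Pr RD k"
  "SU k \<in> Arr \<C>" "Dom \<C> (SU k) = Syz RB k" "Cod \<C> (SU k) = Syz RC k"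
  "SV k \<in> Arr \<C>" "Dom \<C> (SV k) = Syz RC k" "Cod \<C> (SV k) = Syz RD k"
  using U_Hom V_Hom SU_Hom SV_Hom by (simp_all add: Hom_iff)

lemma V_U: "V k \<cdot> U k = Nul \<C> (Pr RB k) (Pr RD k)"
  using kernelD(4)[OF kernel_U] by simp

lemma SV_SU: "SV k \<cdot> SU k = Nul \<C> (Syz RB k) (Syz RD k)"
  using kernelD(4)[OF kernel_SU] by simp

lemmas squares = Epi_U Epi_V Inc_SU Inc_SV V_U SV_SU
  Cmp_eq_assoc[OF Epi_U] Cmp_eq_assoc[OF Epi_V] Cmp_eq_assoc[OF Inc_SU] Cmp_eq_assoc[OF Inc_SV]
  Cmp_eq_assoc1[OF V_U] Cmp_eq_assoc1[OF SV_SU] Cmp_eq_assoc1[OF Epi_Inc]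

section \<open>Lifts of the identity of a syzygy of \<open>D\<close>\<close>

definition conn_lift :: "nat \<Rightarrow> 'm \<Rightarrow> 'm \<Rightarrow> bool" where
  "conn_lift k h h' \<longleftrightarrow> h \<in> Hom \<C> (Pr RD k) (Syz RC k) \<and> SV k \<cdot> h = Epi RD k \<and>
     h' \<in> Hom \<C> (Syz RD (Suc k)) (Syz RB k) \<and> SU k \<cdot> h' = h \<cdot> Inc RD (Suc k)"

lemma conn_lift_extend:
  assumes "h \<in> Arr \<C>" "Dom \<C> h = Pr RD k" "Cod \<C> h = Syz RC k" "SV k \<cdot> h = Epi RD k"
  shows "\<exists>h'. conn_lift k h h'"
proof -
  have "SV k \<cdot> (h \<cdot> Inc RD (Suc k)) = Nul \<C> (Syz RD (Suc k)) (Syz RD k)"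
    using assms(1-3) by (simp add: Cmp_eq_assoc1[OF assms(4)])
  then have "\<exists>u. u \<in> Arr \<C> \<and> Dom \<C> u = Syz RD (Suc k) \<and> Cod \<C> u = Syz RB k \<and> SU k \<cdot> u = h \<cdot> Inc RD (Suc k)"
    using kernel_factor[OF kernel_SU, of "h \<cdot> Inc RD (Suc k)" k] assms(1-3) by simp
  then show ?thesis using assms by (auto simp: conn_lift_def Hom_iff)
qed

text \<open>Two lifts of the same identity differ by \<open>SU k \<cdot> r\<close>; restricted to
  the next syzygy this gives \<open>h1' - h2' = r \<cdot> Inc\<close>, an arrow through the
  projective \<open>Pr RD k\<close>. Hence the class given by \<open>tau\<close> does not depend on
  \<open>h\<close>.\<close>

lemma conn_lift_diff:
  assumes "conn_lift k h1 h1'" "conn_lift k h2 h2'"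
  shows "h1' \<^bold>+ \<^bold>- h2' \<in> proj_maps \<C> (Syz RD (Suc k)) (Syz RB k)"
proof -
  have h: "h1 \<in> Arr \<C>" "Dom \<C> h1 = Pr RD k" "Cod \<C> h1 = Syz RC k"
      "h2 \<in> Arr \<C>" "Dom \<C> h2 = Pr RD k" "Cod \<C> h2 = Syz RC k"
    and SV: "SV k \<cdot> h1 = Epi RD k" "SV k \<cdot> h2 = Epi RD k"
    and h': "h1' \<in> Arr \<C>" "Dom \<C> h1' = Syz RD (Suc k)" "Cod \<C> h1' = Syz RB k"
      "h2' \<in> Arr \<C>" "Dom \<C> h2' = Syz RD (Suc k)" "Cod \<C> h2' = Syz RB k"
    and SU: "SU k \<cdot> h1' = h1 \<cdot> Inc RD (Suc k)" "SU k \<cdot> h2' = h2 \<cdot> Inc RD (Suc k)"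
    using assms by (auto simp: conn_lift_def Hom_iff)
  have "SV k \<cdot> (h1 \<^bold>+ \<^bold>- h2) = Nul \<C> (Pr RD k) (Syz RD k)"
    using h SV by simp
  then have "\<exists>r. r \<in> Arr \<C> \<and> Dom \<C> r = Pr RD k \<and> Cod \<C> r = Syz RB k \<and> SU k \<cdot> r = h1 \<^bold>+ \<^bold>- h2"
    using kernel_factor[OF kernel_SU, of "h1 \<^bold>+ \<^bold>- h2" k] h by simp
  then obtain r where r: "r \<in> Arr \<C>" "Dom \<C> r = Pr RD k" "Cod \<C> r = Syz RB k" "SU k \<cdot> r = h1 \<^bold>+ \<^bold>- h2"
    by blast
  have "SU k \<cdot> (r \<cdot> Inc RD (Suc k)) = SU k \<cdot> (h1' \<^bold>+ \<^bold>- h2')"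
    using r(1-3) h h' by (simp add: Cmp_eq_assoc1[OF r(4)] SU)
  then have "r \<cdot> Inc RD (Suc k) = h1' \<^bold>+ \<^bold>- h2'"
    by (rule kernel_cancel[OF kernel_SU]) (use r(1-3) h' in simp_all)
  then show ?thesis
    using r(1-3) projective_Pr[OF D] proj_mapsI[of "Inc RD (Suc k)" r] by simp
qed

text \<open>
  The source of the sign: with \<open>h = Epi \<cdot> s\<close> for a section \<open>s\<close> of \<open>V k\<close>, and \<open>H\<close> a lift of
  \<open>h' \<cdot> Epi\<close> along the resolution of \<open>B\<close>, the difference \<open>s \<cdot> \<partial> - U k \<cdot> H\<close> is an admissible
  choice of \<open>h\<close> in degree \<open>k + 1\<close>; restricted to the next syzygy only the second term survives.
\<close>

lemma conn_lift_step:
  obtains h h' h2 h2' where "conn_lift k h h'" "conn_lift (Suc k) h2 h2'"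
    "syz_induced \<C> RD RB (Suc k) k h' (\<^bold>- h2')"
proof -
  have "\<exists>s. s \<in> Arr \<C> \<and> Dom \<C> s = Pr RD k \<and> Cod \<C> s = Pr RC k \<and> V k \<cdot> s = Idm \<C> (Pr RD k)"
    using projective_lift[OF projective_Pr[OF D] epi_V, of "Idm \<C> (Pr RD k)" k k] by simp
  then obtain s where s: "s \<in> Arr \<C>" "Dom \<C> s = Pr RD k" "Cod \<C> s = Pr RC k" "V k \<cdot> s = Idm \<C> (Pr RD k)"
    by blast
  note Vs = Cmp_eq_assoc1[OF s(4)]
  define h where "h = Epi RC k \<cdot> s"
  have h: "h \<in> Arr \<C>" "Dom \<C> h = Pr RD k" "Cod \<C> h = Syz RC k" using s(1-3) by (simp_all add: h_def)
  have "SV k \<cdot> h = (Epi RD k \<cdot> V k) \<cdot> s"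
    unfolding h_def Epi_V using s(1-3) by (simp add: Cmp_assoc_Arr)
  also have "\<dots> = Epi RD k" using s by (simp add: Cmp_assoc_Arr)
  finally obtain h' where hh': "conn_lift k h h'" using conn_lift_extend h by blast
  then have h': "h' \<in> Arr \<C>" "Dom \<C> h' = Syz RD (Suc k)" "Cod \<C> h' = Syz RB k"
    and SUh': "SU k \<cdot> h' = h \<cdot> Inc RD (Suc k)"
    by (auto simp: conn_lift_def Hom_iff)
  have "\<exists>H. H \<in> Arr \<C> \<and> Dom \<C> H = Pr RD (Suc k) \<and> Cod \<C> H = Pr RB k \<and> Epi RB k \<cdot> H = h' \<cdot> Epi RD (Suc k)"
    using projective_lift[OF projective_Pr[OF D] epi_Epi[OF B], of "h' \<cdot> Epi RD (Suc k)" "Suc k" k] h' by simp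
  then obtain H where H: "H \<in> Arr \<C>" "Dom \<C> H = Pr RD (Suc k)" "Cod \<C> H = Pr RB k"
    and EH: "Epi RB k \<cdot> H = h' \<cdot> Epi RD (Suc k)" by blast
  define E where "E = s \<cdot> (Inc RD (Suc k) \<cdot> Epi RD (Suc k)) \<^bold>+ \<^bold>- (U k \<cdot> H)"
  have E: "E \<in> Arr \<C>" "Dom \<C> E = Pr RD (Suc k)" "Cod \<C> E = Pr RC k"
    using s(1-3) H by (simp_all add: E_def)
  \<comment> \<open>Both terms of \<open>E\<close> have the same image in the syzygy of
    \<open>C\<close>: by \<open>SUh'\<close> the first becomes
    \<open>SU k \<cdot> (h' \<cdot> Epi RD (Suc k))\<close>, and by the choice of \<open>H\<close>
    so does the second.\<close>
  have "Epi RC k \<cdot> (s \<cdot> (Inc RD (Suc k) \<cdot> Epi RD (Suc k))) = SU k \<cdot> (h' \<cdot> Epi RD (Suc k))"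
    using s(1-3) h h' by (simp add: Cmp_eq_assoc[OF SUh'] Cmp_eq_assoc1[OF h_def[symmetric]])
  then have "Epi RC k \<cdot> E = Nul \<C> (Pr RD (Suc k)) (Syz RC k)"
    using s(1-3) H h' by (simp add: E_def squares EH)
  then have "\<exists>h2. h2 \<in> Arr \<C> \<and> Dom \<C> h2 = Pr RD (Suc k) \<and> Cod \<C> h2 = Syz RC (Suc k) \<and> Inc RC (Suc k) \<cdot> h2 = E"
    using kernel_factor[OF kernel_Inc[OF C], of E k] E by simp
  then obtain h2 where h2: "h2 \<in> Arr \<C>" "Dom \<C> h2 = Pr RD (Suc k)" "Cod \<C> h2 = Syz RC (Suc k)"
    and Ih2: "Inc RC (Suc k) \<cdot> h2 = E" by blast
  \<comment> \<open>\<open>h2\<close> lifts the required identity: \<open>V k\<close> kills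
    \<open>U k \<cdot> H\<close>, while \<open>V k \<cdot> s\<close> is the identity, so what
    remains is the differential of \<open>RD\<close>.\<close>
  have "Inc RD (Suc k) \<cdot> (SV (Suc k) \<cdot> h2) = V k \<cdot> E"
    using h2 by (simp add: squares Ih2)
  also have "\<dots> = Inc RD (Suc k) \<cdot> Epi RD (Suc k)"
    using s(1-3) H by (simp add: E_def squares Vs)
  finally have "SV (Suc k) \<cdot> h2 = Epi RD (Suc k)"
    by (rule kernel_cancel[OF kernel_Inc[OF D]]) (use h2 in simp_all)
  then obtain h2' where hh2': "conn_lift (Suc k) h2 h2'" using conn_lift_extend h2 by blast
  then have h2': "h2' \<in> Arr \<C>" "Dom \<C> h2' = Syz RD (Suc (Suc k))" "Cod \<C> h2' = Syz RB (Suc k)"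
    and SUh2': "SU (Suc k) \<cdot> h2' = h2 \<cdot> Inc RD (Suc (Suc k))"
    by (auto simp: conn_lift_def Hom_iff)
  \<comment> \<open>The comparison takes place in \<open>Pr RC k\<close>, where the monomorphism
    \<open>U k\<close> can be cancelled; the term with \<open>s\<close> vanishes because it contains
    \<open>Epi \<cdot> Inc\<close>.\<close>
  have "U k \<cdot> (Inc RB (Suc k) \<cdot> h2') = Inc RC (Suc k) \<cdot> (SU (Suc k) \<cdot> h2')"
    using h2' by (simp add: squares)
  also have "\<dots> = E \<cdot> Inc RD (Suc (Suc k))"
    using h2 by (simp add: SUh2' Cmp_eq_assoc1[OF Ih2])
  also have "\<dots> = U k \<cdot> \<^bold>- (H \<cdot> Inc RD (Suc (Suc k)))"
    using s(1-3) H by (simp add: E_def Cmp_assoc_Arr Dom_Obj)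
  finally have "Inc RB (Suc k) \<cdot> h2' = \<^bold>- (H \<cdot> Inc RD (Suc (Suc k)))"
    by (rule kernel_cancel[OF kernel_U]) (use h2' H in simp_all)
  then have "syz_induced \<C> RD RB (Suc k) k h' (\<^bold>- h2')"
    unfolding syz_induced_def using h2' H EH by (intro conjI bexI[of _ H]) (simp_all add: Hom_iff)
  with hh' hh2' show thesis by (rule that)
qed

lemma conn_lift_ex: "\<exists>h h'. conn_lift k h h'"
  using conn_lift_step by blast

text \<open>Split \<open>h1' \<cdot> f1 - h2' \<cdot> f2\<close> as
  \<open>h1' \<cdot> (f1 - f2) + (h1' - h2') \<cdot> f2\<close>. The first difference factors
  through a projective because \<open>t_map\<close> is well defined, the second by
  \<open>conn_lift_diff\<close>, and such arrows form an ideal.\<close>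

lemma subquotient_map_tau:
  "subquotient_map (hom_grp \<C> (Syz RA m) (Syz RD k)) (Hom \<C> (Syz RA m) (Syz RD k))
    (proj_maps \<C> (Syz RA m) (Syz RD k)) (hom_grp \<C> (Syz RA (Suc m)) (Syz RB k))
    (Hom \<C> (Syz RA (Suc m)) (Syz RB k)) (proj_maps \<C> (Syz RA (Suc m)) (Syz RB k))
    (\<lambda>f y. \<exists>f' h h'. syz_induced \<C> RA RD m k f f' \<and> conn_lift k h h' \<and> y = h' \<cdot> f')"
proof (intro subquotient_map.intro subquotient_map_axioms.intro subquotient_st_hom)
  fix a assume "a \<in> Hom \<C> (Syz RA m) (Syz RD k)"
  then show "\<exists>b f' h h'. syz_induced \<C> RA RD m k a f' \<and> conn_lift k h h' \<and> b = h' \<cdot> f'"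
    using syz_induced_ex[OF A D] conn_lift_ex by blast
next
  fix a b a' b'
  assume "\<exists>f' h h'. syz_induced \<C> RA RD m k a f' \<and> conn_lift k h h' \<and> b = h' \<cdot> f'"
    and "\<exists>f' h h'. syz_induced \<C> RA RD m k a' f' \<and> conn_lift k h h' \<and> b' = h' \<cdot> f'"
    and a: "a \<in> Hom \<C> (Syz RA m) (Syz RD k)" "a' \<in> Hom \<C> (Syz RA m) (Syz RD k)"
    and diff: "a \<otimes>\<^bsub>hom_grp \<C> (Syz RA m) (Syz RD k)\<^esub> inv\<^bsub>hom_grp \<C> (Syz RA m) (Syz RD k)\<^esub> a'
      \<in> proj_maps \<C> (Syz RA m) (Syz RD k)"
  then obtain f1 f2 h1 h1' h2 h2' where f: "syz_induced \<C> RA RD m k a f1" "syz_induced \<C> RA RD m k a' f2"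
    and h: "conn_lift k h1 h1'" "conn_lift k h2 h2'" and b: "b = h1' \<cdot> f1" "b' = h2' \<cdot> f2"
    by blast
  have f_Arr: "f1 \<in> Arr \<C>" "Dom \<C> f1 = Syz RA (Suc m)" "Cod \<C> f1 = Syz RD (Suc k)"
    "f2 \<in> Arr \<C>" "Dom \<C> f2 = Syz RA (Suc m)" "Cod \<C> f2 = Syz RD (Suc k)"
    using f by (simp_all add: syz_induced_def Hom_iff)
  have h_Arr: "h1' \<in> Arr \<C>" "Dom \<C> h1' = Syz RD (Suc k)" "Cod \<C> h1' = Syz RB k"
    "h2' \<in> Arr \<C>" "Dom \<C> h2' = Syz RD (Suc k)" "Cod \<C> h2' = Syz RB k"
    using h by (simp_all add: conn_lift_def Hom_iff)
  have "f1 \<^bold>+ \<^bold>- f2 \<in> proj_maps \<C> (Syz RA (Suc m)) (Syz RD (Suc k))"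
    using subquotient_map.rel_wd[OF subquotient_map_t[OF A D] f a diff] f_Arr
    by (simp add: inv_hom_grp Hom_iff)
  then have "h1' \<cdot> (f1 \<^bold>+ \<^bold>- f2) \<in> proj_maps \<C> (Syz RA (Suc m)) (Syz RB k)"
    using h_Arr by (intro proj_maps_Cmp_left) simp_all
  moreover have "(h1' \<^bold>+ \<^bold>- h2') \<cdot> f2 \<in> proj_maps \<C> (Syz RA (Suc m)) (Syz RB k)"
    using f_Arr by (intro proj_maps_Cmp_right[OF conn_lift_diff[OF h]]) simp_all
  ultimately have "h1' \<cdot> (f1 \<^bold>+ \<^bold>- f2) \<^bold>+ (h1' \<^bold>+ \<^bold>- h2') \<cdot> f2 \<in> proj_maps \<C> (Syz RA (Suc m)) (Syz RB k)"
    by (rule proj_maps_plus)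
  then show "b \<otimes>\<^bsub>hom_grp \<C> (Syz RA (Suc m)) (Syz RB k)\<^esub>
      inv\<^bsub>hom_grp \<C> (Syz RA (Suc m)) (Syz RB k)\<^esub> b' \<in> proj_maps \<C> (Syz RA (Suc m)) (Syz RB k)"
    using f_Arr h_Arr by (simp add: b inv_hom_grp Hom_iff)
qed (auto simp: syz_induced_def conn_lift_def Hom_iff)

lemma tau_st_class:
  assumes f: "f \<in> Hom \<C> (Syz RA m) (Syz RD k)" and f': "syz_induced \<C> RA RD m k f f'"
    and h: "conn_lift k h h'"
  shows "tau \<C> RA RB RC RD SU SV m k (st_class \<C> (Syz RA m) (Syz RD k) f) =
    st_class \<C> (Syz RA (Suc m)) (Syz RB k) (h' \<cdot> f')"
proof -
  let ?R = "\<lambda>f y. \<exists>f' h h'. syz_induced \<C> RA RD m k f f' \<and> conn_lift k h h' \<and> y = h' \<cdot> f'"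
  have tau: "tau \<C> RA RB RC RD SU SV m k x =
      (THE y. \<exists>f b. f \<in> x \<and> ?R f b \<and> y = st_class \<C> (Syz RA (Suc m)) (Syz RB k) b)" for x
    unfolding tau_def conn_lift_def by (intro arg_cong[where f = The] ext) blast
  have "?R f (h' \<cdot> f')" using f' h by blast
  from subquotient_map.the_coset[OF subquotient_map_tau this f]
  show ?thesis unfolding tau st_class_def .
qed

lemma tau_hom:
  "tau \<C> RA RB RC RD SU SV m k \<in> hom (st_hom \<C> (Syz RA m) (Syz RD k)) (st_hom \<C> (Syz RA (Suc m)) (Syz RB k))"
proof -
  interpret subquotient_map "hom_grp \<C> (Syz RA m) (Syz RD k)" "Hom \<C> (Syz RA m) (Syz RD k)"
    "proj_maps \<C> (Syz RA m) (Syz RD k)" "hom_grp \<C> (Syz RA (Suc m)) (Syz RB k)"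
    "Hom \<C> (Syz RA (Suc m)) (Syz RB k)" "proj_maps \<C> (Syz RA (Suc m)) (Syz RB k)"
    "\<lambda>f y. \<exists>f' h h'. syz_induced \<C> RA RD m k f f' \<and> conn_lift k h h' \<and> y = h' \<cdot> f'"
    by (rule subquotient_map_tau)
  show ?thesis
    unfolding st_hom_eq
  proof (rule hom_of_rel)
    fix a b assume "\<exists>f' h h'. syz_induced \<C> RA RD m k a f' \<and> conn_lift k h h' \<and> b = h' \<cdot> f'"
      "a \<in> Hom \<C> (Syz RA m) (Syz RD k)"
    then show "tau \<C> RA RB RC RD SU SV m k (proj_maps \<C> (Syz RA m) (Syz RD k) #>\<^bsub>hom_grp \<C> (Syz RA m) (Syz RD k)\<^esub> a) =
       proj_maps \<C> (Syz RA (Suc m)) (Syz RB k) #>\<^bsub>hom_grp \<C> (Syz RA (Suc m)) (Syz RB k)\<^esub> b"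
      using tau_st_class unfolding st_class_def by blast
  next
    fix a a' assume a: "a \<in> Hom \<C> (Syz RA m) (Syz RD k)" "a' \<in> Hom \<C> (Syz RA m) (Syz RD k)"
    then obtain f f' where f: "syz_induced \<C> RA RD m k a f" "syz_induced \<C> RA RD m k a' f'"
      using syz_induced_ex[OF A D] by blast
    \<comment> \<open>One fixed \<open>h'\<close> serves both arguments and their sum, which reduces
      additivity to that of the induced arrows.\<close>
    obtain h h' where h: "conn_lift k h h'" using conn_lift_ex by blast
    have "h' \<cdot> f \<^bold>+ h' \<cdot> f' = h' \<cdot> (f \<^bold>+ f')"
      using f h by (simp add: syz_induced_def conn_lift_def Hom_iff)
    moreover have "syz_induced \<C> RA RD m k (a \<^bold>+ a') (f \<^bold>+ f')"
      using f a by (intro syz_induced_plus A D)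
    ultimately show "\<exists>b b'. (\<exists>f' h h'. syz_induced \<C> RA RD m k a f' \<and> conn_lift k h h' \<and> b = h' \<cdot> f') \<and>
        (\<exists>f' h h'. syz_induced \<C> RA RD m k a' f' \<and> conn_lift k h h' \<and> b' = h' \<cdot> f') \<and>
        (\<exists>f' h h'. syz_induced \<C> RA RD m k (a \<otimes>\<^bsub>hom_grp \<C> (Syz RA m) (Syz RD k)\<^esub> a') f' \<and> conn_lift k h h' \<and>
           b \<otimes>\<^bsub>hom_grp \<C> (Syz RA (Suc m)) (Syz RB k)\<^esub> b' = h' \<cdot> f')"
      unfolding hom_grp_simps using f h by blast
  qed
qed

text \<open>Both routes are computed with the same \<open>f''\<close>. After \<open>tau\<close>,
  inducing from \<open>h'\<close> yields \<open>- h2'\<close> by \<open>conn_lift_step\<close>; in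
  the other order \<open>h2'\<close> itself is an admissible choice for \<open>tau\<close> at the
  next stage.\<close>

lemma t_map_tau:
  assumes x: "x \<in> carrier (st_hom \<C> (Syz RA m) (Syz RD k))"
  shows "t_map \<C> RA RB (Suc m) k (tau \<C> RA RB RC RD SU SV m k x) =
    inv\<^bsub>st_hom \<C> (Syz RA (Suc (Suc m))) (Syz RB (Suc k))\<^esub>
      (tau \<C> RA RB RC RD SU SV (Suc m) (Suc k) (t_map \<C> RA RD m k x))"
proof -
  obtain f where f: "f \<in> Hom \<C> (Syz RA m) (Syz RD k)" and x_eq: "x = st_class \<C> (Syz RA m) (Syz RD k) f"
    using st_hom_rep[OF _ _ x] by auto
  obtain f' where f': "syz_induced \<C> RA RD m k f f'" using syz_induced_ex[OF A D f] by blast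
  then have f'_Hom: "f' \<in> Hom \<C> (Syz RA (Suc m)) (Syz RD (Suc k))" by (simp add: syz_induced_def)
  obtain f'' where f'': "syz_induced \<C> RA RD (Suc m) (Suc k) f' f''" using syz_induced_ex[OF A D f'_Hom] by blast
  then have f''_Hom: "f'' \<in> Hom \<C> (Syz RA (Suc (Suc m))) (Syz RD (Suc (Suc k)))" by (simp add: syz_induced_def)
  obtain h h' h2 h2' where h: "conn_lift k h h'" "conn_lift (Suc k) h2 h2'"
    and ind: "syz_induced \<C> RD RB (Suc k) k h' (\<^bold>- h2')" by (rule conn_lift_step)
  have h'_Hom: "h' \<in> Hom \<C> (Syz RD (Suc k)) (Syz RB k)"
    and h2'_Hom: "h2' \<in> Hom \<C> (Syz RD (Suc (Suc k))) (Syz RB (Suc k))"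
    using h by (simp_all add: conn_lift_def)
  have "t_map \<C> RA RB (Suc m) k (tau \<C> RA RB RC RD SU SV m k x) =
      t_map \<C> RA RB (Suc m) k (st_class \<C> (Syz RA (Suc m)) (Syz RB k) (h' \<cdot> f'))"
    unfolding x_eq tau_st_class[OF f f' h(1)] ..
  also have "\<dots> = st_class \<C> (Syz RA (Suc (Suc m))) (Syz RB (Suc k)) (\<^bold>- h2' \<cdot> f'')"
    by (intro t_map_st_class syz_induced_Cmp[OF A D B f'_Hom h'_Hom f'' ind] A B Cmp_Hom[OF f'_Hom h'_Hom])
  also have "\<dots> = inv\<^bsub>st_hom \<C> (Syz RA (Suc (Suc m))) (Syz RB (Suc k))\<^esub>
      (st_class \<C> (Syz RA (Suc (Suc m))) (Syz RB (Suc k)) (h2' \<cdot> f''))"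
    using f''_Hom h2'_Hom by (simp add: inv_st_class Hom_iff)
  also have "st_class \<C> (Syz RA (Suc (Suc m))) (Syz RB (Suc k)) (h2' \<cdot> f'') =
      tau \<C> RA RB RC RD SU SV (Suc m) (Suc k) (t_map \<C> RA RD m k x)"
    unfolding x_eq t_map_st_class[OF A D f f'] tau_st_class[OF f'_Hom f'' h(2)] ..
  finally show ?thesis .
qed

text \<open>The snake cocycle belonging to the lift \<open>h \<cdot> F\<close> is
  \<open>(h' \<cdot> f') \<cdot> Epi\<close>; stripping \<open>Epi\<close> leaves precisely the
  representative of \<open>tau\<close>.\<close>

lemma tau_beta:
  assumes x: "x \<in> carrier (Ext \<C> RA (Syz RD k) (int (Suc l)))"
  shows "tau \<C> RA RB RC RD SU SV (Suc l) k (beta \<C> RA (Syz RD k) (Suc l) x) =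
    beta \<C> RA (Syz RB k) (Suc (Suc l)) (delta \<C> RA (Syz RB k) (Syz RC k) (SU k) (SV k) (int (Suc l)) x)"
proof -
  let ?m = "Suc l"
  obtain f where f: "f \<in> Hom \<C> (Syz RA ?m) (Syz RD k)" and x_eq: "x = ext_class \<C> RA (Syz RD k) ?m (f \<cdot> Epi RA ?m)"
    using Ext_rep[OF A _ x] by auto
  obtain f' where f': "syz_induced \<C> RA RD ?m k f f'" using syz_induced_ex[OF A D f] by blast
  obtain F where F: "F \<in> Hom \<C> (Pr RA ?m) (Pr RD k)" and EF: "Epi RD k \<cdot> F = f \<cdot> Epi RA ?m"
    and IF: "Inc RD (Suc k) \<cdot> f' = F \<cdot> Inc RA (Suc ?m)"
    and f'_Hom: "f' \<in> Hom \<C> (Syz RA (Suc ?m)) (Syz RD (Suc k))"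
    using f' unfolding syz_induced_def by blast
  obtain h h' where h: "conn_lift k h h'" using conn_lift_ex by blast
  then have h_Hom: "h \<in> Hom \<C> (Pr RD k) (Syz RC k)" "h' \<in> Hom \<C> (Syz RD (Suc k)) (Syz RB k)"
    and SVh: "SV k \<cdot> h = Epi RD k" and SUh': "SU k \<cdot> h' = h \<cdot> Inc RD (Suc k)"
    by (simp_all add: conn_lift_def)
  have "SV k \<cdot> (h \<cdot> F) = f \<cdot> Epi RA ?m"
    using F h_Hom by (simp add: Hom_iff Cmp_eq_assoc1[OF SVh] EF)
  moreover have "SU k \<cdot> ((h' \<cdot> f') \<cdot> Epi RA (Suc ?m)) = (h \<cdot> F) \<cdot> Df RA (Suc ?m)"
    using F f'_Hom h_Hom by (simp add: Hom_iff Cmp_assoc_Arr Cmp_eq_assoc[OF SUh'] Cmp_eq_assoc[OF IF] Df_eq)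
  ultimately have "delta_rel RA (Syz RB k) (Syz RC k) (SU k) (SV k) ?m
      (f \<cdot> Epi RA ?m) ((h' \<cdot> f') \<cdot> Epi RA (Suc ?m))"
    unfolding delta_rel_def using F f'_Hom h_Hom by (intro exI[of _ "h \<cdot> F"]) (simp add: Hom_iff)
  then have "delta \<C> RA (Syz RB k) (Syz RC k) (SU k) (SV k) (int ?m) x =
      ext_class \<C> RA (Syz RB k) (Suc ?m) ((h' \<cdot> f') \<cdot> Epi RA (Suc ?m))"
    unfolding x_eq using f
    by (intro delta_ext_class kernel_SU epi_SV SU_Hom SV_Hom beta_rel_cocycle A) (simp_all add: Hom_iff)
  then show ?thesis
    using f'_Hom h_Hom
    by (simp add: x_eq beta_ext_class[OF A] f tau_st_class[OF f f' h] Cmp_Hom[OF f'_Hom h_Hom(2)])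
qed

section \<open>Anticommutation of the two connecting homomorphisms of Ext\<close>

abbreviation delta_syz where
  "delta_syz R k j \<equiv> delta \<C> RA (Syz R (Suc k)) (Pr R k) (Inc R (Suc k)) (Epi R k) j"

abbreviation delta_hs where
  "delta_hs k j \<equiv> delta \<C> RA (Syz RB k) (Syz RC k) (SU k) (SV k) j"

lemma delta_hs_hom: "delta_hs k j \<in> hom (Ext \<C> RA (Syz RD k) j) (Ext \<C> RA (Syz RB k) (j + 1))"
  by (rule delta_hom[OF A SU_Hom SV_Hom kernel_SU epi_SV])

lemma delta_syz_hom:
  assumes "syz_chain R"
  shows "delta_syz R k j \<in> hom (Ext \<C> RA (Syz R k) j) (Ext \<C> RA (Syz R (Suc k)) (j + 1))"
  using assms by (intro delta_hom A kernel_Inc epi_Epi) (simp_all add: Hom_iff)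

text \<open>The classical sign for connecting maps of a 3 by 3 diagram with exact rows and columns,
  here formed by syzygies and terms of the three resolutions. One lift \<open>G\<close> of
  \<open>f\<close> to \<open>Pr RC k\<close> supplies both snake lifts:
  \<open>Epi RC k \<cdot> G\<close> for the row and \<open>V k \<cdot> G\<close> for the
  column.\<close>

lemma delta_syz_delta_hs_nat:
  assumes x: "x \<in> carrier (Ext \<C> RA (Syz RD k) (int m))"
  shows "delta_syz RB k (int (Suc m)) (delta_hs k (int m) x) =
    inv\<^bsub>Ext \<C> RA (Syz RB (Suc k)) (int (Suc (Suc m)))\<^esub>
      (delta_hs (Suc k) (int (Suc m)) (delta_syz RD k (int m) x))"
proof -
  obtain f where f: "f \<in> cocycles \<C> RA (Syz RD k) m" and x_eq: "x = ext_class \<C> RA (Syz RD k) m f"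
    using x by (auto simp: carrier_Ext)
  have f_Arr: "f \<in> Arr \<C>" "Dom \<C> f = Pr RA m" "Cod \<C> f = Syz RD k" using f by (simp_all add: cocycles_iff)
  obtain w where w: "delta_rel RA (Syz RB k) (Syz RC k) (SU k) (SV k) m f w"
    using delta_rel_ex[OF A SU_Hom SV_Hom kernel_SU epi_SV f] by blast
  then obtain g where g_Hom: "g \<in> Hom \<C> (Pr RA m) (Syz RC k)" and SVg: "SV k \<cdot> g = f"
    and w_Hom: "w \<in> Hom \<C> (Pr RA (Suc m)) (Syz RB k)" and SUw: "SU k \<cdot> w = g \<cdot> Df RA (Suc m)"
    unfolding delta_rel_def by blast
  have w_coc: "w \<in> cocycles \<C> RA (Syz RB k) (Suc m)"
    using delta_rel_cocycle[OF A SU_Hom kernel_SU w] .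
  note g = g_Hom[unfolded Hom_iff]
  have "\<exists>G. G \<in> Arr \<C> \<and> Dom \<C> G = Pr RA m \<and> Cod \<C> G = Pr RC k \<and> Epi RC k \<cdot> G = g"
    using projective_lift[OF projective_Pr[OF A] epi_Epi[OF C], of g m k] g by simp
  then obtain G where G: "G \<in> Arr \<C>" "Dom \<C> G = Pr RA m" "Cod \<C> G = Pr RC k" and EG: "Epi RC k \<cdot> G = g"
    by blast
  have EVG: "Epi RD k \<cdot> (V k \<cdot> G) = f" using G by (simp add: squares EG SVg)
  then have "Epi RD k \<cdot> (V k \<cdot> (G \<cdot> Df RA (Suc m))) = f \<cdot> Df RA (Suc m)"
    using G by (simp add: Cmp_assoc_Arr flip: EVG)
  then have "Epi RD k \<cdot> (V k \<cdot> (G \<cdot> Df RA (Suc m))) = Nul \<C> (Pr RA (Suc m)) (Syz RD k)"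
    using f by (simp add: cocycle_Df)
  then have "\<exists>w'. w' \<in> Arr \<C> \<and> Dom \<C> w' = Pr RA (Suc m) \<and> Cod \<C> w' = Syz RD (Suc k) \<and>
      Inc RD (Suc k) \<cdot> w' = V k \<cdot> (G \<cdot> Df RA (Suc m))"
    using kernel_factor[OF kernel_Inc[OF D], of "V k \<cdot> (G \<cdot> Df RA (Suc m))" k] G by simp
  then obtain w' where w': "w' \<in> Arr \<C>" "Dom \<C> w' = Pr RA (Suc m)" "Cod \<C> w' = Syz RD (Suc k)"
      and Iw': "Inc RD (Suc k) \<cdot> w' = V k \<cdot> (G \<cdot> Df RA (Suc m))"
    by blast
  have rel_w': "delta_rel RA (Syz RD (Suc k)) (Pr RD k) (Inc RD (Suc k)) (Epi RD k) m f w'"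
    unfolding delta_rel_def using G w' EVG Iw' by (intro exI[of _ "V k \<cdot> G"]) (simp add: Hom_iff Cmp_assoc_Arr)
  have IncD_Hom: "Inc RD (Suc k) \<in> Hom \<C> (Syz RD (Suc k)) (Pr RD k)" and EpiD_Hom: "Epi RD k \<in> Hom \<C> (Pr RD k) (Syz RD k)"
    and IncB_Hom: "Inc RB (Suc k) \<in> Hom \<C> (Syz RB (Suc k)) (Pr RB k)" and EpiB_Hom: "Epi RB k \<in> Hom \<C> (Pr RB k) (Syz RB k)"
    by (simp_all add: Hom_iff)
  have w'_coc: "w' \<in> cocycles \<C> RA (Syz RD (Suc k)) (Suc m)"
    using delta_rel_cocycle[OF A IncD_Hom kernel_Inc[OF D] rel_w'] .
  obtain v where rel_v: "delta_rel RA (Syz RB (Suc k)) (Pr RB k) (Inc RB (Suc k)) (Epi RB k) (Suc m) w v"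
    using delta_rel_ex[OF A IncB_Hom EpiB_Hom kernel_Inc[OF B] epi_Epi[OF B] w_coc] by blast
  then obtain H where H_Hom: "H \<in> Hom \<C> (Pr RA (Suc m)) (Pr RB k)" and EH: "Epi RB k \<cdot> H = w"
    and v_Hom: "v \<in> Hom \<C> (Pr RA (Suc (Suc m))) (Syz RB (Suc k))"
    and Iv: "Inc RB (Suc k) \<cdot> v = H \<cdot> Df RA (Suc (Suc m))"
    unfolding delta_rel_def by blast
  have v_coc: "v \<in> cocycles \<C> RA (Syz RB (Suc k)) (Suc (Suc m))"
    using delta_rel_cocycle[OF A IncB_Hom kernel_Inc[OF B] rel_v] .
  note H = H_Hom[unfolded Hom_iff] and v = v_Hom[unfolded Hom_iff]
  \<comment> \<open>Under \<open>Epi RC k\<close> the two terms give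
    \<open>g \<cdot> \<partial>\<close> and \<open>SU k \<cdot> w\<close>, which agree by the choice
    of \<open>w\<close>. Hence \<open>E\<close> comes from an arrow \<open>z\<close> into the next
    syzygy of \<open>C\<close>.\<close>
  define E where "E = G \<cdot> Df RA (Suc m) \<^bold>+ \<^bold>- (U k \<cdot> H)"
  have E: "E \<in> Arr \<C>" "Dom \<C> E = Pr RA (Suc m)" "Cod \<C> E = Pr RC k" using G H by (simp_all add: E_def)
  have "Epi RC k \<cdot> E = Nul \<C> (Pr RA (Suc m)) (Syz RC k)"
    using G H g by (simp add: E_def squares EH SUw Cmp_eq_assoc1[OF EG])
  then have "\<exists>z. z \<in> Arr \<C> \<and> Dom \<C> z = Pr RA (Suc m) \<and> Cod \<C> z = Syz RC (Suc k) \<and> Inc RC (Suc k) \<cdot> z = E"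
    using kernel_factor[OF kernel_Inc[OF C], of E k] E by simp
  then obtain z where z: "z \<in> Arr \<C>" "Dom \<C> z = Pr RA (Suc m)" "Cod \<C> z = Syz RC (Suc k)"
    and Iz: "Inc RC (Suc k) \<cdot> z = E" by blast
  \<comment> \<open>\<open>V k\<close> removes the term with \<open>U k\<close>, so \<open>z\<close>
    lifts the cocycle \<open>w'\<close>.\<close>
  have "Inc RD (Suc k) \<cdot> (SV (Suc k) \<cdot> z) = V k \<cdot> E" using z by (simp add: squares Iz)
  also have "\<dots> = Inc RD (Suc k) \<cdot> w'" using G H by (simp add: E_def squares Iw')
  finally have SVz: "SV (Suc k) \<cdot> z = w'"
    by (rule kernel_cancel[OF kernel_Inc[OF D]]) (use z w' in simp_all)
  \<comment> \<open>After the next differential the term with \<open>G\<close> dies by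
    \<open>\<partial> \<cdot> \<partial> = 0\<close>; what is left is minus the arrow that defines
    \<open>v\<close>, and this is where the sign arises.\<close>
  have "Inc RC (Suc k) \<cdot> (SU (Suc k) \<cdot> \<^bold>- v) = \<^bold>- (U k \<cdot> (H \<cdot> Df RA (Suc (Suc m))))"
    using v by (simp add: squares Iv)
  also have "\<dots> = E \<cdot> Df RA (Suc (Suc m))"
    using G H by (simp add: E_def Cmp_assoc_Arr Df_Df)
  also have "\<dots> = Inc RC (Suc k) \<cdot> (z \<cdot> Df RA (Suc (Suc m)))"
    using z by (simp add: Cmp_eq_assoc1[OF Iz])
  finally have "SU (Suc k) \<cdot> \<^bold>- v = z \<cdot> Df RA (Suc (Suc m))"
    by (rule kernel_cancel[OF kernel_Inc[OF C]]) (use z v in simp_all)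
  then have rel_neg: "delta_rel RA (Syz RB (Suc k)) (Syz RC (Suc k)) (SU (Suc k)) (SV (Suc k)) (Suc m) w' (\<^bold>- v)"
    unfolding delta_rel_def using z v SVz by (intro exI[of _ z]) (simp add: Hom_iff)
  have "delta_syz RB k (int (Suc m)) (delta_hs k (int m) x) = ext_class \<C> RA (Syz RB (Suc k)) (Suc (Suc m)) v"
    unfolding x_eq delta_ext_class[OF A SU_Hom SV_Hom kernel_SU epi_SV f w]
    by (rule delta_ext_class[OF A IncB_Hom EpiB_Hom kernel_Inc[OF B] epi_Epi[OF B] w_coc rel_v])
  moreover have "delta_hs (Suc k) (int (Suc m)) (delta_syz RD k (int m) x) =
      ext_class \<C> RA (Syz RB (Suc k)) (Suc (Suc m)) (\<^bold>- v)"
    unfolding x_eq delta_ext_class[OF A IncD_Hom EpiD_Hom kernel_Inc[OF D] epi_Epi[OF D] f rel_w']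
    by (rule delta_ext_class[OF A SU_Hom SV_Hom kernel_SU epi_SV w'_coc rel_neg])
  moreover have "\<^bold>- v \<in> cocycles \<C> RA (Syz RB (Suc k)) (Suc (Suc m))"
    using delta_rel_cocycle[OF A SU_Hom kernel_SU rel_neg] .
  ultimately show ?thesis using v by (simp add: inv_ext_class del: of_nat_Suc)
qed

text \<open>\<open>delta_hat\<close> is a limit over all \<open>k\<close>, so stages of negative
  degree are included. There both sides are the unit; for \<open>j = -1\<close> the outer maps start
  in degree 0, but they are applied to the unit.\<close>

lemma delta_syz_delta_hs:
  assumes x: "x \<in> carrier (Ext \<C> RA (Syz RD k) j)"
  shows "delta_syz RB k (j + 1) (delta_hs k j x) =
    inv\<^bsub>Ext \<C> RA (Syz RB (Suc k)) (j + 1 + 1)\<^esub> (delta_hs (Suc k) (j + 1) (delta_syz RD k j x))"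
proof (cases "j < 0")
  case False
  then obtain m where j: "j = int m" using nonneg_int_cases by (metis not_less)
  have Suc: "int m + 1 = int (Suc m)" "int (Suc m) + 1 = int (Suc (Suc m))" by simp_all
  show ?thesis unfolding j Suc by (rule delta_syz_delta_hs_nat[OF x[unfolded j]])
next
  case True
  have grp: "group (Ext \<C> RA (Syz R k) i)" if "syz_chain R" for R k i
    using that comm_group.axioms(2)[OF comm_group_Ext[OF A, of "Syz R k" i]] by simp
  have "delta_hs k j x = \<one>\<^bsub>Ext \<C> RA (Syz RB k) (j + 1)\<^esub>"
    "delta_syz RD k j x = \<one>\<^bsub>Ext \<C> RA (Syz RD (Suc k)) (j + 1)\<^esub>"
    using True by (simp_all add: delta_def)
  moreover have "delta_syz RB k (j + 1) \<one>\<^bsub>Ext \<C> RA (Syz RB k) (j + 1)\<^esub> =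
      \<one>\<^bsub>Ext \<C> RA (Syz RB (Suc k)) (j + 1 + 1)\<^esub>"
    by (intro hom_one[OF delta_syz_hom] grp B)
  moreover have "delta_hs (Suc k) (j + 1) \<one>\<^bsub>Ext \<C> RA (Syz RD (Suc k)) (j + 1)\<^esub> =
      \<one>\<^bsub>Ext \<C> RA (Syz RB (Suc k)) (j + 1 + 1)\<^esub>"
    by (intro hom_one[OF delta_hs_hom] grp B D)
  moreover have "inv\<^bsub>Ext \<C> RA (Syz RB (Suc k)) (j + 1 + 1)\<^esub> \<one>\<^bsub>Ext \<C> RA (Syz RB (Suc k)) (j + 1 + 1)\<^esub> =
      \<one>\<^bsub>Ext \<C> RA (Syz RB (Suc k)) (j + 1 + 1)\<^esub>"
    by (intro monoid.inv_one group.is_monoid grp B)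
  ultimately show ?thesis by (simp only:)
qed

end

section \<open>The direct systems and the maps between them\<close>

context projective_cat
begin

lemma group_dirsys_Ext:
  assumes A: "syz_chain RA" and Y: "syz_chain RY"
  shows "group_dirsys (Ext_sys \<C> RA RY n)"
proof (rule group_dirsys.intro)
  fix k
  have Suc: "n + int (Suc k) = n + int k + 1" by simp
  show "group (Grp (Ext_sys \<C> RA RY n) k)"
    using A Y by (simp add: Ext_sys_def comm_group.axioms(2)[OF comm_group_Ext])
  show "Tr (Ext_sys \<C> RA RY n) k \<in> hom (Grp (Ext_sys \<C> RA RY n) k) (Grp (Ext_sys \<C> RA RY n) (Suc k))"
    unfolding Ext_sys_def dirsys.simps Suc using Y
    by (intro delta_hom A kernel_Inc epi_Epi) (simp_all add: Hom_iff)
qed (simp add: Ext_sys_def)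

lemma group_dirsys_BC:
  assumes A: "syz_chain RA" and Y: "syz_chain RY"
  shows "group_dirsys (BC_sys \<C> RA RY n)"
proof (rule group_dirsys.intro)
  fix k assume "k \<in> Ix (BC_sys \<C> RA RY n)"
  then have "0 \<le> n + int k" by (simp add: BC_sys_def)
  then have Suc: "nat (n + int (Suc k)) = Suc (nat (n + int k))" by simp
  show "Tr (BC_sys \<C> RA RY n) k \<in> hom (Grp (BC_sys \<C> RA RY n) k) (Grp (BC_sys \<C> RA RY n) (Suc k))"
    unfolding BC_sys_def dirsys.simps Suc by (intro t_map_hom A Y)
  show "group (Grp (BC_sys \<C> RA RY n) k)"
    using A Y by (simp add: BC_sys_def comm_group.axioms(2)[OF comm_group_st_hom])
qed (simp add: BC_sys_def)

lemma dirsys_map_beta: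
  assumes A: "syz_chain RA" and Y: "syz_chain RY"
  shows "dirsys_map (Ext_sys \<C> RA RY n) (BC_sys \<C> RA RY n) {k. n + int k \<ge> 1}
    (\<lambda>k. beta \<C> RA (Syz RY k) (nat (n + int k)))"
proof (intro dirsys_map.intro dirsys_map_axioms.intro group_dirsys_Ext group_dirsys_BC A Y)
  fix k assume "k \<in> {k. n + int k \<ge> 1}"
  then have "1 \<le> n + int k" by simp
  then obtain l where l: "n + int k = int (Suc l)" "nat (n + int k) = Suc l"
    using positive_int_cases[of "n + int k"] by blast
  have Suc: "nat (n + int (Suc k)) = Suc (Suc l)" using l by simp
  show "beta \<C> RA (Syz RY k) (nat (n + int k)) \<in> hom (Grp (Ext_sys \<C> RA RY n) k) (Grp (BC_sys \<C> RA RY n) k)"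
    unfolding Ext_sys_def BC_sys_def dirsys.simps l(1) nat_int using Y by (intro beta_hom A) simp
  fix x assume "x \<in> carrier (Grp (Ext_sys \<C> RA RY n) k)"
  then have "x \<in> carrier (Ext \<C> RA (Syz RY k) (int (Suc l)))" by (simp only: Ext_sys_def dirsys.simps l)
  then show "beta \<C> RA (Syz RY (Suc k)) (nat (n + int (Suc k))) (Tr (Ext_sys \<C> RA RY n) k x) =
      Tr (BC_sys \<C> RA RY n) k (beta \<C> RA (Syz RY k) (nat (n + int k)) x)"
    unfolding Ext_sys_def BC_sys_def dirsys.simps Suc l(1) nat_int by (rule t_map_beta[OF A Y, symmetric])
next
  \<comment> \<open>From any stage, \<open>nat (1 - n)\<close> further steps reach
    \<open>n + k \<ge> 1\<close>.\<close>
  fix k show "\<exists>i. k + i \<in> {k. n + int k \<ge> 1}" by (intro exI[of _ "nat (1 - n)"]) simp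
qed (simp_all add: Ext_sys_def BC_sys_def)

end

context syz_horseshoe
begin

abbreviation sgn_tau where "sgn_tau \<equiv> signed_tau \<C> RA RB RC RD SU SV"

lemma signed_tau_hom:
  "sgn_tau m k \<in> hom (st_hom \<C> (Syz RA m) (Syz RD k)) (st_hom \<C> (Syz RA (Suc m)) (Syz RB k))"
  using hom_int_power[OF tau_hom comm_group_st_hom, of m k "(-1) ^ k"]
  by (simp add: signed_tau_def[abs_def])

text \<open>The homomorphism \<open>t_map\<close> passes through the power, \<open>t_map_tau\<close>
  contributes an inverse, and \<open>inv_sign_power\<close> absorbs it into the next sign.\<close>

lemma t_map_signed_tau:
  assumes x: "x \<in> carrier (st_hom \<C> (Syz RA m) (Syz RD k))"
  shows "t_map \<C> RA RB (Suc m) k (sgn_tau m k x) = sgn_tau (Suc m) (Suc k) (t_map \<C> RA RD m k x)"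
proof -
  let ?H = "st_hom \<C> (Syz RA (Suc (Suc m))) (Syz RB (Suc k))"
  let ?y = "tau \<C> RA RB RC RD SU SV (Suc m) (Suc k) (t_map \<C> RA RD m k x)"
  interpret G: comm_group "st_hom \<C> (Syz RA (Suc m)) (Syz RB k)" by (rule comm_group_st_hom) simp_all
  interpret H: comm_group ?H by (rule comm_group_st_hom) simp_all
  have y: "?y \<in> carrier ?H"
    using x t_map_hom[OF A D, of m k] tau_hom[of "Suc m" "Suc k"] by (auto simp: hom_def)
  have tau: "tau \<C> RA RB RC RD SU SV m k x \<in> carrier (st_hom \<C> (Syz RA (Suc m)) (Syz RB k))"
    using x tau_hom[of m k] by (auto simp: hom_def)
  have "t_map \<C> RA RB (Suc m) k (sgn_tau m k x) = (inv\<^bsub>?H\<^esub> ?y) [^]\<^bsub>?H\<^esub> ((-1 :: int) ^ k)"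
    unfolding signed_tau_def t_map_tau[OF x, symmetric]
    by (rule hom_int_pow[OF t_map_hom[OF A B] tau G.is_group H.is_group])
  also have "\<dots> = sgn_tau (Suc m) (Suc k) (t_map \<C> RA RD m k x)"
    unfolding signed_tau_def using y by (rule H.inv_sign_power)
  finally show ?thesis .
qed

lemma dirsys_map_tau:
  "dirsys_map (BC_sys \<C> RA RD n) (BC_sys \<C> RA RB (n + 1)) {k. n + int k \<ge> 1}
    (\<lambda>k. sgn_tau (nat (n + int k)) k)"
proof (intro dirsys_map.intro dirsys_map_axioms.intro group_dirsys_BC A B D)
  fix k assume "k \<in> {k. n + int k \<ge> 1}"
  \<comment> \<open>Since \<open>n + k\<close> is not negative, \<open>nat\<close> does not
    truncate, and degree \<open>n + 1 + k\<close> of the target system is the successor of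
    \<open>nat (n + k)\<close>.\<close>
  then have Suc: "nat (n + 1 + int k) = Suc (nat (n + int k))" "nat (n + int (Suc k)) = Suc (nat (n + int k))"
    by simp_all
  show "sgn_tau (nat (n + int k)) k \<in> hom (Grp (BC_sys \<C> RA RD n) k) (Grp (BC_sys \<C> RA RB (n + 1)) k)"
    unfolding BC_sys_def dirsys.simps Suc by (rule signed_tau_hom)
  fix x assume "x \<in> carrier (Grp (BC_sys \<C> RA RD n) k)"
  then have "x \<in> carrier (st_hom \<C> (Syz RA (nat (n + int k))) (Syz RD k))" by (simp add: BC_sys_def)
  then show "sgn_tau (nat (n + int (Suc k))) (Suc k) (Tr (BC_sys \<C> RA RD n) k x) =
      Tr (BC_sys \<C> RA RB (n + 1)) k (sgn_tau (nat (n + int k)) k x)"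
    unfolding BC_sys_def dirsys.simps Suc by (rule t_map_signed_tau[symmetric])
next
  fix k show "\<exists>i. k + i \<in> {k. n + int k \<ge> 1}" by (intro exI[of _ "nat (1 - n)"]) simp
qed (simp_all add: BC_sys_def)

lemma dirsys_map_delta:
  "dirsys_map (Ext_sys \<C> RA RD n) (Ext_sys \<C> RA RB (n + 1)) UNIV
    (\<lambda>k x. delta_hs k (n + int k) x [^]\<^bsub>Ext \<C> RA (Syz RB k) (n + int k + 1)\<^esub> ((-1 :: int) ^ k))"
proof (intro dirsys_map.intro dirsys_map_axioms.intro group_dirsys_Ext A B D)
  fix k
  have j: "n + 1 + int k = n + int k + 1" "n + int (Suc k) = n + int k + 1" by simp_all
  show "(\<lambda>x. delta_hs k (n + int k) x [^]\<^bsub>Ext \<C> RA (Syz RB k) (n + int k + 1)\<^esub> ((-1 :: int) ^ k))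
      \<in> hom (Grp (Ext_sys \<C> RA RD n) k) (Grp (Ext_sys \<C> RA RB (n + 1)) k)"
    unfolding Ext_sys_def dirsys.simps j by (intro hom_int_power delta_hs_hom comm_group_Ext) simp_all
  fix x assume "x \<in> carrier (Grp (Ext_sys \<C> RA RD n) k)"
  then have x: "x \<in> carrier (Ext \<C> RA (Syz RD k) (n + int k))" by (simp add: Ext_sys_def)
  let ?H = "Ext \<C> RA (Syz RB (Suc k)) (n + int k + 1 + 1)"
  let ?y = "delta_hs (Suc k) (n + int k + 1) (delta_syz RD k (n + int k) x)"
  interpret G: comm_group "Ext \<C> RA (Syz RB k) (n + int k + 1)" by (rule comm_group_Ext) simp_all
  interpret H: comm_group ?H by (rule comm_group_Ext) simp_all
  have y: "?y \<in> carrier ?H"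
    using x delta_syz_hom[OF D, of k "n + int k"] delta_hs_hom[of "Suc k" "n + int k + 1"]
    unfolding hom_def by blast
  have d: "delta_hs k (n + int k) x \<in> carrier (Ext \<C> RA (Syz RB k) (n + int k + 1))"
    using x delta_hs_hom[of k "n + int k"] unfolding hom_def by blast
  have "delta_syz RB k (n + int k + 1)
      (delta_hs k (n + int k) x [^]\<^bsub>Ext \<C> RA (Syz RB k) (n + int k + 1)\<^esub> ((-1 :: int) ^ k)) =
      (inv\<^bsub>?H\<^esub> ?y) [^]\<^bsub>?H\<^esub> ((-1 :: int) ^ k)"
    unfolding delta_syz_delta_hs[OF x, symmetric]
    by (rule hom_int_pow[OF delta_syz_hom[OF B] d G.is_group H.is_group])
  also have "\<dots> = ?y [^]\<^bsub>?H\<^esub> ((-1 :: int) ^ Suc k)"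
    using y by (rule H.inv_sign_power)
  finally show "delta_hs (Suc k) (n + int (Suc k)) (Tr (Ext_sys \<C> RA RD n) k x)
        [^]\<^bsub>Ext \<C> RA (Syz RB (Suc k)) (n + int (Suc k) + 1)\<^esub> ((-1 :: int) ^ Suc k) =
      Tr (Ext_sys \<C> RA RB (n + 1)) k
        (delta_hs k (n + int k) x [^]\<^bsub>Ext \<C> RA (Syz RB k) (n + int k + 1)\<^esub> ((-1 :: int) ^ k))"
    unfolding Ext_sys_def dirsys.simps j by (rule sym)
qed (simp_all add: Ext_sys_def)

end

theorem theorem5p11:
  fixes \<C> :: "('o, 'm) cat"
    and A B C D :: 'o and i p :: 'm
    and RA RB RC RD :: "('o, 'm) resolution"
    and U V SU SV :: "nat \<Rightarrow> 'm"
    and n :: int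
  assumes "abelian_cat \<C>" and "enough_projectives \<C>"
    and "short_exact \<C> B C D i p"
    and "horseshoe \<C> B C D i p RB RC RD U V SU SV"
    and "A \<in> Obj \<C>" and "syz_resolution \<C> A RA"
  shows "(\<forall>k m. n + int k \<ge> 1 \<and> m = nat (n + int k) \<longrightarrow>
            (\<forall>x\<in>carrier (Ext \<C> RA (Syz RD k) (n + int k)).
               tau \<C> RA RB RC RD SU SV m k (beta \<C> RA (Syz RD k) m x)
               = beta \<C> RA (Syz RB k) (Suc m)
                   (delta \<C> RA (Syz RB k) (Syz RC k) (SU k) (SV k) (n + int k) x)) \<and>
            (\<forall>x\<in>carrier (st_hom \<C> (Syz RA m) (Syz RD k)).
               t_map \<C> RA RB (Suc m) k (signed_tau \<C> RA RB RC RD SU SV m k x)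
               = signed_tau \<C> RA RB RC RD SU SV (Suc m) (Suc k) (t_map \<C> RA RD m k x)))
       \<and> tau_hat \<C> RA RB RC RD SU SV n \<in> hom (BC \<C> RA RD n) (BC \<C> RA RB (n + 1))
       \<and> (\<forall>k. n + int k \<ge> 1 \<longrightarrow>
            (\<forall>x\<in>carrier (st_hom \<C> (Syz RA (nat (n + int k))) (Syz RD k)).
               tau_hat \<C> RA RB RC RD SU SV n (dl_class (BC_sys \<C> RA RD n) k x)
               = dl_class (BC_sys \<C> RA RB (n + 1)) k
                   (signed_tau \<C> RA RB RC RD SU SV (nat (n + int k)) k x)))
       \<and> (\<forall>c\<in>carrier (Ext_hat \<C> RA RD n).
            tau_hat \<C> RA RB RC RD SU SV n (beta_hat \<C> RA RD n c)
            = beta_hat \<C> RA RB (n + 1) (delta_hat \<C> RA RB RC SU SV n c))"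
proof -
  interpret projective_cat \<C>
    using assms(1,2) by (intro projective_cat.intro projective_cat_axioms.intro)
  have ses: "short_exact \<C> (Pr RB k) (Pr RC k) (Pr RD k) (U k) (V k)"
      "short_exact \<C> (Syz RB k) (Syz RC k) (Syz RD k) (SU k) (SV k)" for k
    using assms(4) by (simp_all add: horseshoe_def)
  interpret syz_horseshoe \<C> RA RB RC RD U V SU SV
  proof
    show "syz_chain RA" using assms(6) by (rule syz_resolution_imp_chain)
    show "syz_chain RB" "syz_chain RC" "syz_chain RD"
      using assms(4) syz_resolution_imp_chain unfolding horseshoe_def by blast+
    fix k
    show "U k \<in> Hom \<C> (Pr RB k) (Pr RC k)" "V k \<in> Hom \<C> (Pr RC k) (Pr RD k)" "is_epi \<C> (V k)"
      "SU k \<in> Hom \<C> (Syz RB k) (Syz RC k)" "SV k \<in> Hom \<C> (Syz RC k) (Syz RD k)" "is_epi \<C> (SV k)"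
      using ses[of k] by (simp_all add: short_exact_def)
    show "is_kernel \<C> (V k) (U k)" "is_kernel \<C> (SV k) (SU k)"
      by (rule ses[THEN short_exact_kernel])+
    show "Epi RC k \<cdot>\<^bsub>\<C>\<^esub> U k = SU k \<cdot>\<^bsub>\<C>\<^esub> Epi RB k" "Epi RD k \<cdot>\<^bsub>\<C>\<^esub> V k = SV k \<cdot>\<^bsub>\<C>\<^esub> Epi RC k"
      "Inc RC (Suc k) \<cdot>\<^bsub>\<C>\<^esub> SU (Suc k) = U k \<cdot>\<^bsub>\<C>\<^esub> Inc RB (Suc k)"
      "Inc RD (Suc k) \<cdot>\<^bsub>\<C>\<^esub> SV (Suc k) = V k \<cdot>\<^bsub>\<C>\<^esub> Inc RC (Suc k)"
      using assms(4) by (simp_all add: horseshoe_def)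
  qed
  interpret tau: dirsys_map "BC_sys \<C> RA RD n" "BC_sys \<C> RA RB (n + 1)" "{k. n + int k \<ge> 1}"
    "\<lambda>k. sgn_tau (nat (n + int k)) k"
    by (rule dirsys_map_tau)
  interpret beta: dirsys_map "Ext_sys \<C> RA RD n" "BC_sys \<C> RA RD n" "{k. n + int k \<ge> 1}"
    "\<lambda>k. beta \<C> RA (Syz RD k) (nat (n + int k))"
    by (intro dirsys_map_beta) simp_all
  \<comment> \<open>In degree \<open>n + 1\<close> the components of \<open>beta\<close> are
    available from \<open>n + k = 0\<close> on, so every stage usable for \<open>tau\<close> is
    usable here.\<close>
  interpret beta': dirsys_map "Ext_sys \<C> RA RB (n + 1)" "BC_sys \<C> RA RB (n + 1)" "{k. n + 1 + int k \<ge> 1}"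
    "\<lambda>k. beta \<C> RA (Syz RB k) (nat (n + 1 + int k))"
    by (intro dirsys_map_beta) simp_all
  interpret delta: dirsys_map "Ext_sys \<C> RA RD n" "Ext_sys \<C> RA RB (n + 1)" UNIV
    "\<lambda>k x. delta_hs k (n + int k) x [^]\<^bsub>Ext \<C> RA (Syz RB k) (n + int k + 1)\<^esub> ((-1 :: int) ^ k)"
    by (rule dirsys_map_delta)
  have tau_beta_level: "tau \<C> RA RB RC RD SU SV (nat (n + int k)) k (beta \<C> RA (Syz RD k) (nat (n + int k)) x) =
      beta \<C> RA (Syz RB k) (Suc (nat (n + int k))) (delta_hs k (n + int k) x)"
    if "n + int k \<ge> 1" "x \<in> carrier (Ext \<C> RA (Syz RD k) (n + int k))" for k x
    using positive_int_cases[OF that(1)] that(2) tau_beta by metis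
  have tau_class: "tau_hat \<C> RA RB RC RD SU SV n (dl_class (BC_sys \<C> RA RD n) k x) =
      dl_class (BC_sys \<C> RA RB (n + 1)) k (sgn_tau (nat (n + int k)) k x)"
    if "n + int k \<ge> 1" "x \<in> carrier (st_hom \<C> (Syz RA (nat (n + int k))) (Syz RD k))" for k x
    unfolding tau_hat_def using that by (intro tau.map_dl_class) (simp_all add: BC_sys_def)
  have "tau_hat \<C> RA RB RC RD SU SV n (beta_hat \<C> RA RD n c) =
      beta_hat \<C> RA RB (n + 1) (delta_hat \<C> RA RB RC SU SV n c)"
    if c: "c \<in> carrier (Ext_hat \<C> RA RD n)" for c
  proof -
    \<comment> \<open>Cofinality provides a representative at a stage with
      \<open>n + k \<ge> 1\<close>, where all maps involved are given by components and the identity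
      can be checked before passing to the limit.\<close>
    obtain k x where k: "n + int k \<ge> 1" and x_Grp: "x \<in> carrier (Grp (Ext_sys \<C> RA RD n) k)"
      and c_eq: "c = dl_class (Ext_sys \<C> RA RD n) k x"
      using beta.rep_in_K c unfolding Ext_hat_def by blast
    have x: "x \<in> carrier (Ext \<C> RA (Syz RD k) (n + int k))" using x_Grp by (simp add: Ext_sys_def)
    obtain l where l: "n + int k = int (Suc l)" "nat (n + int k) = Suc l" using positive_int_cases[OF k] by blast
    have m: "nat (n + 1 + int k) = Suc (nat (n + int k))" and j: "n + 1 + int k = n + int k + 1"
      and l': "n + int k + 1 = int (Suc (Suc l))"
      using k l by simp_all
    let ?E = "Ext \<C> RA (Syz RB k) (n + int k + 1)"
    let ?d = "delta_hs k (n + int k) x"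
    have d: "?d \<in> carrier ?E" using x delta_hs_hom[of k "n + int k"] unfolding hom_def by blast
    have pow: "?d [^]\<^bsub>?E\<^esub> ((-1 :: int) ^ k) \<in> carrier (Grp (Ext_sys \<C> RA RB (n + 1)) k)"
      using delta.\<phi>_closed[OF _ x_Grp] by simp
    have "beta \<C> RA (Syz RD k) (nat (n + int k)) x \<in> carrier (st_hom \<C> (Syz RA (nat (n + int k))) (Syz RD k))"
      using beta.\<phi>_closed[OF _ x_Grp] k by (simp add: BC_sys_def)
    then have "tau_hat \<C> RA RB RC RD SU SV n (beta_hat \<C> RA RD n c) =
        dl_class (BC_sys \<C> RA RB (n + 1)) k (sgn_tau (nat (n + int k)) k (beta \<C> RA (Syz RD k) (nat (n + int k)) x))"
      unfolding c_eq beta_hat_def using k x_Grp by (simp add: beta.map_dl_class tau_class)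
    \<comment> \<open>The sign is a power in the stable Hom group on one side and in Ext on the
      other; \<open>beta\<close> is a homomorphism and carries one to the other.\<close>
    also have "sgn_tau (nat (n + int k)) k (beta \<C> RA (Syz RD k) (nat (n + int k)) x) =
        beta \<C> RA (Syz RB k) (Suc (Suc l)) (?d [^]\<^bsub>?E\<^esub> ((-1 :: int) ^ k))"
      unfolding signed_tau_def tau_beta_level[OF k x] unfolding l(2)
    proof (rule hom_int_pow[symmetric])
      show "beta \<C> RA (Syz RB k) (Suc (Suc l)) \<in> hom ?E (st_hom \<C> (Syz RA (Suc (Suc l))) (Syz RB k))"
        unfolding l' by (rule beta_hom) simp_all
      show "group ?E" "group (st_hom \<C> (Syz RA (Suc (Suc l))) (Syz RB k))"
        by (simp_all add: comm_group.axioms(2) comm_group_Ext comm_group_st_hom)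
    qed (rule d)
    also have "dl_class (BC_sys \<C> RA RB (n + 1)) k \<dots> =
        beta_hat \<C> RA RB (n + 1) (dl_class (Ext_sys \<C> RA RB (n + 1)) k (?d [^]\<^bsub>?E\<^esub> ((-1 :: int) ^ k)))"
      unfolding beta_hat_def using beta'.map_dl_class[OF _ pow] k m l(2) by simp
    also have "dl_class (Ext_sys \<C> RA RB (n + 1)) k (?d [^]\<^bsub>?E\<^esub> ((-1 :: int) ^ k)) = delta_hat \<C> RA RB RC SU SV n c"
      unfolding c_eq delta_hat_def using delta.map_dl_class[OF _ x_Grp] by simp
    finally show ?thesis .
  qed
  moreover have "tau_hat \<C> RA RB RC RD SU SV n \<in> hom (BC \<C> RA RD n) (BC \<C> RA RB (n + 1))"
    unfolding tau_hat_def BC_def by (rule tau.map_hom)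
  ultimately show ?thesis
    using tau_beta_level t_map_signed_tau tau_class by blast
qed

end
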